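(* Let $\mathbb G$ be a positively gradable Lie group and let $\alpha\in\ker\Box_0\cap\Omega^{k-1}(\mathbb G)$ be a Rumin form. Then one can retrieve the whole expression of the Rumin differential $d_c\alpha$ from applying the Leibniz rule recursively (starting from the exterior derivative $d\alpha$), up to forms in $\operatorname{Im}\delta_0$.
   Context: Positively gradable Lie group: a connected, simply connected Lie group $\mathbb{G}$ whose Lie algebra has a decomposition $\mathfrak g=\bigoplus_{i=1}^s\mathfrak g_{w_i}$ with integers $0<w_1<\dots<w_s$ and $[\mathfrak g_{w_i},\mathfrak g_{w_j}]\subseteq\mathfrak g_{w_i+w_j}$ (with $\mathfrak g_w=0$ if $w$ is not one of the $w_i$); such a decomposition is fixed. Weights: a left-invariant 1-form that vanishes on all layers except $\mathfrak g_{w_i}$ has weight $w_i$; a wedge product of such forms has weight the sum of the weights. A smooth $k$-form has weight $p$ if it is a $C^\infty(\mathbb G)$-combination of left-invariant $k$-forms of weight $p$. The exterior derivative splits as $d=d_0+d_1+\dots+d_{w_s}$, where $d_i$ raises the weight by exactly $i$; $d_0$ is $C^\infty(\mathbb G)$-linear and coincides with $d$ on left-invariant forms. Fix a scalar product on $\mathfrak g$ for which the layers $\mathfrak g_{w_i}$ are mutually orthogonal; it induces scalar products on $\bigwedge^k\mathfrak g^*$ and on forms. $\delta_0$ is the ($C^\infty$-linear) adjoint of $d_0$, and $\Box_0=d_0\delta_0+\delta_0d_0$; there is an orthogonal decomposition $\Omega^\bullet(\mathbb G)=\operatorname{Im}d_0\oplus\ker\Box_0\oplus\operatorname{Im}\delta_0$.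 $d_0^{-1}:\Omega^{k}(\mathbb G)\to\Omega^{k-1}(\mathbb G)$ is the inverse of the bijection $d_0:\operatorname{Im}\delta_0=(\ker d_0)^\perp\to\operatorname{Im}d_0$ precomposed with the orthogonal projection onto $\operatorname{Im}d_0$. Rumin complex: $E_0^k=\ker\Box_0\cap\Omega^k(\mathbb G)$ (Rumin forms); $\Pi_0=\mathrm{Id}-d_0d_0^{-1}-d_0^{-1}d_0$ (orthogonal projection onto $E_0^\bullet$); $b=-d_0^{-1}(d-d_0)$ is nilpotent; $\Pi=(\mathrm{Id}-b)^{-1}d_0^{-1}d+d(\mathrm{Id}-b)^{-1}d_0^{-1}$; $\Pi_E=\mathrm{Id}-\Pi$; the Rumin differential is $d_c=\Pi_0\,d\,\Pi_E:E_0^{k}\to E_0^{k+1}$. Meaning of "applying the Leibniz rule recursively": one splits $d\alpha$ along the decomposition $\operatorname{Im}d_0\oplus\ker\Box_0\oplus\operatorname{Im}\delta_0$, and rewrites each $\operatorname{Im}d_0$-component by means of the identity $d_0d_0^{-1}\xi=d\big[d_0^{-1}\xi\big]-(d-d_0)d_0^{-1}\xi$; the term $(d-d_0)d_0^{-1}\xi$ is of strictly higher weight and is split again in the same way, and so on, the procedure stopping after finitely many steps because weights are bounded. "Up to forms in $\operatorname{Im}\delta_0$" refers both to the primitives $d_0^{-1}\xi\in\operatorname{Im}\delta_0$ that are collected under $d$ and to the $\operatorname{Im}\delta_0$-components left over. *)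

theory Defs
  imports "HOL-Analysis.Analysis" "HOL-Library.Function_Algebras"
begin

text \<open>Functions are added, subtracted and multiplied pointwise throughout
  (\<^theory>\<open>HOL-Library.Function_Algebras\<close>).\<close>

subsection \<open>Smooth manifolds\<close>

primrec Ck_on :: "nat \<Rightarrow> ('a::euclidean_space \<Rightarrow> 'b::euclidean_space) \<Rightarrow> 'a set \<Rightarrow> bool" where
  "Ck_on 0 f S \<longleftrightarrow> continuous_on S f"
| "Ck_on (Suc n) f S \<longleftrightarrow>
     (\<exists>f'. (\<forall>x\<in>S. (f has_derivative f' x) (at x)) \<and> (\<forall>v. Ck_on n (\<lambda>x. f' x v) S))"

text \<open>Only used for open \<open>S\<close>.\<close>

definition smooth_on :: "('a::euclidean_space \<Rightarrow> 'b::euclidean_space) \<Rightarrow> 'a set \<Rightarrow> bool" where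
  "smooth_on f S \<longleftrightarrow> (\<forall>n. Ck_on n f S)"

text \<open>A chart is a pair of its domain and its coordinate map; the values of the coordinate
  map outside the domain are irrelevant.\<close>

type_synonym ('m, 'e) atlas = "('m set \<times> ('m \<Rightarrow> 'e)) set"

definition smooth_map ::
  "('m::topological_space, 'a::euclidean_space) atlas \<Rightarrow> ('n::topological_space, 'b::euclidean_space) atlas
     \<Rightarrow> ('m \<Rightarrow> 'n) \<Rightarrow> bool" where
  "smooth_map A B f \<longleftrightarrow> continuous_on UNIV f \<and>
     (\<forall>(U, \<phi>)\<in>A. \<forall>(V, \<psi>)\<in>B. smooth_on (\<psi> \<circ> f \<circ> inv_into U \<phi>) (\<phi> ` (U \<inter> f -` V)))"

definition smooth_atlas :: "('m::topological_space, 'e::euclidean_space) atlas \<Rightarrow> bool" where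
  "smooth_atlas A \<longleftrightarrow>
     (\<Union>(U, \<phi>)\<in>A. U) = UNIV \<and>
     (\<forall>(U, \<phi>)\<in>A. open U \<and> open (\<phi> ` U) \<and> homeomorphism U (\<phi> ` U) \<phi> (inv_into U \<phi>)) \<and>
     smooth_map A A id"

definition prod_atlas :: "('m, 'a) atlas \<Rightarrow> ('n, 'b) atlas \<Rightarrow> ('m \<times> 'n, 'a \<times> 'b) atlas" where
  "prod_atlas A B = {(U \<times> V, map_prod \<phi> \<psi>) | U \<phi> V \<psi>. (U, \<phi>) \<in> A \<and> (V, \<psi>) \<in> B}"

definition smooth_functions :: "('m::topological_space, 'e::euclidean_space) atlas \<Rightarrow> ('m \<Rightarrow> real) set" where
  "smooth_functions A = {f. smooth_map A {(UNIV, id :: real \<Rightarrow> real)} f}"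

subsection \<open>Lie groups with a graded Lie algebra\<close>

text \<open>The type \<open>'v\<close> plays the role of the Lie algebra together with the chosen scalar product:
  \<open>field\<close> identifies \<open>'v\<close> linearly with the left-invariant vector fields, regarded as
  derivations of the algebra of smooth functions. Transporting the inner product of \<open>'v\<close>
  along arbitrary such identifications yields all scalar products on the Lie algebra.
  Since the dimensions agree, \<open>'v\<close> also serves as the model space of the charts.
  \<open>layer w\<close> is the layer of weight \<open>w\<close>.\<close>

record ('g, 'v) graded_group =
  mult :: "'g \<Rightarrow> 'g \<Rightarrow> 'g"
  unit :: 'g
  invert :: "'g \<Rightarrow> 'g"
  charts :: "('g, 'v) atlas"
  field :: "'v \<Rightarrow> ('g \<Rightarrow> real) \<Rightarrow> ('g \<Rightarrow> real)"
  weights :: "nat set"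
  layer :: "nat \<Rightarrow> 'v set"

abbreviation Cinf :: "('g::topological_space, 'v::euclidean_space) graded_group \<Rightarrow> ('g \<Rightarrow> real) set" where
  "Cinf G \<equiv> smooth_functions (charts G)"

definition lie_group ::
  "('g::{t2_space, second_countable_topology}, 'v::euclidean_space) graded_group \<Rightarrow> bool" where
  "lie_group G \<longleftrightarrow>
     smooth_atlas (charts G) \<and>
     group (mult G) (unit G) (invert G) \<and>
     smooth_map (prod_atlas (charts G) (charts G)) (charts G) (\<lambda>(x, y). mult G x y) \<and>
     smooth_map (charts G) (charts G) (invert G)"

text \<open>Only the values of an operator on smooth functions matter.\<close>

definition left_invariant_field ::
  "('g::topological_space, 'v::euclidean_space) graded_group \<Rightarrow> (('g \<Rightarrow> real) \<Rightarrow> ('g \<Rightarrow> real)) \<Rightarrow> bool" where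
  "left_invariant_field G D \<longleftrightarrow>
     (\<forall>f\<in>Cinf G. D f \<in> Cinf G) \<and>
     (\<forall>f\<in>Cinf G. \<forall>h\<in>Cinf G. D (f + h) = D f + D h) \<and>
     (\<forall>c. \<forall>f\<in>Cinf G. D (\<lambda>x. c * f x) = (\<lambda>x. c * D f x)) \<and>
     (\<forall>f\<in>Cinf G. \<forall>h\<in>Cinf G. D (f * h) = f * D h + D f * h) \<and>
     (\<forall>a. \<forall>f\<in>Cinf G. D (f \<circ> mult G a) = D f \<circ> mult G a)"

definition lie_algebra_iso ::
  "('g::topological_space, 'v::euclidean_space) graded_group \<Rightarrow> bool" where
  "lie_algebra_iso G \<longleftrightarrow>
     (\<forall>v. left_invariant_field G (field G v)) \<and>
     (\<forall>D. left_invariant_field G D \<longrightarrow> (\<exists>!v. \<forall>f\<in>Cinf G. field G v f = D f)) \<and>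
     (\<forall>v w. \<forall>f\<in>Cinf G. field G (v + w) f = field G v f + field G w f) \<and>
     (\<forall>c v. \<forall>f\<in>Cinf G. field G (c *\<^sub>R v) f = (\<lambda>x. c * field G v f x))"

definition bracket ::
  "('g::topological_space, 'v::euclidean_space) graded_group \<Rightarrow> 'v \<Rightarrow> 'v \<Rightarrow> 'v" where
  "bracket G v w = (THE u. \<forall>f\<in>Cinf G.
     field G u f = field G v (field G w f) - field G w (field G v f))"

definition orthogonal_grading ::
  "('g::topological_space, 'v::euclidean_space) graded_group \<Rightarrow> bool" where
  "orthogonal_grading G \<longleftrightarrow>
     finite (weights G) \<and> 0 \<notin> weights G \<and>
     (\<forall>w. subspace (layer G w)) \<and>
     (\<forall>w. w \<notin> weights G \<longrightarrow> layer G w = {0}) \<and>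
     (\<forall>v. \<exists>!u. (\<forall>w. u w \<in> layer G w) \<and> v = (\<Sum>w\<in>weights G. u w)) \<and>
     (\<forall>i\<in>weights G. \<forall>j\<in>weights G. \<forall>x\<in>layer G i. \<forall>y\<in>layer G j. bracket G x y \<in> layer G (i + j)) \<and>
     (\<forall>i\<in>weights G. \<forall>j\<in>weights G. i \<noteq> j \<longrightarrow> (\<forall>x\<in>layer G i. \<forall>y\<in>layer G j. x \<bullet> y = 0))"

definition positively_gradable_group ::
  "('g::{t2_space, second_countable_topology}, 'v::euclidean_space) graded_group \<Rightarrow> bool" where
  "positively_gradable_group G \<longleftrightarrow>
     lie_group G \<and> connected (UNIV :: 'g set) \<and> simply_connected (UNIV :: 'g set) \<and>
     lie_algebra_iso G \<and> orthogonal_grading G"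

subsection \<open>Differential forms\<close>

text \<open>By left translation, a \<open>k\<close>-form is a function with values in the alternating \<open>k\<close>-linear
  forms on the Lie algebra: \<open>\<omega> g vs\<close> is its value at the point \<open>g\<close> on the left-invariant vector
  fields in the list \<open>vs\<close> of length \<open>k\<close>. Lists of arbitrary length accommodate forms of mixed
  degree. Left-invariant forms are those not depending on \<open>g\<close>.\<close>

type_synonym ('g, 'v) form = "'g \<Rightarrow> 'v list \<Rightarrow> real"

definition alternating :: "('v::real_vector list \<Rightarrow> real) \<Rightarrow> bool" where
  "alternating a \<longleftrightarrow>
     (\<forall>xs ys. linear (\<lambda>v. a (xs @ v # ys))) \<and> (\<forall>vs. \<not> distinct vs \<longrightarrow> a vs = 0)"

definition forms ::
  "('g::topological_space, 'v::euclidean_space) graded_group \<Rightarrow> ('g, 'v) form set" where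
  "forms G = {\<omega>. (\<forall>g. alternating (\<omega> g)) \<and> (\<forall>vs. (\<lambda>g. \<omega> g vs) \<in> Cinf G)}"

definition kforms ::
  "('g::topological_space, 'v::euclidean_space) graded_group \<Rightarrow> nat \<Rightarrow> ('g, 'v) form set" where
  "kforms G k = {\<omega> \<in> forms G. \<forall>g vs. length vs \<noteq> k \<longrightarrow> \<omega> g vs = 0}"

definition del :: "nat \<Rightarrow> 'v list \<Rightarrow> 'v list" where
  "del i vs = take i vs @ drop (Suc i) vs"

text \<open>The invariant (Koszul) formula for the exterior derivative, evaluated on left-invariant
  vector fields. In the second sum \<open>i < j\<close>, so that \<open>del i (del j vs)\<close> omits the entries
  \<open>i\<close> and \<open>j\<close> of \<open>vs\<close>.\<close>

definition ext_d ::
  "('g::topological_space, 'v::euclidean_space) graded_group \<Rightarrow> ('g, 'v) form \<Rightarrow> ('g, 'v) form" where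
  "ext_d G \<omega> = (\<lambda>g vs.
     (\<Sum>i<length vs. (-1) ^ i * field G (vs ! i) (\<lambda>h. \<omega> h (del i vs)) g) +
     (\<Sum>j<length vs. \<Sum>i<j. (-1) ^ (i + j) * \<omega> g (bracket G (vs ! i) (vs ! j) # del i (del j vs))))"

text \<open>The \<open>C\<^sup>\<infinity>\<close>-linear operator coinciding with the exterior derivative on left-invariant forms:
  its value at \<open>g\<close> is that of the exterior derivative of the left-invariant form that agrees
  with \<open>\<omega>\<close> at \<open>g\<close>.\<close>

definition d0 ::
  "('g::topological_space, 'v::euclidean_space) graded_group \<Rightarrow> ('g, 'v) form \<Rightarrow> ('g, 'v) form" where
  "d0 G \<omega> = (\<lambda>g. ext_d G (\<lambda>_. \<omega> g) g)"

subsection \<open>Weights\<close>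

definition covector_weight ::
  "('g, 'v::euclidean_space) graded_group \<Rightarrow> nat \<Rightarrow> ('v \<Rightarrow> real) \<Rightarrow> bool" where
  "covector_weight G w \<theta> \<longleftrightarrow> w \<in> weights G \<and> linear \<theta> \<and>
     (\<forall>u\<in>weights G. u \<noteq> w \<longrightarrow> (\<forall>v\<in>layer G u. \<theta> v = 0))"

definition wedge :: "('v \<Rightarrow> real) list \<Rightarrow> 'v list \<Rightarrow> real" where
  "wedge \<theta> vs = (if length vs = length \<theta>
     then \<Sum>\<sigma> | \<sigma> permutes {..<length \<theta>}. of_int (sign \<sigma>) * (\<Prod>i<length \<theta>. (\<theta> ! i) (vs ! \<sigma> i))
     else 0)"

definition form_weight ::
  "('g::topological_space, 'v::euclidean_space) graded_group \<Rightarrow> nat \<Rightarrow> nat \<Rightarrow> ('g, 'v) form \<Rightarrow> bool" where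
  "form_weight G k p \<omega> \<longleftrightarrow>
     (\<exists>n f \<theta>. \<omega> = (\<lambda>g vs. \<Sum>j<n. f j g * wedge (\<theta> j) vs) \<and>
       (\<forall>j<(n::nat). f j \<in> Cinf G \<and>
         (\<exists>ws. length ws = k \<and> list_all2 (covector_weight G) ws (\<theta> j) \<and> sum_list ws = p)))"

text \<open>\<open>k\<close>-forms all of whose weight components have weight at least \<open>p\<close>:\<close>

definition form_weight_ge ::
  "('g::topological_space, 'v::euclidean_space) graded_group \<Rightarrow> nat \<Rightarrow> nat \<Rightarrow> ('g, 'v) form \<Rightarrow> bool" where
  "form_weight_ge G k p \<omega> \<longleftrightarrow>
     (\<exists>n c. \<omega> = (\<Sum>j<(n::nat). c j) \<and> (\<forall>j<n. \<exists>q\<ge>p. form_weight G k q (c j)))"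

subsection \<open>The algebraic Hodge decomposition\<close>

text \<open>The scalar product induced on \<open>k\<close>-covectors makes the wedge products of \<open>k\<close> distinct
  elements of a dual orthonormal basis orthonormal. Summing over all lists of basis vectors
  counts each of them \<open>k!\<close> times. The result is a function on the group.\<close>

definition form_inner :: "('g, 'v::euclidean_space) form \<Rightarrow> ('g, 'v) form \<Rightarrow> 'g \<Rightarrow> real" where
  "form_inner \<omega> \<eta> = (\<lambda>g. \<Sum>k\<le>DIM('v).
     (\<Sum>vs | set vs \<subseteq> Basis \<and> length vs = k. \<omega> g vs * \<eta> g vs) / fact k)"

definition delta0 ::
  "('g::topological_space, 'v::euclidean_space) graded_group \<Rightarrow> ('g, 'v) form \<Rightarrow> ('g, 'v) form" where
  "delta0 G \<omega> = (THE \<eta>. \<eta> \<in> forms G \<and>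
     (\<forall>\<zeta>\<in>forms G. form_inner (d0 G \<zeta>) \<omega> = form_inner \<zeta> \<eta>))"

definition Box0 ::
  "('g::topological_space, 'v::euclidean_space) graded_group \<Rightarrow> ('g, 'v) form \<Rightarrow> ('g, 'v) form" where
  "Box0 G \<omega> = d0 G (delta0 G \<omega>) + delta0 G (d0 G \<omega>)"

definition proj_im_d0 ::
  "('g::topological_space, 'v::euclidean_space) graded_group \<Rightarrow> ('g, 'v) form \<Rightarrow> ('g, 'v) form" where
  "proj_im_d0 G \<omega> = (THE \<xi>. \<xi> \<in> d0 G ` forms G \<and>
     (\<forall>\<zeta>\<in>d0 G ` forms G. form_inner (\<omega> - \<xi>) \<zeta> = 0))"

definition d0_inv ::
  "('g::topological_space, 'v::euclidean_space) graded_group \<Rightarrow> ('g, 'v) form \<Rightarrow> ('g, 'v) form" where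
  "d0_inv G \<omega> = the_inv_into (delta0 G ` forms G) (d0 G) (proj_im_d0 G \<omega>)"

subsection \<open>The Rumin complex\<close>

definition rumin_forms ::
  "('g::topological_space, 'v::euclidean_space) graded_group \<Rightarrow> nat \<Rightarrow> ('g, 'v) form set" where
  "rumin_forms G k = {\<omega> \<in> kforms G k. Box0 G \<omega> = 0}"

definition Pi0 ::
  "('g::topological_space, 'v::euclidean_space) graded_group \<Rightarrow> ('g, 'v) form \<Rightarrow> ('g, 'v) form" where
  "Pi0 G \<omega> = \<omega> - d0 G (d0_inv G \<omega>) - d0_inv G (d0 G \<omega>)"

definition rumin_b ::
  "('g::topological_space, 'v::euclidean_space) graded_group \<Rightarrow> ('g, 'v) form \<Rightarrow> ('g, 'v) form" where
  "rumin_b G \<omega> = - d0_inv G (ext_d G \<omega> - d0 G \<omega>)"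

definition inv_Id_minus_b ::
  "('g::topological_space, 'v::euclidean_space) graded_group \<Rightarrow> ('g, 'v) form \<Rightarrow> ('g, 'v) form" where
  "inv_Id_minus_b G = the_inv_into (forms G) (\<lambda>\<omega>. \<omega> - rumin_b G \<omega>)"

definition rumin_Pi ::
  "('g::topological_space, 'v::euclidean_space) graded_group \<Rightarrow> ('g, 'v) form \<Rightarrow> ('g, 'v) form" where
  "rumin_Pi G \<omega> = inv_Id_minus_b G (d0_inv G (ext_d G \<omega>)) + ext_d G (inv_Id_minus_b G (d0_inv G \<omega>))"

definition rumin_Pi_E ::
  "('g::topological_space, 'v::euclidean_space) graded_group \<Rightarrow> ('g, 'v) form \<Rightarrow> ('g, 'v) form" where
  "rumin_Pi_E G \<omega> = \<omega> - rumin_Pi G \<omega>"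

definition rumin_d ::
  "('g::topological_space, 'v::euclidean_space) graded_group \<Rightarrow> ('g, 'v) form \<Rightarrow> ('g, 'v) form" where
  "rumin_d G \<alpha> = Pi0 G (ext_d G (rumin_Pi_E G \<alpha>))"

subsection \<open>The recursive application of the Leibniz rule\<close>

text \<open>\<open>leibniz_run G \<alpha> n \<rho> \<eta> \<tau> \<beta>\<close>: after \<open>n\<close> rounds, \<open>d\<alpha>\<close> has been rewritten as
  \<open>\<rho> + d\<eta> + \<tau> + \<beta>\<close>, where \<open>\<rho>\<close> is the sum of the \<open>ker \<box>\<^sub>0\<close>-components met so far, \<open>\<eta>\<close> the sum of
  the primitives, \<open>\<tau>\<close> the sum of the \<open>Im \<delta>\<^sub>0\<close>-components, and \<open>\<beta>\<close> is still to be split. A round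
  splits \<open>\<beta> = \<xi> + r + t\<close> and replaces \<open>\<xi> = d\<^sub>0 d\<^sub>0\<^sup>-\<^sup>1 \<xi>\<close> by
  \<open>d (d\<^sub>0\<^sup>-\<^sup>1 \<xi>) - (d - d\<^sub>0) d\<^sub>0\<^sup>-\<^sup>1 \<xi>\<close>.\<close>

inductive leibniz_run ::
  "('g::topological_space, 'v::euclidean_space) graded_group \<Rightarrow> ('g, 'v) form \<Rightarrow> nat \<Rightarrow>
     ('g, 'v) form \<Rightarrow> ('g, 'v) form \<Rightarrow> ('g, 'v) form \<Rightarrow> ('g, 'v) form \<Rightarrow> bool"
  for G \<alpha> where
  start: "leibniz_run G \<alpha> 0 0 0 0 (ext_d G \<alpha>)"
| round: "leibniz_run G \<alpha> (Suc n) (\<rho> + r) (\<eta> + d0_inv G \<xi>) (\<tau> + t)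
            (- (ext_d G (d0_inv G \<xi>) - d0 G (d0_inv G \<xi>)))"
  if "leibniz_run G \<alpha> n \<rho> \<eta> \<tau> \<beta>" and "\<beta> = \<xi> + r + t"
    and "\<xi> \<in> d0 G ` forms G" and "r \<in> forms G" and "Box0 G r = 0" and "t \<in> delta0 G ` forms G"

end

theory Submission
  imports Defs "HOL-Combinatorics.Permutations"
begin


text \<open>Let \<beta> be the part of \<open>d \<alpha>\<close> still to be split and \<eta> the
  sum of the primitives collected so far. A round replaces \<eta> by \<open>\<eta> + u\<close> and
  \<beta> by \<open>- (d - d0) u\<close>, where \<open>u = d0_inv \<beta>\<close>. As
  \<open>b = - d0_inv (d - d0)\<close>, the form \<open>(Id - b) u\<close> is \<open>d0_inv\<close>
  of the old \<beta> minus \<open>d0_inv\<close> of the new one. These differences telescope: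
  throughout a run, \<open>(Id - b) \<eta> = d0_inv (d \<alpha>) - d0_inv \<beta>\<close>. Once
  \<beta> = 0, \<eta> is therefore the first summand in the definition of \<open>rumin_Pi\<close>,
  and the second summand vanishes because \<open>d0_inv\<close> kills Rumin forms. So
  \<open>rumin_Pi_E\<close> sends \<alpha> to \<open>\<alpha> - \<eta>\<close>, whose exterior
  derivative is \<open>\<rho> + \<tau>\<close> with \<rho> in the kernel of \<open>Box0\<close> and
  \<tau> in the image of \<open>delta0\<close>; \<open>Pi0\<close> fixes \<rho> and kills \<tau>.
  This is \<open>leibniz_run_invariant\<close> and \<open>leibniz_run_result\<close>.

  A run reaches 0 because \<open>d - d0\<close> differentiates coefficients and adds one argument of
  positive weight (\<open>weight_ge_grad\<close>), \<open>d0_inv\<close> does not lower weights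
  (\<open>tr_d0_inv\<close>), and weights are bounded in finite dimension
  (\<open>weight_ge_bounded\<close>). Behind \<open>tr_d0_inv\<close> stand two facts:
  \<open>d0\<close> is compatible with weights because the bracket is graded
  (\<open>trunc_ce\<close>), and its adjoint is because the layers are orthogonal
  (\<open>adj_ce_trunc\<close>).

  The algebra takes place at a single point of the group: in the left-invariant frame,
  \<open>d0\<close> is the Chevalley-Eilenberg differential \<open>ce\<close> applied pointwise, and
  \<open>delta0\<close> is its pointwise adjoint. Projections to ranges come from Gram-Schmidt with
  vectors chosen once for all points, which keeps forms smooth (\<open>projection_on_range\<close>,
  \<open>hodge_preimage\<close>). After that, \<open>d0_inv_unique\<close> replaces the definition
  of \<open>d0_inv\<close>.\<close>

subsection \<open>Alternating functions on lists\<close>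

text \<open>The interior product. The operators \<open>lie\<close>, \<open>ce\<close>,
  \<open>trunc\<close> and \<open>grad\<close> below are recursions on the argument list through it,
  so that their properties follow by list induction for all \<open>a\<close>.\<close>

definition contract :: "'v \<Rightarrow> ('v list \<Rightarrow> real) \<Rightarrow> 'v list \<Rightarrow> real" where
  "contract x a = (\<lambda>vs. a (x # vs))"

lemma contract_apply: "contract x a vs = a (x # vs)"
  by (simp add: contract_def)

lemma alternating_linear: "alternating a \<Longrightarrow> linear (\<lambda>v. a (xs @ v # ys))"
  by (simp add: alternating_def)

lemma alternating_linear_hd: "alternating a \<Longrightarrow> linear (\<lambda>v. a (v # ys))"
  using alternating_linear[of a "[]"] by simp

lemma alternating_not_distinct: "alternating a \<Longrightarrow> \<not> distinct vs \<Longrightarrow> a vs = 0"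
  by (simp add: alternating_def)

text \<open>Polarization at \<open>x + y\<close>. The hypotheses are spelled out because the lemma
  serves to establish \<open>alternating\<close> in \<open>alternatingI\<close>.\<close>

lemma adjacent_swap:
  assumes lin: "\<And>xs ys. linear (\<lambda>v. a (xs @ v # ys) :: real)"
    and adj: "\<And>xs x ys. a (xs @ x # x # ys) = 0"
  shows "a (xs @ x # y # ys) = - a (xs @ y # x # ys)"
proof -
  have l1: "a (xs @ (u + v) # w # ys) = a (xs @ u # w # ys) + a (xs @ v # w # ys)" for u v w
    using linear_add[OF lin[of xs "w # ys"]] by simp
  have l2: "a (xs @ w # (u + v) # ys) = a (xs @ w # u # ys) + a (xs @ w # v # ys)" for u v w
    using linear_add[OF lin[of "xs @ [w]" ys]] by simp
  have "a (xs @ x # y # ys) + a (xs @ y # x # ys) = 0"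
    using adj[of xs "x + y" ys, unfolded l1 l2] by (simp add: adj)
  then show ?thesis by simp
qed

text \<open>Adjacent swaps carry a repeated entry next to its twin at the cost of signs. The
  adjacent case is the one that list recursions can verify.\<close>

lemma alternatingI:
  assumes lin: "\<And>xs ys. linear (\<lambda>v. a (xs @ v # ys) :: real)"
    and adj: "\<And>xs x ys. a (xs @ x # x # ys) = 0"
  shows "alternating a"
proof -
  have "a (xs @ y # ys @ y # zs) = 0" for xs y ys zs
  proof (induction ys arbitrary: xs)
    case Nil
    then show ?case by (simp add: adj)
  next
    case (Cons z ys)
    have "a (xs @ y # z # ys @ y # zs) = - a ((xs @ [z]) @ y # ys @ y # zs)"
      using adjacent_swap[OF lin adj, of xs y z "ys @ y # zs"] by simp
    then show ?case using Cons[of "xs @ [z]"] by simp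
  qed
  then have "a vs = 0" if "\<not> distinct vs" for vs
    using not_distinct_decomp[OF that] by auto
  then show ?thesis using lin by (simp add: alternating_def)
qed

lemma alternating_swap:
  assumes "alternating a"
  shows "a (xs @ x # y # ys) = - a (xs @ y # x # ys)"
  by (rule adjacent_swap) (use assms in \<open>auto simp: alternating_def\<close>)

lemma alternating_swap_hd: "alternating a \<Longrightarrow> a (x # y # ys) = - a (y # x # ys)"
  using alternating_swap[of a "[]" x y ys] by simp

lemma alternating_contract: "alternating a \<Longrightarrow> alternating (contract x a)"
  using alternating_linear[of a "x # _"] by (simp add: alternating_def contract_apply)

lemma alternating_zero [simp]: "alternating 0"
  by (simp add: alternating_def zero_fun_def linear_iff)

lemma alternating_add: "alternating a \<Longrightarrow> alternating b \<Longrightarrow> alternating (a + b)"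
  by (simp add: alternating_def linear_compose_add)

lemma alternating_scale: "alternating a \<Longrightarrow> alternating (\<lambda>vs. c * a vs)"
  using linear_compose_scale_right[of _ c, where 'b = real, unfolded real_scaleR_def] by (auto simp: alternating_def)

lemma alternating_uminus: "alternating a \<Longrightarrow> alternating (- a)"
  using alternating_scale[of a "-1"] by (simp add: fun_Compl_def)

lemma alternating_diff: "alternating a \<Longrightarrow> alternating b \<Longrightarrow> alternating (a - b)"
  using alternating_add[of a "- b"] alternating_uminus[of b] by simp

subsection \<open>The Chevalley--Eilenberg differential\<close>

text \<open>The Lie derivative of a left-invariant form: minus the sum over all positions of
  \<open>a\<close> with \<open>br x\<close> applied to that entry.\<close>

primrec lie :: "('v \<Rightarrow> 'v \<Rightarrow> 'v) \<Rightarrow> 'v \<Rightarrow> ('v list \<Rightarrow> real) \<Rightarrow> 'v list \<Rightarrow> real" where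
  "lie br x a [] = 0"
| "lie br x a (y # vs) = lie br x (contract y a) vs - a (br x y # vs)"

text \<open>Cartan's formula \<open>\<iota>\<^sub>x d = L\<^sub>x - d \<iota>\<^sub>x\<close>, turned into a recursion.\<close>

primrec ce :: "('v \<Rightarrow> 'v \<Rightarrow> 'v) \<Rightarrow> ('v list \<Rightarrow> real) \<Rightarrow> 'v list \<Rightarrow> real" where
  "ce br a [] = 0"
| "ce br a (x # vs) = lie br x a vs - ce br (contract x a) vs"

lemma contract_add: "contract x (a + b) = contract x a + contract x b"
  by (auto simp: fun_eq_iff contract_apply)

lemma contract_diff: "contract x (a - b) = contract x a - contract x b"
  by (auto simp: fun_eq_iff contract_apply)

lemma contract_scale: "contract x (\<lambda>vs. c * a vs) = (\<lambda>vs. c * contract x a vs)"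
  by (auto simp: fun_eq_iff contract_apply)

lemma lie_add: "lie br x (a + b) vs = lie br x a vs + lie br x b vs"
  by (induction vs arbitrary: a b) (auto simp: contract_add)

lemma lie_scale: "lie br x (\<lambda>vs. c * a vs) vs = c * lie br x a vs"
  by (induction vs arbitrary: a) (auto simp: contract_scale right_diff_distrib)

lemma ce_add: "ce br (a + b) vs = ce br a vs + ce br b vs"
  by (induction vs arbitrary: a b) (auto simp: contract_add lie_add)

lemma ce_scale: "ce br (\<lambda>vs. c * a vs) vs = c * ce br a vs"
  by (induction vs arbitrary: a) (auto simp: contract_scale lie_scale right_diff_distrib)

lemma lie_diff: "lie br x (a - b) vs = lie br x a vs - lie br x b vs"
  by (induction vs arbitrary: a b) (auto simp: contract_diff)

lemma ce_diff: "ce br (a - b) vs = ce br a vs - ce br b vs"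
  by (induction vs arbitrary: a b) (auto simp: contract_diff lie_diff)

lemma lie_eq_sum:
  assumes "alternating a"
  shows "lie br x a vs = (\<Sum>j<length vs. (-1) ^ Suc j * a (br x (vs ! j) # del j vs))"
  using assms
proof (induction vs arbitrary: a)
  case (Cons y vs)
  have "(\<Sum>j<length vs. (-1) ^ Suc j * contract y a (br x (vs ! j) # del j vs)) =
     (\<Sum>j<length vs. (-1) ^ Suc (Suc j) * a (br x (vs ! j) # y # del j vs))"
    by (rule sum.cong[OF refl]) (simp add: contract_apply alternating_swap_hd[OF Cons.prems, of y])
  with Cons.IH[of "contract y a", OF alternating_contract[OF Cons.prems]] show ?case
    by (simp add: sum.lessThan_Suc_shift del_def del: sum.lessThan_Suc)
qed simp

text \<open>In the Koszul sum, the pairs containing the first argument \<open>x\<close> form the Lie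
  derivative along \<open>x\<close>. The remaining pairs form the sum for
  \<open>contract x a\<close>, with a minus sign from moving \<open>x\<close> past the
  bracket.\<close>

lemma ce_eq_sum:
  assumes "alternating a"
  shows "ce br a vs = (\<Sum>j<length vs. \<Sum>i<j. (-1) ^ (i + j) *
    a (br (vs ! i) (vs ! j) # del i (del j vs)))"
  using assms
proof (induction vs arbitrary: a)
  case (Cons x vs)
  have "(\<Sum>j<length vs. \<Sum>i<j. (-1) ^ (i + j) *
      contract x a (br (vs ! i) (vs ! j) # del i (del j vs))) =
    - (\<Sum>j<length vs. \<Sum>i<j. (-1) ^ (i + j) *
      a (br (vs ! i) (vs ! j) # x # del i (del j vs)))"
    by (simp add: contract_apply alternating_swap_hd[OF Cons.prems, of x] sum_negf)
  with Cons.IH[of "contract x a", OF alternating_contract[OF Cons.prems]]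
  have "ce br (contract x a) vs = - (\<Sum>j<length vs. \<Sum>i<j. (-1) ^ (i + j) *
      a (br (vs ! i) (vs ! j) # x # del i (del j vs)))"
    by (simp only: )
  then show ?case
    by (simp add: sum.lessThan_Suc_shift del_def lie_eq_sum[OF Cons.prems] sum.distrib
        sum_subtractf sum_negf del: sum.lessThan_Suc)
qed simp

locale lie_bracket =
  fixes br :: "'v::real_vector \<Rightarrow> 'v \<Rightarrow> 'v"
  assumes add_left: "br (x + y) z = br x z + br y z"
    and scale_left: "br (c *\<^sub>R x) z = c *\<^sub>R br x z"
    and anticommute: "br x y = - br y x"
    and jacobi: "br x (br y z) = br (br x y) z + br y (br x z)"
begin

lemma br_self: "br x x = 0"
proof -
  have "br x x + br x x = 0" using anticommute[of x x] by (metis add.right_inverse)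
  then have "2 *\<^sub>R br x x = 0" by (simp add: scaleR_2)
  then show ?thesis by simp
qed

lemma add_right: "br z (x + y) = br z x + br z y"
proof -
  have "br z (x + y) = - (br x z + br y z)" using anticommute[of z "x + y"] by (simp add: add_left)
  then show ?thesis using anticommute[of z x] anticommute[of z y] by simp
qed

lemma scale_right: "br z (c *\<^sub>R x) = c *\<^sub>R br z x"
  by (metis anticommute scale_left scaleR_minus_right)

lemma br_zero [simp]: "br 0 x = 0" "br x 0 = 0"
  using scale_left[of 0 0 x] scale_right[of x 0 0] by auto

lemma contract_alt_add: "alternating a \<Longrightarrow> contract (x + y) a = contract x a + contract y a"
  using linear_add[OF alternating_linear_hd] by (fastforce simp: fun_eq_iff contract_apply)

lemma contract_alt_scale: "alternating a \<Longrightarrow> contract (c *\<^sub>R x) a = (\<lambda>vs. c * contract x a vs)"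
  using linear_scale[OF alternating_linear_hd] by (fastforce simp: fun_eq_iff contract_apply)

lemma lie_linear_left:
  assumes "alternating a"
  shows "linear (\<lambda>x. lie br x a vs)"
  using assms
proof (induction vs arbitrary: a)
  case (Cons y vs)
  note l = alternating_linear_hd[OF Cons.prems]
  have "linear (\<lambda>x. a (br x y # vs))"
    by (rule linearI) (auto simp: add_left scale_left linear_add[OF l] linear_scale[OF l])
  then show ?case
    using Cons.IH[of "contract y a", OF alternating_contract[OF Cons.prems]] by (simp add: linear_compose_sub)
qed (simp add: linear_zero)

lemma lie_linear:
  assumes "alternating a"
  shows "linear (\<lambda>v. lie br x a (vs @ v # ws))"
  using assms
proof (induction vs arbitrary: a)
  case Nil
  note l = alternating_linear_hd[OF Nil]
  show ?case
    by (rule linearI) (auto simp: contract_alt_add[OF Nil] contract_alt_scale[OF Nil] lie_add lie_scale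
        add_right scale_right linear_add[OF l] linear_scale[OF l] right_diff_distrib)
next
  case (Cons y vs)
  then show ?case
    using Cons.IH[of "contract y a", OF alternating_contract[OF Cons.prems]]
      alternating_linear[of a "br x y # vs"] by (auto intro!: linear_compose_sub)
qed

lemma lie_adjacent:
  assumes "alternating a"
  shows "lie br x a (vs @ v # v # ws) = 0"
  using assms
proof (induction vs arbitrary: a)
  case Nil
  have "contract v (contract v a) = 0"
    by (auto simp: fun_eq_iff contract_apply alternating_not_distinct[OF Nil])
  moreover have "lie br x 0 ws = 0" using lie_scale[of br x 0 0 ws] by (simp add: zero_fun_def)
  ultimately show ?case
    by (simp add: contract_apply alternating_swap_hd[OF Nil, of v])
next
  case (Cons y vs)
  have "a (br x y # vs @ v # v # ws) = 0"
    by (rule alternating_not_distinct[OF Cons.prems]) simp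
  then show ?case
    using Cons.IH[of "contract y a", OF alternating_contract[OF Cons.prems]] by simp
qed

lemma ce_linear:
  assumes "alternating a"
  shows "linear (\<lambda>v. ce br a (vs @ v # ws))"
  using assms
proof (induction vs arbitrary: a)
  case Nil
  note l = lie_linear_left[OF Nil]
  show ?case
    by (rule linearI) (auto simp: contract_alt_add[OF Nil] contract_alt_scale[OF Nil] ce_add ce_scale
        linear_add[OF l] linear_scale[OF l] right_diff_distrib)
next
  case (Cons y vs)
  then show ?case
    using Cons.IH[of "contract y a", OF alternating_contract[OF Cons.prems]]
      lie_linear[of a y vs] by (auto intro!: linear_compose_sub)
qed

lemma ce_zero: "ce br 0 vs = 0"
  using ce_scale[of br 0 0 vs] by (simp add: zero_fun_def)

lemma ce_adjacent:
  assumes "alternating a"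
  shows "ce br a (vs @ v # v # ws) = 0"
  using assms
proof (induction vs arbitrary: a)
  case Nil
  have "contract v (contract v a) = 0"
    by (auto simp: fun_eq_iff contract_apply alternating_not_distinct[OF Nil])
  then show ?case
    using linear_0[OF alternating_linear_hd[OF Nil]] by (simp add: br_self ce_zero)
next
  case (Cons y vs)
  then show ?case
    using Cons.IH[of "contract y a", OF alternating_contract[OF Cons.prems]] by (simp add: lie_adjacent)
qed

lemma alternating_ce: "alternating a \<Longrightarrow> alternating (ce br a)"
  by (rule alternatingI) (auto simp: ce_linear ce_adjacent)

lemma contract_lie: "contract y (lie br x a) = lie br x (contract y a) - contract (br x y) a"
  by (auto simp: fun_eq_iff contract_apply)

lemma contract_ce: "contract x (ce br a) = lie br x a - ce br (contract x a)"
  by (auto simp: fun_eq_iff contract_apply)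

text \<open>The Jacobi identity, applied to the argument split off in the induction. Within this
  locale it enters only here.\<close>

lemma lie_commutator:
  assumes "alternating a"
  shows "lie br x (lie br y a) vs - lie br y (lie br x a) vs = lie br (br x y) a vs"
  using assms
proof (induction vs arbitrary: a)
  case (Cons z vs)
  have j: "a (br x (br y z) # vs) = a (br (br x y) z # vs) + a (br y (br x z) # vs)"
    by (simp add: jacobi[of x y z] linear_add[OF alternating_linear_hd[OF Cons.prems]])
  show ?case
    using Cons.IH[of "contract z a", OF alternating_contract[OF Cons.prems]] j
    by (simp add: contract_lie lie_diff)
qed simp

text \<open>Contracting both sides with \<open>y\<close> and using Cartan's formula leaves the claim
  for \<open>contract y a\<close> and the commutator of two Lie derivatives.\<close>

lemma lie_ce_commute:
  assumes "alternating a"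
  shows "lie br x (ce br a) vs = ce br (lie br x a) vs"
  using assms
proof (induction vs arbitrary: a)
  case (Cons y vs)
  show ?case
    using Cons.IH[of "contract y a", OF alternating_contract[OF Cons.prems]] lie_commutator[OF Cons.prems, of x y vs]
    by (simp add: contract_lie contract_ce lie_diff ce_diff)
qed simp

text \<open>By Cartan's formula, contraction with \<open>x\<close> turns the square of
  \<open>ce\<close> into the commutator of \<open>lie\<close> and \<open>ce\<close>, which vanishes,
  plus the square applied to \<open>contract x a\<close>.\<close>

lemma ce_ce:
  assumes "alternating a"
  shows "ce br (ce br a) vs = 0"
  using assms
proof (induction vs arbitrary: a)
  case (Cons x vs)
  show ?case
    using Cons.IH[of "contract x a", OF alternating_contract[OF Cons.prems]] lie_ce_commute[OF Cons.prems]
    by (simp add: contract_ce ce_diff)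
qed simp

end


subsection \<open>The inner product of alternating functions\<close>

abbreviation nlists :: "'i set \<Rightarrow> nat \<Rightarrow> 'i list set" where
  "nlists I k \<equiv> {is. set is \<subseteq> I \<and> length is = k}"

abbreviation basis_lists :: "nat \<Rightarrow> 'v::euclidean_space list set" where
  "basis_lists k \<equiv> {vs. set vs \<subseteq> Basis \<and> length vs = k}"

lemma finite_basis_lists [simp]: "finite (basis_lists k)"
  by (rule finite_lists_length_eq) simp

lemma sum_nlists_Suc:
  "(\<Sum>is\<in>nlists I (Suc k). f is) = (\<Sum>i\<in>I. \<Sum>is\<in>nlists I k. f (i # is))"
proof -
  have "nlists I (Suc k) = (\<lambda>(i, is). i # is) ` (I \<times> nlists I k)"
    by (auto simp: length_Suc_conv image_iff)
  then show ?thesis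
    by (simp only:, subst sum.reindex) (auto simp: inj_on_def sum.cartesian_product comp_def case_prod_unfold)
qed

text \<open>\<open>form_inner\<close> at one point of the group. On arbitrary functions of lists it
  is only semidefinite; on alternating ones it is definite by \<open>ip_eq_0_iff\<close>.\<close>

definition ip :: "('v::euclidean_space list \<Rightarrow> real) \<Rightarrow> ('v list \<Rightarrow> real) \<Rightarrow> real" where
  "ip a b = (\<Sum>k\<le>DIM('v). (\<Sum>vs\<in>basis_lists k. a vs * b vs) / fact k)"

lemma ip_commute: "ip a b = ip b a"
  by (simp add: ip_def mult.commute)

lemma ip_add_left: "ip (a + b) c = ip a c + ip b c"
  by (simp add: ip_def distrib_right sum.distrib add_divide_distrib)

lemma ip_diff_left: "ip (a - b) c = ip a c - ip b c"
  by (simp add: ip_def left_diff_distrib sum_subtractf diff_divide_distrib)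

lemma ip_scale_left: "ip (\<lambda>vs. s * a vs) c = s * ip a c"
  by (simp add: ip_def sum_distrib_left sum_divide_distrib mult.assoc)

lemma ip_zero_left [simp]: "ip 0 c = 0"
  by (simp add: ip_def)

lemma ip_add_right: "ip c (a + b) = ip c a + ip c b"
  by (simp add: ip_commute[of c] ip_add_left)

lemma ip_diff_right: "ip c (a - b) = ip c a - ip c b"
  by (simp add: ip_commute[of c] ip_diff_left)

lemma ip_scale_right: "ip c (\<lambda>vs. s * a vs) = s * ip c a"
  by (simp add: ip_commute[of c] ip_scale_left)

lemma ip_zero_right [simp]: "ip c 0 = 0"
  by (simp add: ip_commute[of c])

lemma ip_sum_left: "ip (\<Sum>i\<in>I. a i) c = (\<Sum>i\<in>I. ip (a i) c)"
  by (induction I rule: infinite_finite_induct) (auto simp: ip_add_left simp del: plus_fun_apply zero_fun_apply)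

lemma ip_self_nonneg: "ip a a \<ge> 0"
  by (auto simp: ip_def intro!: sum_nonneg divide_nonneg_nonneg)

lemma ip_self_eq_0:
  fixes a :: "'v::euclidean_space list \<Rightarrow> real"
  assumes "ip a a = 0" "set vs \<subseteq> Basis" "length vs \<le> DIM('v)"
  shows "a vs = 0"
proof -
  have "\<forall>k\<in>{..DIM('v)}. (\<Sum>vs\<in>basis_lists k. a vs * a vs) / fact k = 0"
    using assms(1) unfolding ip_def
    by (subst (asm) sum_nonneg_eq_0_iff) (auto intro!: sum_nonneg divide_nonneg_nonneg)
  then have "(\<Sum>us\<in>basis_lists (length vs). a us * a us) = 0"
    using assms(3) by simp
  then have "\<forall>us\<in>basis_lists (length vs). a us * a us = 0"
    by (subst (asm) sum_nonneg_eq_0_iff) auto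
  then show ?thesis using assms(2) by auto
qed

text \<open>A function of norm zero vanishes on every list that enters \<open>ip\<close>. This
  settles the degenerate case of Gram-Schmidt.\<close>

lemma ip_null:
  fixes a :: "'v::euclidean_space list \<Rightarrow> real"
  assumes "ip a a = 0"
  shows "ip b a = 0"
proof -
  have "(\<Sum>vs\<in>basis_lists k. b vs * a vs) = 0" if "k \<le> DIM('v)" for k
    using ip_self_eq_0[OF assms] that by (intro sum.neutral) auto
  then show ?thesis by (simp add: ip_def)
qed

text \<open>Besides orthonormal bases, this is applied to the frame of the projections of the basis
  vectors to the layers, which avoids choosing an orthonormal basis adapted to the layers.\<close>

lemma multilinear_expand:
  fixes a :: "'v::euclidean_space list \<Rightarrow> real"
  assumes "\<And>xs ys. linear (\<lambda>v. a (xs @ v # ys))"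
    and frame: "\<And>v. v = (\<Sum>i\<in>I. (f i \<bullet> v) *\<^sub>R f i)"
  shows "a vs = (\<Sum>is\<in>nlists I (length vs). (\<Prod>j<length vs. f (is ! j) \<bullet> vs ! j) * a (map f is))"
  using assms(1)
proof (induction vs arbitrary: a)
  case Nil
  have "nlists I 0 = {[]}" by auto
  then show ?case by simp
next
  case (Cons v vs)
  have l: "linear (\<lambda>v. a (v # vs))" using Cons.prems[of "[]"] by simp
  have "a (v # vs) = (\<Sum>i\<in>I. (f i \<bullet> v) * a (f i # vs))"
  proof -
    have "a (v # vs) = a ((\<Sum>i\<in>I. (f i \<bullet> v) *\<^sub>R f i) # vs)"
      using frame[of v] by (rule arg_cong)
    also have "\<dots> = (\<Sum>i\<in>I. (f i \<bullet> v) * a (f i # vs))"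
      using linear_sum[OF l, of "\<lambda>i. (f i \<bullet> v) *\<^sub>R f i" I] linear_scale[OF l] by simp
    finally show ?thesis .
  qed
  also have "\<dots> = (\<Sum>i\<in>I. (f i \<bullet> v) * (\<Sum>is\<in>nlists I (length vs).
      (\<Prod>j<length vs. f (is ! j) \<bullet> vs ! j) * a (f i # map f is)))"
  proof (rule sum.cong[OF refl])
    fix i
    have "\<And>xs ys. linear (\<lambda>v. contract (f i) a (xs @ v # ys))"
      using Cons.prems[of "f i # _"] by (simp add: contract_apply)
    from Cons.IH[OF this] show "(f i \<bullet> v) * a (f i # vs) = (f i \<bullet> v) * (\<Sum>is\<in>nlists I (length vs).
      (\<Prod>j<length vs. f (is ! j) \<bullet> vs ! j) * a (f i # map f is))" by (simp add: contract_apply)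
  qed
  also have "\<dots> = (\<Sum>is\<in>nlists I (length (v # vs)).
      (\<Prod>j<length (v # vs). f (is ! j) \<bullet> (v # vs) ! j) * a (map f is))"
    unfolding length_Cons sum_nlists_Suc prod.lessThan_Suc_shift
    by (simp add: sum_distrib_left mult.assoc)
  finally show ?case .
qed

lemma basis_frame: "v = (\<Sum>b\<in>Basis. (b \<bullet> v) *\<^sub>R b)"
  using euclidean_representation[of v] by (simp add: inner_commute)

lemma alternating_expand:
  fixes a :: "'v::euclidean_space list \<Rightarrow> real"
  assumes "alternating a"
  shows "a vs = (\<Sum>us\<in>basis_lists (length vs). (\<Prod>j<length vs. us ! j \<bullet> vs ! j) * a us)"
  using multilinear_expand[OF alternating_linear[OF assms], where I = Basis and f = "\<lambda>b. b" and vs = vs, OF basis_frame] by simp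

text \<open>Multilinearity reduces to lists of basis vectors, and such a list longer than the
  dimension has a repetition. Hence \<open>ip\<close> sees enough degrees to be definite.\<close>

lemma alternating_eqI:
  fixes a b :: "'v::euclidean_space list \<Rightarrow> real"
  assumes "alternating a" "alternating b"
    and eq: "\<And>vs. set vs \<subseteq> Basis \<Longrightarrow> length vs \<le> DIM('v) \<Longrightarrow> a vs = b vs"
  shows "a = b"
proof
  fix vs :: "'v list"
  have *: "a us = b us" if "us \<in> basis_lists (length vs)" for us
  proof (cases "distinct us")
    case True
    then have "length us \<le> DIM('v)"
      using that card_mono[of "Basis :: 'v set" "set us"] by (simp add: distinct_card)
    then show ?thesis using eq that by auto
  next
    case False
    then show ?thesis using alternating_not_distinct assms(1,2) by metis
  qed
  have "a vs = (\<Sum>us\<in>basis_lists (length vs). (\<Prod>i<length vs. us ! i \<bullet> vs ! i) * a us)"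
    by (rule alternating_expand[OF assms(1)])
  also have "\<dots> = (\<Sum>us\<in>basis_lists (length vs). (\<Prod>i<length vs. us ! i \<bullet> vs ! i) * b us)"
    using * by (intro sum.cong) auto
  also have "\<dots> = b vs"
    by (rule alternating_expand[OF assms(2), symmetric])
  finally show "a vs = b vs" .
qed

lemma ip_eq_0_iff: "alternating a \<Longrightarrow> ip a a = 0 \<longleftrightarrow> a = 0"
  using alternating_eqI[of a 0] ip_self_eq_0[of a] by auto

section \<open>Permutations of arguments, and wedge products as reproducing kernels\<close>

lemma alternating_transpose:
  assumes "alternating a" "i < length vs" "j < length vs" "i \<noteq> j"
  shows "a (permute_list (Transposition.transpose i j) vs) = - a vs"
proof -
  have "\<not> distinct (vs[i := w, j := w])" for w
    using assms(2-4) nth_eq_iff_index_eq[of "vs[i := w, j := w]" i j] by auto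
  then have nn: "a (vs[i := w, j := w]) = 0" for w
    by (rule alternating_not_distinct[OF assms(1)])
  have upd: "linear (\<lambda>v. a (us[n := v]))" if "n < length us" for us n
    using alternating_linear[OF assms(1), of "take n us" "drop (Suc n) us"] that
    by (simp add: upd_conv_take_nth_drop)
  have j: "linear (\<lambda>v. a (vs[i := u, j := v]))" for u
    using upd[of j "vs[i := u]"] assms by simp
  have i: "linear (\<lambda>v. a (vs[i := v, j := u]))" for u
    using upd[of i "vs[j := u]"] assms by (simp add: list_update_swap)
  let ?h = "\<lambda>u v. a (vs[i := u, j := v])"
  let ?x = "vs ! i" and ?y = "vs ! j"
  have "?h (?x + ?y) (?x + ?y) = ?h ?x ?x + ?h ?x ?y + (?h ?y ?x + ?h ?y ?y)"
    using linear_add[OF i] linear_add[OF j] by simp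
  moreover have "?h ?x ?x = 0" "?h ?y ?y = 0" "?h (?x + ?y) (?x + ?y) = 0" by (rule nn)+
  ultimately have "?h ?y ?x = - ?h ?x ?y" by linarith
  moreover have "?h ?x ?y = a vs" by simp
  moreover have "permute_list (Transposition.transpose i j) vs = vs[i := ?y, j := ?x]"
    using assms
    by (auto intro!: nth_equalityI simp: permute_list_nth permutes_swap_id nth_list_update Transposition.transpose_def)
  ultimately show ?thesis by simp
qed

lemma alternating_permute:
  assumes "alternating a" "p permutes {..<length vs}"
  shows "a (permute_list p vs) = of_int (sign p) * a vs"
  using finite_lessThan assms(2)
proof (induction p rule: permutes_rev_induct)
  case id
  then show ?case by simp
next
  case (swap i j p)
  have "permute_list (p \<circ> Transposition.transpose i j) vs =
    permute_list (Transposition.transpose i j) (permute_list p vs)"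
    by (rule permute_list_compose) (use swap in \<open>simp add: permutes_swap_id\<close>)
  then have "a (permute_list (p \<circ> Transposition.transpose i j) vs) = - a (permute_list p vs)"
    using alternating_transpose[OF assms(1), of i "permute_list p vs" j] swap by simp
  moreover have "sign (p \<circ> Transposition.transpose i j) = - sign p"
    using swap sign_compose[of p "Transposition.transpose i j"]
    by (simp add: sign_swap_id permutation_swap_id permutes_imp_permutation[OF finite_lessThan])
  ultimately show ?case using swap.IH by (simp del: o_apply)
qed

text \<open>The wedge product of the covectors dual to \<open>vs\<close>; at a list of the same
  length its value is the Gram determinant of the two lists.\<close>

abbreviation dual_wedge :: "'v::euclidean_space list \<Rightarrow> 'v list \<Rightarrow> real" where
  "dual_wedge vs \<equiv> wedge (map (\<bullet>) vs)"

text \<open>Expand the Gram determinant over permutations. For each \<sigma>, the sum over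
  \<open>is\<close> is the multilinear expansion of \<open>a\<close> at the list permuted by
  \<sigma>, that is, the sign of \<sigma> times \<open>a us\<close>. The two signs cancel and
  \<open>k!\<close> equal terms remain.\<close>

lemma dual_wedge_expand:
  fixes a :: "'v::euclidean_space list \<Rightarrow> real"
  assumes "alternating a"
    and frame: "\<And>v. v = (\<Sum>i\<in>I. (f i \<bullet> v) *\<^sub>R f i)"
  shows "(\<Sum>is\<in>nlists I (length us). a (map f is) * dual_wedge (map f is) us) = fact (length us) * a us"
proof -
  let ?k = "length us"
  let ?P = "{\<sigma>. \<sigma> permutes {..<?k}}"
  have "(\<Sum>is\<in>nlists I ?k. a (map f is) * dual_wedge (map f is) us) =
    (\<Sum>is\<in>nlists I ?k. \<Sum>\<sigma>\<in>?P. of_int (sign \<sigma>) * ((\<Prod>j<?k. f (is ! j) \<bullet> us ! \<sigma> j) * a (map f is)))"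
    by (rule sum.cong[OF refl]) (auto simp: wedge_def sum_distrib_left mult_ac intro!: sum.cong)
  also have "\<dots> = (\<Sum>\<sigma>\<in>?P. of_int (sign \<sigma>) *
      (\<Sum>is\<in>nlists I ?k. (\<Prod>j<?k. f (is ! j) \<bullet> us ! \<sigma> j) * a (map f is)))"
    by (subst sum.swap) (simp add: sum_distrib_left)
  also have "\<dots> = (\<Sum>\<sigma>\<in>?P. of_int (sign \<sigma>) * (of_int (sign \<sigma>) * a us))"
  proof (rule sum.cong[OF refl])
    fix \<sigma> assume "\<sigma> \<in> ?P"
    then have s: "\<sigma> permutes {..<?k}" by simp
    have "of_int (sign \<sigma>) * a us = a (permute_list \<sigma> us)"
      by (rule alternating_permute[OF assms(1) s, symmetric])
    also have "\<dots> = (\<Sum>is\<in>nlists I ?k. (\<Prod>j<?k. f (is ! j) \<bullet> permute_list \<sigma> us ! j) * a (map f is))"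
      using multilinear_expand[OF alternating_linear[OF assms(1)] frame, of "permute_list \<sigma> us"] by simp
    also have "\<dots> = (\<Sum>is\<in>nlists I ?k. (\<Prod>j<?k. f (is ! j) \<bullet> us ! \<sigma> j) * a (map f is))"
      by (intro sum.cong refl arg_cong2[where f = "(*)"] prod.cong) (auto simp: permute_list_nth[OF s])
    finally show "of_int (sign \<sigma>) * (\<Sum>is\<in>nlists I ?k. (\<Prod>j<?k. f (is ! j) \<bullet> us ! \<sigma> j) * a (map f is)) =
      of_int (sign \<sigma>) * (of_int (sign \<sigma>) * a us)" by simp
  qed
  also have "\<dots> = (\<Sum>\<sigma>\<in>?P. a us)"
    by (rule sum.cong[OF refl]) (simp add: mult.assoc[symmetric] of_int_mult[symmetric] del: of_int_mult)
  also have "\<dots> = fact ?k * a us"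
    by (simp add: card_permutations)
  finally show ?thesis .
qed

text \<open>A determinant equals that of the transposed matrix: sum over inverse permutations. This
  transfers alternation from one argument to the other.\<close>

lemma dual_wedge_commute: "dual_wedge vs us = dual_wedge us vs"
proof (cases "length us = length vs")
  case True
  let ?k = "length vs"
  have "dual_wedge vs us = (\<Sum>\<sigma> | \<sigma> permutes {..<?k}. of_int (sign \<sigma>) * (\<Prod>i<?k. vs ! i \<bullet> us ! \<sigma> i))"
    using True by (simp add: wedge_def)
  also have "\<dots> = (\<Sum>\<sigma> | \<sigma> permutes {..<?k}. of_int (sign (inv \<sigma>)) * (\<Prod>i<?k. vs ! i \<bullet> us ! (inv \<sigma>) i))"
    by (rule sum_permutations_inverse)
  also have "\<dots> = (\<Sum>\<sigma> | \<sigma> permutes {..<?k}. of_int (sign \<sigma>) * (\<Prod>i<?k. us ! i \<bullet> vs ! \<sigma> i))"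
  proof (rule sum.cong[OF refl])
    fix \<sigma> assume "\<sigma> \<in> {\<sigma>. \<sigma> permutes {..<?k}}"
    then have s: "\<sigma> permutes {..<?k}" by simp
    have "(\<Prod>i<?k. vs ! i \<bullet> us ! (inv \<sigma>) i) = (\<Prod>i<?k. vs ! \<sigma> i \<bullet> us ! (inv \<sigma>) (\<sigma> i))"
      by (subst prod.permute[OF s]) (simp add: comp_def)
    then show "of_int (sign (inv \<sigma>)) * (\<Prod>i<?k. vs ! i \<bullet> us ! (inv \<sigma>) i) =
        of_int (sign \<sigma>) * (\<Prod>i<?k. us ! i \<bullet> vs ! \<sigma> i)"
      using s by (simp add: permutes_inverses sign_inverse permutation_permutes inner_commute
          exI[of _ "{..<?k}"])
  qed
  also have "\<dots> = dual_wedge us vs"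
    using True by (simp add: wedge_def)
  finally show ?thesis .
qed (simp add: wedge_def)

lemma alternating_dual_wedge_left: "alternating (\<lambda>vs. dual_wedge vs us)"
  unfolding alternating_def
proof (intro conjI allI impI)
  fix xs ys :: "'a list"
  let ?k = "Suc (length xs + length ys)" and ?p = "length xs"
  show "linear (\<lambda>v. dual_wedge (xs @ v # ys) us)"
  proof (cases "length us = ?k")
    case True
    \<comment> \<open>The other rows of the determinant do not depend on \<open>v\<close>, so
      \<open>0\<close> stands in for it and the expansion along row \<open>?p\<close> becomes
      visibly linear.\<close>
    have nth: "(xs @ v # ys) ! i = (xs @ 0 # ys) ! i" if "i \<noteq> ?p" for v i
      using that by (cases "i < ?p") (auto simp: nth_append nth_Cons')
    have "dual_wedge (xs @ v # ys) us = (\<Sum>\<sigma> | \<sigma> permutes {..<?k}. (v \<bullet> us ! \<sigma> ?p) *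
      (of_int (sign \<sigma>) * (\<Prod>i\<in>{..<?k} - {?p}. (xs @ 0 # ys) ! i \<bullet> us ! \<sigma> i)))" for v
    proof -
      have "(\<Prod>i<?k. (xs @ v # ys) ! i \<bullet> us ! \<sigma> i) =
        (v \<bullet> us ! \<sigma> ?p) * (\<Prod>i\<in>{..<?k} - {?p}. (xs @ 0 # ys) ! i \<bullet> us ! \<sigma> i)" for \<sigma>
        by (subst prod.remove[of _ ?p]) (auto simp: nth[of _ v] intro!: prod.cong)
      moreover have "(\<Prod>i<?k. (map (\<bullet>) (xs @ v # ys) ! i) (us ! \<sigma> i)) =
          (\<Prod>i<?k. (xs @ v # ys) ! i \<bullet> us ! \<sigma> i)" for \<sigma>
        by (rule prod.cong[OF refl]) (simp del: map_append add: nth_map)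
      ultimately show ?thesis
        using True by (simp add: wedge_def mult_ac del: map_append prod.lessThan_Suc)
    qed
    then show ?thesis
      by (simp add: linear_iff inner_add_left distrib_right sum.distrib sum_distrib_left mult.assoc)
  qed (simp add: wedge_def linear_zero)
next
  fix vs :: "'a list" assume "\<not> distinct vs"
  then obtain p q where pq: "p < length vs" "q < length vs" "p \<noteq> q" "vs ! p = vs ! q"
    by (auto simp: distinct_conv_nth)
  let ?t = "Transposition.transpose p q" and ?k = "length vs"
  have t: "?t permutes {..<?k}" using pq by (simp add: permutes_swap_id)
  let ?S = "\<Sum>\<sigma> | \<sigma> permutes {..<?k}. of_int (sign \<sigma>) * (\<Prod>i<?k. vs ! i \<bullet> us ! \<sigma> i)"
  \<comment> \<open>Reindexing by the transposition flips every sign but leaves the products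
    unchanged, because rows \<open>p\<close> and \<open>q\<close> agree; so \<open>?S\<close> is its
    own negative.\<close>
  have "?S = (\<Sum>\<sigma> | \<sigma> permutes {..<?k}. of_int (sign (\<sigma> \<circ> ?t)) * (\<Prod>i<?k. vs ! i \<bullet> us ! (\<sigma> \<circ> ?t) i))"
    by (rule sum_permutations_compose_right[OF t])
  also have "\<dots> = (\<Sum>\<sigma> | \<sigma> permutes {..<?k}. - (of_int (sign \<sigma>) * (\<Prod>i<?k. vs ! i \<bullet> us ! \<sigma> i)))"
  proof (rule sum.cong[OF refl])
    fix \<sigma> assume "\<sigma> \<in> {\<sigma>. \<sigma> permutes {..<?k}}"
    then have s: "\<sigma> permutes {..<?k}" by simp
    have "(\<Prod>i<?k. vs ! i \<bullet> us ! \<sigma> i) = (\<Prod>i<?k. vs ! ?t i \<bullet> us ! \<sigma> (?t i))"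
      by (subst prod.permute[OF t]) (simp add: comp_def)
    also have "\<dots> = (\<Prod>i<?k. vs ! i \<bullet> us ! \<sigma> (?t i))"
      using pq by (intro prod.cong) (auto simp: Transposition.transpose_def)
    finally have 1: "(\<Prod>i<?k. vs ! i \<bullet> us ! (\<sigma> \<circ> ?t) i) = (\<Prod>i<?k. vs ! i \<bullet> us ! \<sigma> i)" by simp
    have 2: "sign (\<sigma> \<circ> ?t) = - sign \<sigma>"
      using s pq sign_compose[of \<sigma> ?t]
      by (simp add: sign_swap_id permutation_swap_id permutes_imp_permutation[OF finite_lessThan])
    show "of_int (sign (\<sigma> \<circ> ?t)) * (\<Prod>i<?k. vs ! i \<bullet> us ! (\<sigma> \<circ> ?t) i) =
      - (of_int (sign \<sigma>) * (\<Prod>i<?k. vs ! i \<bullet> us ! \<sigma> i))" unfolding 1 2 by simp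
  qed
  finally have "?S = 0" by (simp add: sum_negf)
  then show "dual_wedge vs us = 0" by (simp add: wedge_def)
qed

lemma alternating_dual_wedge: "alternating (dual_wedge vs)"
proof -
  have "(\<lambda>us. dual_wedge us vs) = dual_wedge vs" by (rule ext) (rule dual_wedge_commute)
  then show ?thesis using alternating_dual_wedge_left[of vs] by simp
qed


subsection \<open>Adjoints and projections\<close>

text \<open>Instantiated by \<open>ce br\<close> and by its adjoint (\<open>alt_op_adj\<close>), so
  that projections onto both ranges are obtained from one argument.\<close>

locale alt_op =
  fixes D :: "('v::euclidean_space list \<Rightarrow> real) \<Rightarrow> 'v list \<Rightarrow> real"
  assumes D_add: "D (a + b) = D a + D b"
    and D_scale: "D (\<lambda>vs. c * a vs) = (\<lambda>vs. c * D a vs)"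
    and D_alternating: "alternating a \<Longrightarrow> alternating (D a)"
begin

lemma D_zero: "D 0 = 0"
  using D_scale[of 0 0] by (simp add: zero_fun_def)

lemma D_uminus: "D (- a) = - D a"
  using D_scale[of "-1" a] by (simp add: fun_Compl_def)

lemma D_diff: "D (a - b) = D a - D b"
  using D_add[of a "- b"] by (simp only: diff_conv_add_uminus D_uminus)

lemma D_sum: "D (\<Sum>i\<in>I. a i) = (\<Sum>i\<in>I. D (a i))"
  by (induction I rule: infinite_finite_induct)
    (auto simp: D_add D_zero simp del: plus_fun_apply zero_fun_apply)

end

lemma sum_fun_apply: "(\<Sum>i\<in>I. f i) x = (\<Sum>i\<in>I. f i x)" for f :: "'i \<Rightarrow> 'a \<Rightarrow> 'b::comm_monoid_add"
  by (induction I rule: infinite_finite_induct) auto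

lemma alternating_long:
  fixes a :: "'v::euclidean_space list \<Rightarrow> real"
  assumes "alternating a" "length us > DIM('v)"
  shows "a us = 0"
proof -
  have "a vs = 0" if "vs \<in> basis_lists (length us)" for vs
  proof (rule alternating_not_distinct[OF assms(1)])
    show "\<not> distinct vs"
      using that assms(2) card_mono[of "Basis :: 'v set" "set vs"] by (auto dest: distinct_card)
  qed
  moreover have "a us = (\<Sum>vs\<in>basis_lists (length us). (\<Prod>i<length us. vs ! i \<bullet> us ! i) * a vs)"
    by (rule alternating_expand[OF assms(1)])
  ultimately show ?thesis by simp
qed

text \<open>The reproducing formula in all degrees at once. It shows that finitely many wedge
  products span the alternating functions.\<close>

lemma alternating_dual_wedge_sum:
  fixes a :: "'v::euclidean_space list \<Rightarrow> real"
  assumes "alternating a"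
  shows "a = (\<Sum>k\<le>DIM('v). \<Sum>vs\<in>basis_lists k. (\<lambda>us. a vs / fact k * dual_wedge vs us))"
    (is "a = ?b")
proof
  fix us
  have "?b us = (\<Sum>k\<le>DIM('v). (\<Sum>vs\<in>basis_lists k. a vs * dual_wedge vs us) / fact k)"
    by (simp add: sum_fun_apply sum_divide_distrib)
  also have "\<dots> = (\<Sum>k\<le>DIM('v). if k = length us then a us else 0)"
  proof (rule sum.cong[OF refl])
    fix k
    show "(\<Sum>vs\<in>basis_lists k. a vs * dual_wedge vs us) / fact k = (if k = length us then a us else 0)"
    proof (cases "k = length us")
      case True
      then show ?thesis using dual_wedge_expand[OF assms, where I = Basis and f = "\<lambda>b. b" and us = us, OF basis_frame] by simp
    next
      case False
      then have "dual_wedge vs us = 0" if "vs \<in> basis_lists k" for vs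
        using that by (auto simp: wedge_def)
      then show ?thesis using False by simp
    qed
  qed
  also have "\<dots> = a us"
    using alternating_long[OF assms, of us] by auto
  finally show "a us = ?b us" by simp
qed

text \<open>Pairing an alternating function with \<open>dual_wedge vs\<close> returns its value at
  \<open>vs\<close>; this forces the formula for the adjoint. Being an explicit finite sum, it
  preserves smooth dependence of \<open>a\<close> on a point.\<close>

definition adj :: "(('v::euclidean_space list \<Rightarrow> real) \<Rightarrow> 'v list \<Rightarrow> real) \<Rightarrow> ('v list \<Rightarrow> real) \<Rightarrow> 'v list \<Rightarrow> real" where
  "adj D a = (\<lambda>vs. ip (D (dual_wedge vs)) a)"

text \<open>If the functions \<open>D z\<close> are orthonormal, then \<open>D\<close> maps this combination to the orthogonal
  projection of \<open>a\<close> to their span.\<close>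

definition preimage_comb ::
  "(('v::euclidean_space list \<Rightarrow> real) \<Rightarrow> 'v list \<Rightarrow> real) \<Rightarrow> ('v list \<Rightarrow> real) list \<Rightarrow> ('v list \<Rightarrow> real) \<Rightarrow> 'v list \<Rightarrow> real" where
  "preimage_comb D zs a = (\<lambda>vs. \<Sum>z\<leftarrow>zs. ip a (D z) * z vs)"

lemma preimage_comb_Nil: "preimage_comb D [] a = 0"
  by (simp add: preimage_comb_def zero_fun_def)

lemma preimage_comb_Cons:
  "preimage_comb D (z # zs) a = (\<lambda>vs. ip a (D z) * z vs) + preimage_comb D zs a"
  by (simp add: preimage_comb_def plus_fun_def)

lemma alternating_preimage_comb:
  assumes "\<forall>z\<in>set zs. alternating z"
  shows "alternating (preimage_comb D zs a)"
  using assms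
  by (induction zs) (auto simp: preimage_comb_Nil preimage_comb_Cons simp del: plus_fun_apply zero_fun_apply
      intro!: alternating_add alternating_scale)

context alt_op
begin

lemma alternating_adj: "alternating (adj D a)"
proof -
  have w: "linear (\<lambda>v. dual_wedge (xs @ v # ys) us)" for xs ys us :: "'v list"
    by (rule alternating_linear[OF alternating_dual_wedge_left])
  have "linear (\<lambda>v. ip (D (dual_wedge (xs @ v # ys))) a)" for xs ys :: "'v list"
  proof (rule linearI)
    fix u v :: 'v and c :: real
    have "dual_wedge (xs @ (u + v) # ys) = dual_wedge (xs @ u # ys) + dual_wedge (xs @ v # ys)"
      by (rule ext) (simp only: linear_add[OF w] plus_fun_apply)
    then show "ip (D (dual_wedge (xs @ (u + v) # ys))) a =
      ip (D (dual_wedge (xs @ u # ys))) a + ip (D (dual_wedge (xs @ v # ys))) a"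
      by (simp only: D_add ip_add_left)
    have "dual_wedge (xs @ (c *\<^sub>R u) # ys) = (\<lambda>us. c * dual_wedge (xs @ u # ys) us)"
      by (rule ext) (simp only: linear_scale[OF w] real_scaleR_def)
    then show "ip (D (dual_wedge (xs @ (c *\<^sub>R u) # ys))) a = c *\<^sub>R ip (D (dual_wedge (xs @ u # ys))) a"
      by (simp only: D_scale ip_scale_left real_scaleR_def)
  qed
  moreover have "ip (D (dual_wedge vs)) a = 0" if "\<not> distinct vs" for vs :: "'v list"
  proof -
    have "dual_wedge vs = 0"
      by (rule ext) (simp only: alternating_not_distinct[OF alternating_dual_wedge_left that] zero_fun_apply)
    then show ?thesis by (simp only: D_zero ip_zero_left)
  qed
  ultimately show ?thesis by (simp only: alternating_def adj_def) blast
qed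

lemma alt_op_adj: "alt_op (adj D)"
proof
  show "adj D (a + b) = adj D a + adj D b" for a b
    by (rule ext) (simp only: adj_def ip_add_right plus_fun_apply)
  show "adj D (\<lambda>vs. c * a vs) = (\<lambda>vs. c * adj D a vs)" for c a
    by (rule ext) (simp only: adj_def ip_scale_right)
qed (rule alternating_adj)

text \<open>Expand \<open>b\<close> into the wedge products that define \<open>adj\<close> and pull
  \<open>D\<close> and \<open>ip\<close> through the finite sum.\<close>

lemma ip_adj:
  assumes "alternating b"
  shows "ip b (adj D a) = ip (D b) a"
proof -
  have "ip (D b) a = ip (D (\<Sum>k\<le>DIM('v). \<Sum>vs\<in>basis_lists k. (\<lambda>us. b vs / fact k * dual_wedge vs us))) a"
    using alternating_dual_wedge_sum[OF assms] by (rule arg_cong)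
  also have "\<dots> = (\<Sum>k\<le>DIM('v). \<Sum>vs\<in>basis_lists k. b vs / fact k * ip (D (dual_wedge vs)) a)"
    by (simp only: D_sum D_scale ip_sum_left ip_scale_left)
  also have "\<dots> = ip b (adj D a)"
    by (simp add: ip_def[of b] adj_def sum_divide_distrib)
  finally show ?thesis ..
qed

lemma D_preimage_comb: "ip (D (preimage_comb D zs a)) c = (\<Sum>z\<leftarrow>zs. ip a (D z) * ip (D z) c)"
  by (induction zs) (auto simp: preimage_comb_Nil preimage_comb_Cons D_add D_zero D_scale ip_add_left
      ip_scale_left simp del: plus_fun_apply zero_fun_apply)

lemma ip_D_preimage_comb_eq_0:
  "\<forall>z\<in>set zs. ip (D z) c = 0 \<Longrightarrow> ip (D (preimage_comb D zs a)) c = 0"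
  unfolding D_preimage_comb by (induction zs) auto

text \<open>Gram--Schmidt orthonormalization of the values of \<open>D\<close>, carried out on the arguments.\<close>

lemma orthonormal_preimages:
  assumes "\<forall>c\<in>set cs. alternating c"
  shows "\<exists>zs. (\<forall>z\<in>set zs. alternating z) \<and>
    (\<forall>a. \<forall>c\<in>set zs \<union> set cs. ip (a - D (preimage_comb D zs a)) (D c) = 0)"
  using assms
proof (induction cs)
  case Nil
  show ?case by (rule exI[of _ "[]"]) simp
next
  case (Cons c cs)
  then obtain zs where alt: "\<forall>z\<in>set zs. alternating z"
    and orth: "\<And>a b. b \<in> set zs \<union> set cs \<Longrightarrow> ip (a - D (preimage_comb D zs a)) (D b) = 0"
    by (auto simp del: minus_apply)
  \<comment> \<open>Subtracting the combination makes \<open>D z\<close> the part of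
    \<open>D c\<close> orthogonal to all values of \<open>D\<close> treated so far.\<close>
  define z where "z = c - preimage_comb D zs (D c)"
  have z_alt: "alternating z"
    unfolding z_def using Cons.prems alt by (intro alternating_diff alternating_preimage_comb) auto
  have Dz: "D z = D c - D (preimage_comb D zs (D c))" by (simp only: z_def D_diff)
  have Dz_orth: "ip (D z) (D b) = 0" if "b \<in> set zs \<union> set cs" for b
    unfolding Dz by (rule orth[OF that])
  have Dc: "D c = D z + D (preimage_comb D zs (D c))" by (simp only: Dz diff_add_cancel)
  have res_comb: "ip r (D (preimage_comb D ys b)) = 0" if "\<forall>y\<in>set ys. ip r (D y) = 0" for r ys b
    using ip_D_preimage_comb_eq_0[of ys r b] that by (simp only: ip_commute[of r])
  show ?case
  \<comment> \<open>If \<open>D z\<close> has norm zero, \<open>D c\<close> contributes no new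
    direction and the list stays as it is; otherwise the normalized \<open>z\<close> is
    added.\<close>
  proof (cases "ip (D z) (D z) = 0")
    case True
    have "ip (a - D (preimage_comb D zs a)) (D c) = 0" for a
    proof -
      have "ip (a - D (preimage_comb D zs a)) (D (preimage_comb D zs (D c))) = 0"
        using orth by (intro res_comb) blast
      then show ?thesis by (subst Dc, subst ip_add_right) (simp only: ip_null[OF True] add_0)
    qed
    then have "\<forall>a. \<forall>b\<in>set zs \<union> set (c # cs). ip (a - D (preimage_comb D zs a)) (D b) = 0"
      using orth by (auto simp del: minus_apply)
    then show ?thesis using alt by blast
  next
    case False
    define s where "s = sqrt (ip (D z) (D z))"
    have s: "s > 0" "s * s = ip (D z) (D z)"
      using False ip_self_nonneg[of "D z"] by (auto simp: s_def)
    define z0 where "z0 = (\<lambda>vs. inverse s * z vs)"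
    have z0_alt: "alternating z0" unfolding z0_def by (rule alternating_scale[OF z_alt])
    have Dz0: "D z0 = (\<lambda>vs. inverse s * D z vs)" unfolding z0_def by (rule D_scale)
    have one: "ip (D z0) (D z0) = 1"
    proof -
      have "inverse s * (inverse s * (s * s)) = 1" using s(1) by (simp add: field_simps)
      then show ?thesis by (simp only: Dz0 ip_scale_left ip_scale_right s(2))
    qed
    have z0_orth: "ip (D z0) (D b) = 0" if "b \<in> set zs \<union> set cs" for b
      by (simp only: Dz0 ip_scale_left Dz_orth[OF that] mult_zero_right)
    have sz0: "D z = (\<lambda>vs. s * D z0 vs)" using s(1) by (simp add: Dz0 fun_eq_iff)
    have res: "a - D (preimage_comb D (z0 # zs) a) =
        (a - D (preimage_comb D zs a)) - (\<lambda>vs. ip a (D z0) * D z0 vs)" for a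
      by (simp only: preimage_comb_Cons D_add D_scale) (simp add: fun_eq_iff)
    have A: "ip (a - D (preimage_comb D (z0 # zs) a)) (D b) = 0" if "b \<in> set zs \<union> set cs" for a b
      by (simp only: res ip_diff_left ip_scale_left z0_orth[OF that] orth[OF that, unfolded ip_diff_left] mult_zero_right diff_0_right)
    have B: "ip (a - D (preimage_comb D (z0 # zs) a)) (D z0) = 0" for a
    proof -
      have "ip (D (preimage_comb D zs a)) (D z0) = 0"
        using z0_orth by (intro ip_D_preimage_comb_eq_0) (auto simp: ip_commute[of _ "D z0"])
      then show ?thesis by (simp only: res ip_diff_left ip_scale_left one)
    qed
    have C: "ip (a - D (preimage_comb D (z0 # zs) a)) (D c) = 0" for a
    proof -
      have "ip (a - D (preimage_comb D (z0 # zs) a)) (D z) = 0"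
        by (simp only: sz0 ip_scale_right B mult_zero_right)
      moreover have "ip (a - D (preimage_comb D (z0 # zs) a)) (D (preimage_comb D zs (D c))) = 0"
        using A by (intro res_comb) blast
      ultimately show ?thesis by (subst Dc, subst ip_add_right) (simp only: add_0)
    qed
    have "\<forall>a. \<forall>b\<in>set (z0 # zs) \<union> set (c # cs). ip (a - D (preimage_comb D (z0 # zs) a)) (D b) = 0"
      using A B C by (auto simp del: minus_apply)
    moreover have "\<forall>z\<in>set (z0 # zs). alternating z" using alt z0_alt by simp
    ultimately show ?thesis by blast
  qed
qed

text \<open>The residual is made orthogonal to the images of all wedge products of basis vectors,
  and these inner products are the values of its adjoint. The list \<open>zs\<close> is chosen
  before \<open>a\<close>: one list serves all points of the group.\<close>

lemma projection_on_range:
  "\<exists>zs. (\<forall>z\<in>set zs. alternating z) \<and> (\<forall>a. adj D (a - D (preimage_comb D zs a)) = 0)"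
proof -
  have "finite (\<Union>k\<le>DIM('v). dual_wedge ` (basis_lists k :: 'v list set))" by simp
  from finite_list[OF this] obtain cs
    where cs: "set cs = (\<Union>k\<le>DIM('v). dual_wedge ` (basis_lists k :: 'v list set))" ..
  then have "\<forall>c\<in>set cs. alternating c" by (auto intro: alternating_dual_wedge)
  from orthonormal_preimages[OF this] obtain zs where zs: "(\<forall>z\<in>set zs. alternating z) \<and>
    (\<forall>a. \<forall>c\<in>set zs \<union> set cs. ip (a - D (preimage_comb D zs a)) (D c) = 0)" ..
  then have alt: "\<forall>z\<in>set zs. alternating z" ..
  have orth: "ip (a - D (preimage_comb D zs a)) (D b) = 0" if "b \<in> set cs" for a b
    by (rule bspec[OF spec[OF conjunct2[OF zs]] UnI2[OF that]])
  have "adj D (a - D (preimage_comb D zs a)) = 0" for a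
  proof (rule alternating_eqI[OF alternating_adj alternating_zero])
    fix vs :: "'v list" assume "set vs \<subseteq> Basis" "length vs \<le> DIM('v)"
    then have "dual_wedge vs \<in> set cs" unfolding cs by blast
    then show "adj D (a - D (preimage_comb D zs a)) vs = 0 vs"
      using orth by (simp add: adj_def ip_commute del: minus_apply)
  qed
  then show ?thesis using alt by blast
qed

end


subsection \<open>Truncation by degree and weight\<close>

locale graded_bracket = lie_bracket br
  for br :: "'v::euclidean_space \<Rightarrow> 'v \<Rightarrow> 'v" +
  fixes W :: "nat set" and L :: "nat \<Rightarrow> 'v set"
  assumes finite_W: "finite W" and W_pos: "0 \<notin> W"
    and subspace_L: "subspace (L w)"
    and L_trivial: "w \<notin> W \<Longrightarrow> L w = {0}"
    and decomposition: "\<exists>!u. (\<forall>w. u w \<in> L w) \<and> v = (\<Sum>w\<in>W. u w)"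
    and br_layer: "i \<in> W \<Longrightarrow> j \<in> W \<Longrightarrow> x \<in> L i \<Longrightarrow> y \<in> L j \<Longrightarrow> br x y \<in> L (i + j)"
    and L_orthogonal: "i \<in> W \<Longrightarrow> j \<in> W \<Longrightarrow> i \<noteq> j \<Longrightarrow> x \<in> L i \<Longrightarrow> y \<in> L j \<Longrightarrow> x \<bullet> y = 0"
begin

definition P :: "nat \<Rightarrow> 'v \<Rightarrow> 'v" where
  "P w v = (THE u. (\<forall>w. u w \<in> L w) \<and> v = (\<Sum>w\<in>W. u w)) w"

lemma P_decomposition: "P w v \<in> L w" "v = (\<Sum>w\<in>W. P w v)"
  using theI'[OF decomposition[of v]] by (auto simp: P_def)

lemma P_unique: "(\<And>w. u w \<in> L w) \<Longrightarrow> v = (\<Sum>w\<in>W. u w) \<Longrightarrow> P w v = u w"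
  using the1_equality[OF decomposition[of v], of u] by (simp add: P_def)

lemma zero_in_L [simp]: "0 \<in> L w"
  by (rule subspace_0[OF subspace_L])

lemma br_in_L: "x \<in> L i \<Longrightarrow> y \<in> L j \<Longrightarrow> br x y \<in> L (i + j)"
  using br_layer[of i j x y] L_trivial[of i] L_trivial[of j] by (cases "i \<in> W"; cases "j \<in> W") auto

lemma P_linear: "linear (P w)"
proof (rule linearI)
  show "P w (x + y) = P w x + P w y" for x y
  proof (rule P_unique)
    show "x + y = (\<Sum>w\<in>W. P w x + P w y)"
      using P_decomposition(2)[of x] P_decomposition(2)[of y] by (simp add: sum.distrib)
  qed (simp add: subspace_add[OF subspace_L] P_decomposition)
  show "P w (c *\<^sub>R x) = c *\<^sub>R P w x" for c x
  proof (rule P_unique)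
    show "c *\<^sub>R x = (\<Sum>w\<in>W. c *\<^sub>R P w x)"
      using P_decomposition(2)[of x] by (simp add: scaleR_sum_right[symmetric])
  qed (simp add: subspace_scale[OF subspace_L] P_decomposition)
qed

lemma P_on_layer: "v \<in> L w \<Longrightarrow> P u v = (if u = w then v else 0)"
  by (rule P_unique) (use finite_W L_trivial in auto)

text \<open>Because the layers are orthogonal, either inner product equals that of
  \<open>P w x\<close> and \<open>P w y\<close>. Through this the adjoint of \<open>ce\<close> will
  respect weights.\<close>

lemma P_self_adjoint: "P w x \<bullet> y = x \<bullet> P w y"
proof (cases "w \<in> W")
  case True
  have *: "P w x \<bullet> y = P w x \<bullet> P w y" for x y
  proof -
    have "P w x \<bullet> y = P w x \<bullet> (\<Sum>u\<in>W. P u y)" using P_decomposition(2)[of y] by simp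
    also have "\<dots> = (\<Sum>u\<in>W. if u = w then P w x \<bullet> P w y else 0)"
      unfolding inner_sum_right using True
      by (intro sum.cong) (auto intro: L_orthogonal[OF _ _ _ P_decomposition(1) P_decomposition(1)])
    finally show ?thesis using True finite_W by simp
  qed
  show ?thesis using *[of x y] *[of y x] by (simp add: inner_commute)
next
  case False
  then have "P w v = 0" for v using P_decomposition(1)[of w v] L_trivial by auto
  then show ?thesis by simp
qed

abbreviation homogeneous :: "nat list \<Rightarrow> 'v list \<Rightarrow> bool" where
  "homogeneous \<equiv> list_all2 (\<lambda>w v. v \<in> L w)"

lemma alternating_decompose_hd:
  assumes "alternating a"
  shows "a (v # vs) = (\<Sum>w\<in>W. a (P w v # vs))"
proof -
  have "a ((\<Sum>w\<in>W. P w v) # vs) = (\<Sum>w\<in>W. a (P w v # vs))"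
    by (rule linear_sum[OF alternating_linear_hd[OF assms]])
  then show ?thesis using P_decomposition(2)[of v] by simp
qed

text \<open>Split every argument into its layers. Identities about weights can then be tested on
  lists of homogeneous vectors, where \<open>trunc\<close> is transparent.\<close>

lemma homogeneous_eqI:
  assumes "alternating a" "alternating b"
    and "\<And>ws xs. homogeneous ws xs \<Longrightarrow> a xs = b xs"
  shows "a = b"
proof
  show "a vs = b vs" for vs
    using assms
  proof (induction vs arbitrary: a b)
    case Nil
    then show ?case using Nil.prems(3)[of "[]" "[]"] by simp
  next
    case (Cons v vs)
    have "contract (P w v) a vs = contract (P w v) b vs" for w
    proof (rule Cons.IH[OF alternating_contract[OF Cons.prems(1)] alternating_contract[OF Cons.prems(2)]])
      show "contract (P w v) a xs = contract (P w v) b xs" if "homogeneous ws xs" for ws xs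
        unfolding contract_apply using that P_decomposition(1) by (intro Cons.prems(3)[of "w # ws"]) simp
    qed
    then have "a (P w v # vs) = b (P w v # vs)" for w by (simp only: contract_apply)
    then show ?case
      by (simp only: alternating_decompose_hd[OF Cons.prems(1), of v vs]
          alternating_decompose_hd[OF Cons.prems(2), of v vs])
  qed
qed

text \<open>The projection to the components whose degree \<open>n\<close> and weight
  \<open>u\<close> satisfy \<open>Q n u\<close>. The recursion splits each argument into layers and
  records length and weight by shifting \<open>Q\<close>. A single operator thus handles both degree
  and weight.\<close>

primrec trunc :: "(nat \<Rightarrow> nat \<Rightarrow> bool) \<Rightarrow> ('v list \<Rightarrow> real) \<Rightarrow> 'v list \<Rightarrow> real" where
  "trunc Q a [] = (if Q 0 0 then a [] else 0)"
| "trunc Q a (v # vs) = (\<Sum>w\<in>W. trunc (\<lambda>n u. Q (Suc n) (u + w)) (contract (P w v) a) vs)"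

lemma trunc_add: "trunc Q (a + b) vs = trunc Q a vs + trunc Q b vs"
  by (induction vs arbitrary: Q a b) (auto simp: contract_add sum.distrib)

lemma trunc_scale: "trunc Q (\<lambda>vs. c * a vs) vs = c * trunc Q a vs"
  by (induction vs arbitrary: Q a) (auto simp: contract_scale sum_distrib_left)

lemma trunc_zero [simp]: "trunc Q 0 vs = 0"
  using trunc_scale[of Q 0 0 vs] by (simp add: zero_fun_def)

lemma trunc_zero' [simp]: "trunc Q (\<lambda>vs. 0) vs = 0"
  using trunc_zero[of Q vs] by (simp add: zero_fun_def)

lemma trunc_contract_linear:
  assumes "alternating a"
  shows "linear (\<lambda>v. trunc Q (contract v a) vs)"
  by (rule linearI) (simp_all add: contract_alt_add[OF assms] contract_alt_scale[OF assms] trunc_add trunc_scale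
      del: plus_fun_apply)

lemma trunc_linear:
  assumes "alternating a"
  shows "linear (\<lambda>v. trunc Q a (vs @ v # ws))"
  using assms
proof (induction vs arbitrary: Q a)
  case Nil
  then show ?case
    using linear_compose[OF P_linear trunc_contract_linear[OF Nil], unfolded comp_def]
    by (auto intro!: linear_compose_sum)
next
  case (Cons y vs)
  then show ?case
    by (auto intro!: linear_compose_sum alternating_contract)
qed

lemma trunc_adjacent:
  assumes "alternating a"
  shows "trunc Q a (vs @ v # v # ws) = 0"
  using assms
proof (induction vs arbitrary: Q a)
  case Nil
  let ?f = "\<lambda>w u. trunc (\<lambda>n x. Q (Suc (Suc n)) (x + u + w)) (contract (P u v) (contract (P w v) a)) ws"
  \<comment> \<open>Exchanging the layers of the two equal arguments changes the sign of the double
    contraction but not the total weight. The double sum is therefore its own negative.\<close>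
  have anti: "?f w u = - ?f u w" for w u
  proof -
    have "contract (P u v) (contract (P w v) a) = (\<lambda>vs. -1 * contract (P w v) (contract (P u v) a) vs)"
      by (rule ext) (simp add: contract_apply alternating_swap_hd[OF Nil, of "P w v" "P u v"])
    then have "?f w u = trunc (\<lambda>n x. Q (Suc (Suc n)) (x + u + w))
        (\<lambda>vs. -1 * contract (P w v) (contract (P u v) a) vs) ws" by (simp only:)
    also have "\<dots> = - trunc (\<lambda>n x. Q (Suc (Suc n)) (x + u + w)) (contract (P w v) (contract (P u v) a)) ws"
      by (simp only: trunc_scale)
    finally show ?thesis by (simp add: add_ac)
  qed
  have "(\<Sum>w\<in>W. \<Sum>u\<in>W. ?f w u) = (\<Sum>w\<in>W. \<Sum>u\<in>W. - ?f u w)"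
    by (intro sum.cong refl) (rule anti)
  also have "\<dots> = - (\<Sum>w\<in>W. \<Sum>u\<in>W. ?f w u)"
    by (subst sum.swap) (simp add: sum_negf)
  finally show ?case by (simp add: add_ac)
next
  case (Cons y vs)
  then show ?case
    by (auto intro!: sum.neutral alternating_contract)
qed

lemma alternating_trunc: "alternating a \<Longrightarrow> alternating (trunc Q a)"
  by (rule alternatingI) (auto simp: trunc_linear trunc_adjacent)

lemma contract_zero: "alternating a \<Longrightarrow> contract 0 a = 0"
  using linear_0[OF alternating_linear_hd] by (fastforce simp: fun_eq_iff contract_apply)

text \<open>On a homogeneous list only one choice of layers contributes, so the value is kept or
  dropped as a whole.\<close>

lemma trunc_homogeneous:
  assumes "alternating a" "homogeneous ws xs"
  shows "trunc Q a xs = (if Q (length xs) (sum_list ws) then a xs else 0)"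
  using assms(2,1)
proof (induction arbitrary: Q a rule: list_all2_induct)
  case Nil
  then show ?case by simp
next
  case (Cons w ws x xs)
  have "trunc Q a (x # xs) =
      (\<Sum>u\<in>W. if u = w then trunc (\<lambda>n u. Q (Suc n) (u + w)) (contract x a) xs else 0)"
    unfolding trunc.simps
    by (rule sum.cong[OF refl]) (auto simp: P_on_layer[OF Cons.hyps(1)] contract_zero[OF Cons.prems] simp del: zero_fun_apply)
  also have "\<dots> = (if w \<in> W then trunc (\<lambda>n u. Q (Suc n) (u + w)) (contract x a) xs else 0)"
    using finite_W by simp
  also have "\<dots> = (if w \<in> W \<and> Q (length (x # xs)) (sum_list (w # ws)) then a (x # xs) else 0)"
  proof -
    have "trunc (\<lambda>n u. Q (Suc n) (u + w)) (contract x a) xs =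
        (if Q (Suc (length xs)) (sum_list ws + w) then a (x # xs) else 0)"
      by (simp only: Cons.IH[OF alternating_contract[OF Cons.prems]]) (simp only: contract_apply)
    then show ?thesis by (simp only:) (simp add: add.commute)
  qed
  \<comment> \<open>If \<open>w\<close> is not a weight, its layer is trivial, so
    \<open>x = 0\<close> and both sides vanish.\<close>
  also have "\<dots> = (if Q (length (x # xs)) (sum_list (w # ws)) then a (x # xs) else 0)"
    using L_trivial[of w] Cons.hyps(1) linear_0[OF alternating_linear_hd[OF Cons.prems]] by auto
  finally show ?case .
qed

text \<open>The bracket adds weights, so on a homogeneous list the Lie derivative consults
  \<open>a\<close> only at lists of the stated length and total weight. The factor \<open>c\<close>
  covers agreement (1) and vanishing (0) together.\<close>

lemma lie_homogeneous_cong: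
  assumes "x \<in> L w" "homogeneous ws xs"
    and "\<And>us ys. homogeneous us ys \<Longrightarrow> length ys = length xs \<Longrightarrow> sum_list us = w + sum_list ws \<Longrightarrow> a ys = c * b ys"
  shows "lie br x a xs = c * lie br x b xs"
  using assms(2,3)
proof (induction arbitrary: a b rule: list_all2_induct)
  case Nil
  then show ?case by simp
next
  case (Cons u ws y xs)
  have "lie br x (contract y a) xs = c * lie br x (contract y b) xs"
  proof (rule Cons.IH)
    fix us ys assume "homogeneous us ys" "length ys = length xs" "sum_list us = w + sum_list ws"
    then show "contract y a ys = c * contract y b ys"
      using Cons.hyps Cons.prems[of "u # us" "y # ys"] by (simp add: contract_apply)
  qed
  moreover have "a (br x y # xs) = c * b (br x y # xs)"
    using Cons.hyps Cons.prems[of "(w + u) # ws" "br x y # xs"] br_in_L[OF assms(1)] by simp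
  ultimately show ?case by (simp add: right_diff_distrib)
qed

lemma ce_homogeneous_cong:
  assumes "homogeneous ws xs"
    and "\<And>us ys. homogeneous us ys \<Longrightarrow> Suc (length ys) = length xs \<Longrightarrow> sum_list us = sum_list ws \<Longrightarrow> a ys = c * b ys"
  shows "ce br a xs = c * ce br b xs"
  using assms
proof (induction arbitrary: a b rule: list_all2_induct)
  case Nil
  then show ?case by simp
next
  case (Cons u ws y xs)
  have "ce br (contract y a) xs = c * ce br (contract y b) xs"
  proof (rule Cons.IH)
    fix us ys assume "homogeneous us ys" "Suc (length ys) = length xs" "sum_list us = sum_list ws"
    then show "contract y a ys = c * contract y b ys"
      using Cons.hyps Cons.prems[of "u # us" "y # ys"] by (simp add: contract_apply)
  qed
  moreover have "lie br y a xs = c * lie br y b xs"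
    by (rule lie_homogeneous_cong[OF Cons.hyps(1,2)]) (use Cons.prems in simp)
  ultimately show ?case by (simp add: right_diff_distrib)
qed

text \<open>\<open>ce\<close> preserves weight and raises the degree by one: degree
  \<open>Suc n\<close> of the result comes from degree \<open>n\<close> of the argument, hence the
  shift of \<open>Q\<close>.\<close>

lemma trunc_ce:
  assumes "alternating a"
  shows "trunc Q (ce br a) = ce br (trunc (\<lambda>n. Q (Suc n)) a)"
proof (rule homogeneous_eqI)
  fix ws xs assume h: "homogeneous ws xs"
  have "ce br (trunc (\<lambda>n. Q (Suc n)) a) xs = (if Q (length xs) (sum_list ws) then 1 else 0) * ce br a xs"
    by (rule ce_homogeneous_cong[OF h]) (auto simp: trunc_homogeneous[OF assms])
  then show "trunc Q (ce br a) xs = ce br (trunc (\<lambda>n. Q (Suc n)) a) xs"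
    using trunc_homogeneous[OF alternating_ce[OF assms] h] by simp
qed (auto intro: assms alternating_ce alternating_trunc)

text \<open>\<open>Basis\<close> need not be adapted to the layers, but the matrix of
  \<open>P w\<close> in it is symmetric, so \<open>P w\<close> moves from one factor to the
  other.\<close>

lemma sum_Basis_P:
  assumes "linear f" "linear g"
  shows "(\<Sum>b\<in>Basis. f (P w b) * g b) = (\<Sum>b\<in>Basis. f b * (g (P w b) :: real))"
proof -
  have exp: "h (P w b) = (\<Sum>e\<in>Basis. (P w b \<bullet> e) * h e)" if "linear h" for h :: "'v \<Rightarrow> real" and b
    using linear_sum[OF that, of "\<lambda>e. (P w b \<bullet> e) *\<^sub>R e" Basis] linear_scale[OF that]
    by (simp add: euclidean_representation)
  have "(\<Sum>b\<in>Basis. f (P w b) * g b) = (\<Sum>b\<in>Basis. \<Sum>e\<in>Basis. (P w b \<bullet> e) * f e * g b)"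
    by (simp add: exp[OF assms(1)] sum_distrib_right)
  also have "\<dots> = (\<Sum>e\<in>Basis. \<Sum>b\<in>Basis. (P w e \<bullet> b) * f e * g b)"
  proof -
    have "(P w b \<bullet> e) * f e * g b = (P w e \<bullet> b) * f e * g b" for b e
      using P_self_adjoint[of w b e] inner_commute[of b "P w e"] by simp
    then show ?thesis by (subst sum.swap) (intro sum.cong refl)
  qed
  also have "\<dots> = (\<Sum>b\<in>Basis. f b * g (P w b))"
    by (simp add: exp[OF assms(2)] sum_distrib_left mult_ac)
  finally show ?thesis .
qed

text \<open>\<open>trunc\<close> is symmetric: the layer projections are moved across one argument
  at a time.\<close>

lemma sum_basis_lists_trunc:
  assumes "alternating a" "alternating b"
  shows "(\<Sum>vs\<in>basis_lists k. trunc Q a vs * b vs) = (\<Sum>vs\<in>basis_lists k. a vs * trunc Q b vs)"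
  using assms
proof (induction k arbitrary: Q a b)
  case 0
  have "basis_lists 0 = {[] :: 'v list}" by auto
  then show ?case by simp
next
  case (Suc k)
  let ?Q = "\<lambda>w n u. Q (Suc n) (u + w)"
  have rotate: "(\<Sum>e\<in>A. \<Sum>w\<in>B. \<Sum>v\<in>C. f e w v) = (\<Sum>w\<in>B. \<Sum>v\<in>C. \<Sum>e\<in>A. f e w v)"
    for f :: "'v \<Rightarrow> nat \<Rightarrow> 'v list \<Rightarrow> real" and A B C
    by (subst sum.swap) (intro sum.cong refl sum.swap)
  note ac = alternating_contract[OF Suc.prems(1)] and bc = alternating_contract[OF Suc.prems(2)]
  have "(\<Sum>vs\<in>basis_lists (Suc k). trunc Q a vs * b vs) =
    (\<Sum>e\<in>Basis. \<Sum>w\<in>W. \<Sum>vs\<in>basis_lists k. trunc (?Q w) (contract (P w e) a) vs * contract e b vs)"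
  proof -
    have "(\<Sum>vs\<in>basis_lists k. trunc Q a (e # vs) * b (e # vs)) =
      (\<Sum>w\<in>W. \<Sum>vs\<in>basis_lists k. trunc (?Q w) (contract (P w e) a) vs * contract e b vs)" for e
      unfolding trunc.simps sum_distrib_right contract_apply[of e b] by (rule sum.swap)
    then show ?thesis by (simp only: sum_nlists_Suc)
  qed
  also have "\<dots> = (\<Sum>e\<in>Basis. \<Sum>w\<in>W. \<Sum>vs\<in>basis_lists k. contract (P w e) a vs * trunc (?Q w) (contract e b) vs)"
    by (simp only: Suc.IH[OF ac bc])
  also have "\<dots> = (\<Sum>w\<in>W. \<Sum>vs\<in>basis_lists k. \<Sum>e\<in>Basis. contract (P w e) a vs * trunc (?Q w) (contract e b) vs)"
    by (rule rotate)
  also have "\<dots> = (\<Sum>w\<in>W. \<Sum>vs\<in>basis_lists k. \<Sum>e\<in>Basis. contract e a vs * trunc (?Q w) (contract (P w e) b) vs)"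
    unfolding contract_apply[of _ a]
    by (intro sum.cong refl sum_Basis_P alternating_linear_hd[OF Suc.prems(1)]
        trunc_contract_linear[OF Suc.prems(2)])
  also have "\<dots> = (\<Sum>e\<in>Basis. \<Sum>w\<in>W. \<Sum>vs\<in>basis_lists k. contract e a vs * trunc (?Q w) (contract (P w e) b) vs)"
    by (rule rotate[symmetric])
  also have "\<dots> = (\<Sum>vs\<in>basis_lists (Suc k). a vs * trunc Q b vs)"
  proof -
    have "(\<Sum>vs\<in>basis_lists k. a (e # vs) * trunc Q b (e # vs)) =
      (\<Sum>w\<in>W. \<Sum>vs\<in>basis_lists k. contract e a vs * trunc (?Q w) (contract (P w e) b) vs)" for e
      unfolding trunc.simps sum_distrib_left contract_apply[of e a] by (rule sum.swap)
    then show ?thesis by (simp only: sum_nlists_Suc)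
  qed
  finally show ?case .
qed

lemma ip_trunc: "alternating a \<Longrightarrow> alternating b \<Longrightarrow> ip (trunc Q a) b = ip a (trunc Q b)"
  by (simp add: ip_def sum_basis_lists_trunc)

sublocale alt_op "ce br"
  by standard (auto simp: fun_eq_iff ce_add ce_scale alternating_ce)

text \<open>The adjoint of \<open>trunc_ce\<close>: both sides have the same inner product with
  every alternating function, in particular with their difference. Here degree \<open>n\<close> of
  the result comes from degree \<open>Suc n\<close> of \<open>a\<close>.\<close>

lemma adj_ce_trunc:
  assumes "alternating a"
  shows "adj (ce br) (trunc Q a) = trunc (\<lambda>n. Q (Suc n)) (adj (ce br) a)"
proof -
  let ?x = "adj (ce br) (trunc Q a)" and ?y = "trunc (\<lambda>n. Q (Suc n)) (adj (ce br) a)"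
  have "ip b ?x = ip b ?y" if "alternating b" for b
  proof -
    have "ip b ?x = ip (ce br b) (trunc Q a)" by (rule ip_adj[OF that])
    also have "\<dots> = ip (trunc Q (ce br b)) a"
      by (rule ip_trunc[OF alternating_ce[OF that] assms, symmetric])
    also have "\<dots> = ip (trunc (\<lambda>n. Q (Suc n)) b) (adj (ce br) a)"
      by (simp only: trunc_ce[OF that] ip_adj[OF alternating_trunc[OF that]])
    also have "\<dots> = ip b ?y" by (rule ip_trunc[OF that alternating_adj])
    finally show ?thesis .
  qed
  moreover have alt: "alternating (?x - ?y)"
    by (intro alternating_diff alternating_adj alternating_trunc)
  ultimately have "ip (?x - ?y) (?x - ?y) = 0" by (simp only: ip_diff_right[of "?x - ?y"] diff_self)
  then have "?x - ?y = 0" using ip_eq_0_iff[OF alt] by simp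
  then show ?thesis by (simp only: right_minus_eq)
qed

end


subsection \<open>Smooth functions and invariant vector fields\<close>

lemma Ck_on_Suc_imp: "Ck_on (Suc n) f S \<Longrightarrow> Ck_on n f S"
proof (induction n arbitrary: f)
  case 0
  then show ?case
    by (auto intro!: continuous_at_imp_continuous_on dest: has_derivative_continuous)
next
  case (Suc n)
  from Suc.prems[unfolded Ck_on.simps(2)[of "Suc n"]] obtain f' where
    "\<forall>x\<in>S. (f has_derivative f' x) (at x)" "\<forall>v. Ck_on (Suc n) (\<lambda>x. f' x v) S" by blast
  moreover from this(2) have "\<forall>v. Ck_on n (\<lambda>x. f' x v) S" by (intro allI Suc.IH) simp
  ultimately show ?case unfolding Ck_on.simps(2)[of n] by blast
qed

lemma Ck_on_const: "Ck_on n (\<lambda>x. c) S"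
proof (induction n arbitrary: c)
  case (Suc n)
  show ?case by (auto intro!: exI[of _ "\<lambda>x v. 0"] Suc)
qed simp

lemma Ck_on_add: "Ck_on n f S \<Longrightarrow> Ck_on n g S \<Longrightarrow> Ck_on n (\<lambda>x. f x + g x) S"
proof (induction n arbitrary: f g)
  case (Suc n)
  then obtain f' g' where "\<forall>x\<in>S. (f has_derivative f' x) (at x)" "\<And>v. Ck_on n (\<lambda>x. f' x v) S"
    "\<forall>x\<in>S. (g has_derivative g' x) (at x)" "\<And>v. Ck_on n (\<lambda>x. g' x v) S" by auto
  then show ?case
    by (auto intro!: exI[of _ "\<lambda>x v. f' x v + g' x v"] Suc.IH has_derivative_add)
qed (auto intro: continuous_on_add)

lemma Ck_on_mult:
  fixes f g :: "'a::euclidean_space \<Rightarrow> real"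
  shows "Ck_on n f S \<Longrightarrow> Ck_on n g S \<Longrightarrow> Ck_on n (\<lambda>x. f x * g x) S"
proof (induction n arbitrary: f g)
  case (Suc n)
  then obtain f' g' where 1: "\<forall>x\<in>S. (f has_derivative f' x) (at x)" "\<And>v. Ck_on n (\<lambda>x. f' x v) S"
    "\<forall>x\<in>S. (g has_derivative g' x) (at x)" "\<And>v. Ck_on n (\<lambda>x. g' x v) S" by auto
  have "Ck_on n f S" "Ck_on n g S" using Suc.prems by (auto dest: Ck_on_Suc_imp simp del: Ck_on.simps)
  with 1 show ?case
    by (auto intro!: exI[of _ "\<lambda>x v. f x * g' x v + f' x v * g x"] Suc.IH Ck_on_add has_derivative_mult)
qed (auto intro: continuous_on_mult)

lemma smooth_functions_iff:
  "f \<in> smooth_functions A \<longleftrightarrow> continuous_on UNIV f \<and>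
    (\<forall>(U, \<phi>)\<in>A. \<forall>n. Ck_on n (\<lambda>x. f (inv_into U \<phi> x)) (\<phi> ` U))"
  by (auto simp: smooth_functions_def smooth_map_def smooth_on_def comp_def)

lemma smooth_const: "(\<lambda>x. c) \<in> smooth_functions A"
  by (auto simp: smooth_functions_iff Ck_on_const)

lemma smooth_add: "f \<in> smooth_functions A \<Longrightarrow> g \<in> smooth_functions A \<Longrightarrow> (\<lambda>x. f x + g x) \<in> smooth_functions A"
  by (fastforce simp: smooth_functions_iff intro: Ck_on_add continuous_on_add)

lemma smooth_mult: "f \<in> smooth_functions A \<Longrightarrow> g \<in> smooth_functions A \<Longrightarrow> (\<lambda>x. f x * g x) \<in> smooth_functions A"
  by (fastforce simp: smooth_functions_iff intro: Ck_on_mult continuous_on_mult)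

lemma smooth_scale: "f \<in> smooth_functions A \<Longrightarrow> (\<lambda>x. c * f x) \<in> smooth_functions A"
  by (rule smooth_mult[OF smooth_const])

lemma smooth_diff: "f \<in> smooth_functions A \<Longrightarrow> g \<in> smooth_functions A \<Longrightarrow> (\<lambda>x. f x - g x) \<in> smooth_functions A"
  using smooth_add[OF _ smooth_scale[of g A "-1"], of f] by simp

lemma smooth_sum: "(\<And>i. i \<in> I \<Longrightarrow> f i \<in> smooth_functions A) \<Longrightarrow> (\<lambda>x. \<Sum>i\<in>I. f i x) \<in> smooth_functions A"
  by (induction I rule: infinite_finite_induct) (auto intro: smooth_add smooth_const)

section \<open>Left-invariant fields of the group and their bracket\<close>

locale gradable =
  fixes G :: "('g::{t2_space, second_countable_topology}, 'v::euclidean_space) graded_group"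
  assumes gradable: "positively_gradable_group G"
begin

abbreviation "br \<equiv> bracket G"
abbreviation "X \<equiv> field G"

lemma iso: "lie_algebra_iso G"
  using gradable by (simp add: positively_gradable_group_def)

lemma X_invariant: "left_invariant_field G (X v)"
  using iso by (simp add: lie_algebra_iso_def)

lemma X_closed: "f \<in> Cinf G \<Longrightarrow> X v f \<in> Cinf G"
  using X_invariant[of v] by (simp add: left_invariant_field_def)

lemma X_fadd: "f \<in> Cinf G \<Longrightarrow> h \<in> Cinf G \<Longrightarrow> X v (\<lambda>x. f x + h x) = (\<lambda>x. X v f x + X v h x)"
  using X_invariant[of v] unfolding left_invariant_field_def plus_fun_def by blast

lemma X_fscale: "f \<in> Cinf G \<Longrightarrow> X v (\<lambda>x. c * f x) = (\<lambda>x. c * X v f x)"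
  using X_invariant[of v] unfolding left_invariant_field_def by blast

lemma X_fmult: "f \<in> Cinf G \<Longrightarrow> h \<in> Cinf G \<Longrightarrow> X v (\<lambda>x. f x * h x) = (\<lambda>x. f x * X v h x + X v f x * h x)"
  using X_invariant[of v] unfolding left_invariant_field_def plus_fun_def times_fun_def by blast

lemma X_translate: "f \<in> Cinf G \<Longrightarrow> X v (f \<circ> mult G a) = X v f \<circ> mult G a"
  using X_invariant[of v] unfolding left_invariant_field_def by blast

lemma X_fdiff:
  assumes "f \<in> Cinf G" "h \<in> Cinf G"
  shows "X v (\<lambda>x. f x - h x) = (\<lambda>x. X v f x - X v h x)"
  using X_fadd[OF assms(1) smooth_scale[OF assms(2), of "-1"]] X_fscale[OF assms(2), of v "-1"] by simp

lemma X_const: "X v (\<lambda>x. c) = (\<lambda>x. 0)"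
proof -
  have "X v (\<lambda>x. 1) = (\<lambda>x. X v (\<lambda>x. 1) x + X v (\<lambda>x. 1) x)"
    using X_fmult[OF smooth_const smooth_const, of v 1 1] by simp
  then have "X v (\<lambda>x. 1) x = 0" for x by (metis add_cancel_right_right)
  then show ?thesis using X_fscale[OF smooth_const, of v c 1] by auto
qed

lemma X_add: "f \<in> Cinf G \<Longrightarrow> X (v + w) f = (\<lambda>x. X v f x + X w f x)"
  using iso unfolding lie_algebra_iso_def plus_fun_def by blast

lemma X_scale: "f \<in> Cinf G \<Longrightarrow> X (c *\<^sub>R v) f = (\<lambda>x. c * X v f x)"
  using iso unfolding lie_algebra_iso_def by blast

lemma X_ex1: "left_invariant_field G D \<Longrightarrow> \<exists>!v. \<forall>f\<in>Cinf G. X v f = D f"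
  using iso unfolding lie_algebra_iso_def by blast

lemma X_inject: "(\<And>f. f \<in> Cinf G \<Longrightarrow> X v f = X w f) \<Longrightarrow> v = w"
  using X_ex1[OF X_invariant[of w]] by blast

text \<open>Justifies the definite description in \<open>bracket\<close>: by \<open>X_ex1\<close>
  the commutator is the field of exactly one vector. In the product rule the mixed terms
  cancel.\<close>

lemma commutator_invariant: "left_invariant_field G (\<lambda>f. X v (X w f) - X w (X v f))"
  unfolding left_invariant_field_def
proof (intro conjI allI ballI)
  fix f h :: "'g \<Rightarrow> real" and c :: real and a :: 'g
  assume f: "f \<in> Cinf G"
  show "X v (X w f) - X w (X v f) \<in> Cinf G"
    using smooth_diff[OF X_closed[OF X_closed[OF f]] X_closed[OF X_closed[OF f]]] by (simp add: fun_diff_def)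
  show "X v (X w (\<lambda>x. c * f x)) - X w (X v (\<lambda>x. c * f x)) = (\<lambda>x. c * (X v (X w f) - X w (X v f)) x)"
    by (simp add: X_fscale f X_closed fun_eq_iff right_diff_distrib)
  show "X v (X w (f \<circ> mult G a)) - X w (X v (f \<circ> mult G a)) = X v (X w f) - X w (X v f) \<circ> mult G a"
    by (simp add: X_translate f X_closed fun_eq_iff del: o_apply) (simp add: fun_eq_iff)
  assume h: "h \<in> Cinf G"
  show "X v (X w (f + h)) - X w (X v (f + h)) = X v (X w f) - X w (X v f) + (X v (X w h) - X w (X v h))"
    unfolding plus_fun_def by (simp add: X_fadd f h X_closed fun_eq_iff)
  show "X v (X w (f * h)) - X w (X v (f * h)) =
      f * (X v (X w h) - X w (X v h)) + (X v (X w f) - X w (X v f)) * h"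
    unfolding times_fun_def plus_fun_def
    by (simp add: X_fmult X_fadd f h X_closed smooth_mult fun_eq_iff algebra_simps)
qed

lemma X_bracket:
  assumes "f \<in> Cinf G"
  shows "X (br v w) f = (\<lambda>x. X v (X w f) x - X w (X v f) x)"
  using theI'[OF X_ex1[OF commutator_invariant[of v w]]] assms
  by (fastforce simp: bracket_def fun_eq_iff)

text \<open>On smooth functions the bracket laws are identities between commutators of operators;
  \<open>X_inject\<close> brings them back to vectors.\<close>

sublocale graded_bracket "bracket G" "weights G" "layer G"
proof
  show "br (x + y) z = br x z + br y z" for x y z
    by (rule X_inject) (simp add: X_bracket X_add X_closed X_fadd fun_eq_iff)
  show "br (c *\<^sub>R x) z = c *\<^sub>R br x z" for c x z
    by (rule X_inject) (simp add: X_bracket X_scale X_closed X_fscale fun_eq_iff right_diff_distrib)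
  show "br x y = - br y x" for x y
    by (rule X_inject) (simp add: X_bracket X_scale[of _ "-1", simplified] X_closed fun_eq_iff)
  show "br x (br y z) = br (br x y) z + br y (br x z)" for x y z
    by (rule X_inject) (simp add: X_bracket X_add X_closed X_fdiff fun_eq_iff)
qed (use gradable in \<open>auto simp: positively_gradable_group_def orthogonal_grading_def\<close>)

subsection \<open>Smooth forms\<close>

lemma forms_alternating: "\<omega> \<in> forms G \<Longrightarrow> alternating (\<omega> g)"
  by (simp add: forms_def)

lemma forms_smooth: "\<omega> \<in> forms G \<Longrightarrow> (\<lambda>g. \<omega> g vs) \<in> Cinf G"
  by (simp add: forms_def)

lemma formsI: "(\<And>g. alternating (\<omega> g)) \<Longrightarrow> (\<And>vs. (\<lambda>g. \<omega> g vs) \<in> Cinf G) \<Longrightarrow> \<omega> \<in> forms G"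
  by (simp add: forms_def)

lemma forms_zero: "0 \<in> forms G"
  by (rule formsI) (auto simp: zero_fun_def smooth_const alternating_zero[unfolded zero_fun_def])

lemma forms_add: "\<omega> \<in> forms G \<Longrightarrow> \<eta> \<in> forms G \<Longrightarrow> \<omega> + \<eta> \<in> forms G"
  by (rule formsI) (auto simp: plus_fun_def forms_def smooth_add alternating_add[unfolded plus_fun_def])

lemma forms_diff: "\<omega> \<in> forms G \<Longrightarrow> \<eta> \<in> forms G \<Longrightarrow> \<omega> - \<eta> \<in> forms G"
  by (rule formsI) (auto simp: fun_diff_def forms_def smooth_diff alternating_diff[unfolded fun_diff_def])

lemma forms_uminus: "\<omega> \<in> forms G \<Longrightarrow> - \<omega> \<in> forms G"
  using forms_diff[OF forms_zero] by simp

lemma forms_contract: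
  assumes "\<omega> \<in> forms G"
  shows "(\<lambda>g. contract x (\<omega> g)) \<in> forms G"
proof (rule formsI)
  show "(\<lambda>g. contract x (\<omega> g) vs) \<in> Cinf G" for vs
    unfolding contract_apply by (rule forms_smooth[OF assms])
qed (rule alternating_contract[OF forms_alternating[OF assms]])

text \<open>The terms of the exterior derivative that differentiate coefficients. By
  \<open>ext_d_minus_d0\<close> this is \<open>d - d0\<close>.\<close>

primrec grad :: "('g, 'v) form \<Rightarrow> 'g \<Rightarrow> 'v list \<Rightarrow> real" where
  "grad \<omega> g [] = 0"
| "grad \<omega> g (x # vs) = X x (\<lambda>h. \<omega> h vs) g - grad (\<lambda>h. contract x (\<omega> h)) g vs"

lemma grad_eq_sum: "grad \<omega> g vs = (\<Sum>i<length vs. (-1) ^ i * X (vs ! i) (\<lambda>h. \<omega> h (del i vs)) g)"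
proof (induction vs arbitrary: \<omega>)
  case (Cons x vs)
  show ?case
    by (simp add: Cons.IH contract_apply sum.lessThan_Suc_shift del_def sum_negf del: sum.lessThan_Suc)
qed simp

lemma ext_d_eq: "\<omega> \<in> forms G \<Longrightarrow> ext_d G \<omega> g vs = grad \<omega> g vs + ce br (\<omega> g) vs"
  by (simp add: ext_d_def grad_eq_sum ce_eq_sum forms_alternating)

text \<open>Freezing the coefficients at \<open>g\<close> turns the derivative terms into
  derivatives of constants. What remains acts on the value \<open>\<omega> g\<close> alone.\<close>

lemma d0_eq: "\<omega> \<in> forms G \<Longrightarrow> d0 G \<omega> g = ce br (\<omega> g)"
  by (rule ext) (simp add: d0_def ext_d_def X_const ce_eq_sum forms_alternating)

lemma grad_smooth: "\<omega> \<in> forms G \<Longrightarrow> (\<lambda>g. grad \<omega> g vs) \<in> Cinf G"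
proof (induction vs arbitrary: \<omega>)
  case (Cons x vs)
  then show ?case
    using smooth_diff[OF X_closed[OF forms_smooth[OF Cons.prems]] Cons.IH[OF forms_contract[OF Cons.prems]]]
    by simp
qed (simp add: smooth_const)

lemma grad_add:
  "\<omega> \<in> forms G \<Longrightarrow> \<eta> \<in> forms G \<Longrightarrow> grad (\<lambda>g vs. \<omega> g vs + \<eta> g vs) g us = grad \<omega> g us + grad \<eta> g us"
proof (induction us arbitrary: \<omega> \<eta>)
  case (Cons x us)
  then show ?case
    using Cons.IH[OF forms_contract[OF Cons.prems(1)] forms_contract[OF Cons.prems(2)], of x x]
    by (simp add: X_fadd forms_smooth contract_def)
qed simp

lemma grad_scale:
  "\<omega> \<in> forms G \<Longrightarrow> grad (\<lambda>g vs. c * \<omega> g vs) g us = c * grad \<omega> g us"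
proof (induction us arbitrary: \<omega>)
  case (Cons x us)
  then show ?case
    using Cons.IH[OF forms_contract[OF Cons.prems], of x]
    by (simp add: X_fscale forms_smooth contract_def right_diff_distrib)
qed simp

lemma grad_zero: "grad (\<lambda>g vs. 0) g us = 0"
  using grad_scale[OF forms_zero, of 0] by simp

lemma grad_linear:
  assumes "\<omega> \<in> forms G"
  shows "linear (\<lambda>v. grad \<omega> g (vs @ v # ws))"
  using assms
proof (induction vs arbitrary: \<omega>)
  case Nil
  note alt = forms_alternating[OF Nil] and c = forms_contract[OF Nil] and s = forms_smooth[OF Nil]
  have "grad (\<lambda>h. contract (x + y) (\<omega> h)) g ws =
      grad (\<lambda>h. contract x (\<omega> h)) g ws + grad (\<lambda>h. contract y (\<omega> h)) g ws" for x y
    using grad_add[OF c c, of x y g ws] contract_alt_add[OF alt, of x y]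
    by (simp only: plus_fun_def)
  moreover have "grad (\<lambda>h. contract (r *\<^sub>R x) (\<omega> h)) g ws = r * grad (\<lambda>h. contract x (\<omega> h)) g ws" for r x
    using grad_scale[OF c, of r x g ws] contract_alt_scale[OF alt, of r x]
    by (simp only:)
  ultimately show ?case
    by (intro linearI) (simp_all add: X_add[OF s] X_scale[OF s] right_diff_distrib)
next
  case (Cons y vs)
  have "linear (\<lambda>v. X y (\<lambda>h. \<omega> h (vs @ v # ws)) g)"
    using linear_add[OF alternating_linear[OF forms_alternating[OF Cons.prems]]]
      linear_scale[OF alternating_linear[OF forms_alternating[OF Cons.prems]]]
    by (intro linearI) (simp_all add: X_fadd X_fscale forms_smooth[OF Cons.prems])
  then show ?case
    using Cons.IH[OF forms_contract[OF Cons.prems], of y] by (auto intro!: linear_compose_sub)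
qed

lemma grad_adjacent:
  assumes "\<omega> \<in> forms G"
  shows "grad \<omega> g (vs @ v # v # ws) = 0"
  using assms
proof (induction vs arbitrary: \<omega>)
  case Nil
  have "contract v (contract v (\<omega> h)) = (\<lambda>vs. 0)" for h
    by (rule ext) (simp add: contract_apply alternating_not_distinct[OF forms_alternating[OF Nil]])
  then show ?case by (simp add: grad_zero contract_apply[of v "\<omega> _"])
next
  case (Cons y vs)
  have "\<omega> h (vs @ v # v # ws) = 0" for h
    by (rule alternating_not_distinct[OF forms_alternating[OF Cons.prems]]) simp
  then show ?case
    using Cons.IH[OF forms_contract[OF Cons.prems], of y] by (simp add: X_const)
qed

lemma grad_forms: "\<omega> \<in> forms G \<Longrightarrow> grad \<omega> \<in> forms G"
  by (rule formsI) (auto intro!: alternatingI grad_smooth simp: grad_linear grad_adjacent)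

lemma lie_smooth:
  assumes "\<And>vs. (\<lambda>g. \<omega> g vs) \<in> Cinf G"
  shows "(\<lambda>g. lie br x (\<omega> g) vs) \<in> Cinf G"
  using assms
proof (induction vs arbitrary: \<omega>)
  case (Cons y vs)
  have "(\<lambda>g. lie br x (contract y (\<omega> g)) vs) \<in> Cinf G"
    by (rule Cons.IH) (simp only: contract_apply Cons.prems)
  then show ?case using Cons.prems by (auto intro!: smooth_diff)
qed (simp add: smooth_const)

lemma ce_smooth:
  assumes "\<And>vs. (\<lambda>g. \<omega> g vs) \<in> Cinf G"
  shows "(\<lambda>g. ce br (\<omega> g) vs) \<in> Cinf G"
  using assms
proof (induction vs arbitrary: \<omega>)
  case (Cons y vs)
  have "(\<lambda>g. ce br (contract y (\<omega> g)) vs) \<in> Cinf G"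
    by (rule Cons.IH) (simp only: contract_apply Cons.prems)
  then show ?case using Cons.prems by (auto intro!: smooth_diff lie_smooth)
qed (simp add: smooth_const)

lemma trunc_smooth:
  assumes "\<And>vs. (\<lambda>g. \<omega> g vs) \<in> Cinf G"
  shows "(\<lambda>g. trunc Q (\<omega> g) vs) \<in> Cinf G"
  using assms
proof (induction vs arbitrary: \<omega> Q)
  case Nil
  then show ?case by (cases "Q 0 0") (simp_all add: smooth_const)
next
  case (Cons y vs)
  have "(\<lambda>g. trunc Q (contract x (\<omega> g)) vs) \<in> Cinf G" for x Q
    by (rule Cons.IH) (simp only: contract_apply Cons.prems)
  then show ?case by (auto intro!: smooth_sum)
qed

lemma ip_smooth:
  assumes "\<And>vs. (\<lambda>g. \<omega> g vs) \<in> Cinf G"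
  shows "(\<lambda>g. ip b (\<omega> g)) \<in> Cinf G" "(\<lambda>g. ip (\<omega> g) b) \<in> Cinf G"
proof -
  show "(\<lambda>g. ip b (\<omega> g)) \<in> Cinf G"
    unfolding ip_def divide_inverse using assms
    by (intro smooth_sum smooth_mult smooth_const)
  then show "(\<lambda>g. ip (\<omega> g) b) \<in> Cinf G" by (simp only: ip_commute[of _ b])
qed

lemma preimage_comb_smooth:
  assumes "\<And>vs. (\<lambda>g. \<omega> g vs) \<in> Cinf G"
  shows "(\<lambda>g. preimage_comb D zs (\<omega> g) vs) \<in> Cinf G"
proof (induction zs)
  case (Cons z zs)
  then show ?case
    using smooth_mult[OF ip_smooth(2)[OF assms] smooth_const] by (auto simp: preimage_comb_def intro!: smooth_add)
qed (simp add: preimage_comb_def smooth_const)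

end


subsection \<open>The algebraic Hodge decomposition\<close>

context gradable
begin

text \<open>The simplifier eta-contracts these rules, so they would unfold the operations on forms even
  where these are not applied to an argument.\<close>

declare plus_fun_apply [simp del] zero_fun_apply [simp del] minus_apply [simp del] uminus_apply [simp del]

abbreviation "F \<equiv> forms G"
abbreviation "\<delta> \<equiv> adj (ce br)"

interpretation \<delta>: alt_op \<delta>
  by (rule alt_op_adj)

lemma ip_D_left: "alternating a \<Longrightarrow> ip (ce br a) b = ip a (\<delta> b)"
  by (rule ip_adj[symmetric])

lemma ip_\<delta>_left: "alternating b \<Longrightarrow> ip (\<delta> a) b = ip a (ce br b)"
  using ip_adj[of b a] by (simp only: ip_commute[of _ b] ip_commute[of "ce br b"])

lemma form_inner_eq: "form_inner \<omega> \<eta> = (\<lambda>g. ip (\<omega> g) (\<eta> g))"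
  by (simp add: form_inner_def ip_def)

lemma forms_eq_0:
  assumes "\<omega> \<in> F" "\<And>g. ip (\<omega> g) (\<omega> g) = 0"
  shows "\<omega> = 0"
  using ip_eq_0_iff[OF forms_alternating[OF assms(1)]] assms(2) by (auto simp: fun_eq_iff zero_fun_def)

lemma ce_forms: "\<omega> \<in> F \<Longrightarrow> (\<lambda>g. ce br (\<omega> g)) \<in> F"
  by (rule formsI) (auto intro: alternating_ce forms_alternating ce_smooth forms_smooth)

lemma adj_forms: "\<omega> \<in> F \<Longrightarrow> (\<lambda>g. \<delta> (\<omega> g)) \<in> F"
proof (rule formsI)
  show "(\<lambda>g. \<delta> (\<omega> g) vs) \<in> Cinf G" if "\<omega> \<in> F" for vs
    unfolding adj_def by (rule ip_smooth(1)) (rule forms_smooth[OF that])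
qed (rule alternating_adj)

lemma d0_forms:
  assumes "\<omega> \<in> F"
  shows "d0 G \<omega> \<in> F"
proof -
  have "d0 G \<omega> = (\<lambda>g. ce br (\<omega> g))" by (rule ext) (rule d0_eq[OF assms])
  then show ?thesis using ce_forms[OF assms] by simp
qed

text \<open>The pointwise adjoint has the defining property. For uniqueness, the difference of two
  candidates serves as its own test form.\<close>

lemma delta0_eq:
  assumes "\<omega> \<in> F"
  shows "delta0 G \<omega> = (\<lambda>g. \<delta> (\<omega> g))"
  unfolding delta0_def
proof (rule the_equality)
  show "(\<lambda>g. \<delta> (\<omega> g)) \<in> F \<and> (\<forall>\<zeta>\<in>F. form_inner (d0 G \<zeta>) \<omega> = form_inner \<zeta> (\<lambda>g. \<delta> (\<omega> g)))"
    using adj_forms[OF assms] by (auto simp: form_inner_eq d0_eq ip_D_left forms_alternating)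
next
  fix \<eta> assume *: "\<eta> \<in> F \<and> (\<forall>\<zeta>\<in>F. form_inner (d0 G \<zeta>) \<omega> = form_inner \<zeta> \<eta>)"
  let ?x = "\<eta> - (\<lambda>g. \<delta> (\<omega> g))"
  have x: "?x \<in> F" using * adj_forms[OF assms] by (auto intro: forms_diff)
  have "ip (?x g) (?x g) = 0" for g
  proof -
    have "ip (ce br (?x g)) (\<omega> g) = ip (?x g) (\<eta> g)"
    proof -
      have "form_inner (d0 G ?x) \<omega> = form_inner ?x \<eta>" using * x by blast
      from fun_cong[OF this, of g] show ?thesis by (simp only: form_inner_eq d0_eq[OF x])
    qed
    then have "ip (?x g) (\<eta> g) - ip (?x g) (\<delta> (\<omega> g)) = 0"
      using ip_D_left[OF forms_alternating[OF x]] by simp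
    then show ?thesis by (subst (2) minus_apply) (simp only: ip_diff_right)
  qed
  then have "?x = 0" by (rule forms_eq_0[OF x])
  then show "\<eta> = (\<lambda>g. \<delta> (\<omega> g))" by simp
qed

lemma delta0_forms: "\<omega> \<in> F \<Longrightarrow> delta0 G \<omega> \<in> F"
  by (simp add: delta0_eq adj_forms)

lemma d0_add: "\<omega> \<in> F \<Longrightarrow> \<eta> \<in> F \<Longrightarrow> d0 G (\<omega> + \<eta>) = d0 G \<omega> + d0 G \<eta>"
  by (rule ext) (simp add: d0_eq forms_add plus_fun_apply[of \<omega>] plus_fun_apply[of "d0 G \<omega>"] D_add)

lemma d0_diff: "\<omega> \<in> F \<Longrightarrow> \<eta> \<in> F \<Longrightarrow> d0 G (\<omega> - \<eta>) = d0 G \<omega> - d0 G \<eta>"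
  by (rule ext) (simp add: d0_eq forms_diff minus_apply[of \<omega>] minus_apply[of "d0 G \<omega>"] D_diff)

lemma delta0_add: "\<omega> \<in> F \<Longrightarrow> \<eta> \<in> F \<Longrightarrow> delta0 G (\<omega> + \<eta>) = delta0 G \<omega> + delta0 G \<eta>"
  by (rule ext) (simp add: delta0_eq forms_add plus_fun_apply[of \<omega>] plus_fun_apply[of "\<lambda>g. \<delta> (\<omega> g)"] \<delta>.D_add)

lemma delta0_diff: "\<omega> \<in> F \<Longrightarrow> \<eta> \<in> F \<Longrightarrow> delta0 G (\<omega> - \<eta>) = delta0 G \<omega> - delta0 G \<eta>"
  by (rule ext) (simp add: delta0_eq forms_diff minus_apply[of \<omega>] minus_apply[of "\<lambda>g. \<delta> (\<omega> g)"] \<delta>.D_diff)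

lemma d0_zero: "d0 G 0 = 0"
  using d0_diff[OF forms_zero forms_zero] by simp

lemma delta0_zero: "delta0 G 0 = 0"
  using delta0_diff[OF forms_zero forms_zero] by simp

lemma d0_d0: "\<omega> \<in> F \<Longrightarrow> d0 G (d0 G \<omega>) = 0"
  by (intro ext) (simp add: d0_eq d0_forms ce_ce forms_alternating zero_fun_def)

text \<open>The squared norm of the left-hand side becomes, after moving both adjoints across, a
  pairing with the square of \<open>ce\<close>.\<close>

lemma delta0_delta0:
  assumes "\<omega> \<in> F"
  shows "delta0 G (delta0 G \<omega>) = 0"
proof (rule forms_eq_0)
  show "ip (delta0 G (delta0 G \<omega>) g) (delta0 G (delta0 G \<omega>) g) = 0" for g
  proof -
    have "ce br (ce br (\<delta> (\<delta> (\<omega> g)))) = 0"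
      by (rule ext) (simp add: ce_ce[OF alternating_adj] zero_fun_def)
    then have "ip (\<delta> (\<delta> (\<omega> g))) (\<delta> (\<delta> (\<omega> g))) = 0"
      by (simp only: ip_\<delta>_left[OF alternating_adj] ip_\<delta>_left[OF alternating_ce[OF alternating_adj]] ip_zero_right)
    then show ?thesis by (simp only: delta0_eq[OF delta0_forms[OF assms]]) (simp only: delta0_eq[OF assms])
  qed
qed (simp add: delta0_forms assms)

text \<open>The squared norm of \<open>d0 G \<omega>\<close> is the pairing of \<omega> with
  \<open>delta0 G (d0 G \<omega>)\<close>.\<close>

lemma delta0_d0_eq_0:
  assumes "\<omega> \<in> F" "delta0 G (d0 G \<omega>) = 0"
  shows "d0 G \<omega> = 0"
proof (rule forms_eq_0[OF d0_forms[OF assms(1)]])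
  show "ip (d0 G \<omega> g) (d0 G \<omega> g) = 0" for g
  proof -
    have "\<delta> (d0 G \<omega> g) = 0"
      using fun_cong[OF assms(2), of g] by (simp add: delta0_eq d0_forms assms(1) zero_fun_def)
    then show ?thesis
      by (subst d0_eq[OF assms(1)]) (simp add: ip_D_left[OF forms_alternating[OF assms(1)]])
  qed
qed

lemma d0_delta0_eq_0:
  assumes "\<omega> \<in> F" "d0 G (delta0 G \<omega>) = 0"
  shows "delta0 G \<omega> = 0"
proof (rule forms_eq_0[OF delta0_forms[OF assms(1)]])
  show "ip (delta0 G \<omega> g) (delta0 G \<omega> g) = 0" for g
  proof -
    have "ce br (delta0 G \<omega> g) = 0"
      using fun_cong[OF assms(2), of g] by (simp add: d0_eq delta0_forms assms(1) zero_fun_def)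
    then show ?thesis
      using ip_\<delta>_left[OF forms_alternating[OF delta0_forms[OF assms(1)], of g], of "\<omega> g"]
      by (simp add: delta0_eq[OF assms(1)])
  qed
qed

text \<open>Applying \<open>d0\<close> to the equation removes the first summand of
  \<open>Box0\<close>. The two preceding lemmas then give \<open>d0 G \<omega> = 0\<close>, and what
  is left of the equation gives \<open>delta0 G \<omega> = 0\<close>.\<close>

lemma Box0_eq_0_iff:
  assumes "\<omega> \<in> F"
  shows "Box0 G \<omega> = 0 \<longleftrightarrow> d0 G \<omega> = 0 \<and> delta0 G \<omega> = 0"
proof
  note [simp] = assms d0_forms delta0_forms
  assume b: "Box0 G \<omega> = 0"
  then have "d0 G (Box0 G \<omega>) = 0" by (simp add: d0_zero)
  then have "d0 G (delta0 G (d0 G \<omega>)) = 0" by (simp add: Box0_def d0_add d0_d0)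
  then have "d0 G \<omega> = 0" using d0_delta0_eq_0[of "d0 G \<omega>"] delta0_d0_eq_0[of \<omega>] by simp
  moreover from this b have "delta0 G \<omega> = 0"
    using d0_delta0_eq_0[of \<omega>] by (simp add: Box0_def delta0_zero)
  ultimately show "d0 G \<omega> = 0 \<and> delta0 G \<omega> = 0" by simp
qed (simp add: Box0_def d0_zero delta0_zero)

text \<open>Two projections: subtracting \<open>d0 G s\<close> leaves a form orthogonal to the image
  of \<open>d0\<close>, and replacing \<open>s\<close> by its projection to the image of
  \<open>delta0\<close> does not change \<open>d0 G s\<close>.\<close>

lemma hodge_preimage:
  assumes "\<omega> \<in> F"
  shows "\<exists>u\<in>delta0 G ` F. delta0 G (\<omega> - d0 G u) = 0"
proof -
  obtain zs where zs: "\<forall>z\<in>set zs. alternating z"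
    "\<And>a. \<delta> (a - ce br (preimage_comb (ce br) zs a)) = 0"
    using projection_on_range by blast
  obtain ys where ys: "\<forall>z\<in>set ys. alternating z"
    "\<And>a. adj \<delta> (a - \<delta> (preimage_comb \<delta> ys a)) = 0"
    using \<delta>.projection_on_range by blast
  define s where "s = (\<lambda>g. preimage_comb (ce br) zs (\<omega> g))"
  define y where "y = (\<lambda>g. preimage_comb \<delta> ys (s g))"
  have s: "s \<in> F"
    unfolding s_def
    by (rule formsI, rule alternating_preimage_comb[OF zs(1)], rule preimage_comb_smooth, rule forms_smooth[OF assms])
  have y: "y \<in> F"
    unfolding y_def
    by (rule formsI, rule alternating_preimage_comb[OF ys(1)], rule preimage_comb_smooth, rule forms_smooth[OF s])
  \<comment> \<open>The choice of \<open>y\<close> makes the double adjoint vanish at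
    \<open>?z\<close>. Pairing with \<open>ce br ?z\<close> converts this into a vanishing norm of
    \<open>ce br ?z\<close>.\<close>
  have "ce br (s g - \<delta> (y g)) = 0" for g
  proof -
    let ?z = "s g - \<delta> (y g)"
    have alt: "alternating ?z" by (intro alternating_diff forms_alternating s alternating_adj)
    have "ip (ce br ?z) (ce br ?z) = ip (\<delta> (ce br ?z)) ?z" by (rule ip_\<delta>_left[OF alt, symmetric])
    also have "\<dots> = ip (ce br ?z) (adj \<delta> ?z)" by (rule \<delta>.ip_adj[OF alternating_ce[OF alt], symmetric])
    also have "\<dots> = 0" unfolding y_def ys(2) by (rule ip_zero_right)
    finally show ?thesis using ip_eq_0_iff[OF alternating_ce[OF alt]] by blast
  qed
  then have "ce br (s g) = ce br (\<delta> (y g))" for g by (simp only: D_diff right_minus_eq)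
  then have "d0 G s g = d0 G (delta0 G y) g" for g
    by (simp only: d0_eq[OF s] d0_eq[OF delta0_forms[OF y]]) (simp only: delta0_eq[OF y])
  then have "d0 G s = d0 G (delta0 G y)" by (rule ext)
  moreover have "delta0 G (\<omega> - d0 G s) = 0"
  proof
    fix g
    have "\<delta> ((\<omega> - d0 G s) g) = 0"
      by (simp only: minus_apply[of \<omega>] d0_eq[OF s]) (simp only: s_def zs(2))
    then show "delta0 G (\<omega> - d0 G s) g = 0 g"
      by (simp only: delta0_eq[OF forms_diff[OF assms d0_forms[OF s]]]) (simp only: zero_fun_apply)
  qed
  ultimately show ?thesis using y by auto
qed

lemma delta0_image_unique:
  assumes "u \<in> delta0 G ` F" "v \<in> delta0 G ` F" "d0 G u = d0 G v"
  shows "u = v"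
proof -
  obtain x y where xy: "x \<in> F" "y \<in> F" "u = delta0 G x" "v = delta0 G y" using assms by auto
  then have "d0 G (delta0 G (x - y)) = 0" using assms(3) by (simp add: delta0_diff d0_diff delta0_forms)
  then have "delta0 G (x - y) = 0" using xy by (intro d0_delta0_eq_0 forms_diff)
  then show ?thesis using xy by (simp add: delta0_diff)
qed

text \<open>A residual is orthogonal to the image of \<open>d0\<close> exactly when
  \<open>delta0\<close> kills it. So \<open>d0 G u\<close> is the projection of \<omega>, and
  \<open>u\<close> is its only preimage in the image of \<open>delta0\<close>. Later facts about
  \<open>d0_inv\<close> rest on this characterization.\<close>

lemma d0_inv_unique:
  assumes \<omega>: "\<omega> \<in> F" and u: "u \<in> delta0 G ` F" and r: "delta0 G (\<omega> - d0 G u) = 0"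
  shows "d0_inv G \<omega> = u"
proof -
  have uF: "u \<in> F" using u delta0_forms by auto
  have char: "(\<forall>\<zeta>\<in>d0 G ` F. form_inner (\<omega> - \<xi>) \<zeta> = 0) \<longleftrightarrow> delta0 G (\<omega> - \<xi>) = 0" if "\<xi> \<in> F" for \<xi>
  proof -
    have d: "\<omega> - \<xi> \<in> F" using \<omega> that by (rule forms_diff)
    have "form_inner (\<omega> - \<xi>) (d0 G y) = (\<lambda>g. ip (delta0 G (\<omega> - \<xi>) g) (y g))" if "y \<in> F" for y
      using that d by (simp add: form_inner_eq d0_eq delta0_eq ip_\<delta>_left forms_alternating)
    note inner = this
    show ?thesis
    proof
      assume *: "\<forall>\<zeta>\<in>d0 G ` F. form_inner (\<omega> - \<xi>) \<zeta> = 0"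
      let ?x = "delta0 G (\<omega> - \<xi>)"
      have x: "?x \<in> F" by (rule delta0_forms[OF d])
      \<comment> \<open>The test form \<open>d0 G ?x\<close> turns orthogonality into a vanishing
        norm of \<open>?x\<close>.\<close>
      have "form_inner (\<omega> - \<xi>) (d0 G ?x) = 0" using * x by blast
      then have "(\<lambda>g. ip (?x g) (?x g)) = 0" by (simp only: inner[OF x])
      from fun_cong[OF this] have "ip (?x g) (?x g) = 0" for g by (simp only: zero_fun_apply)
      then show "?x = 0" by (rule forms_eq_0[OF x])
    next
      assume "delta0 G (\<omega> - \<xi>) = 0"
      then show "\<forall>\<zeta>\<in>d0 G ` F. form_inner (\<omega> - \<xi>) \<zeta> = 0"
        by (auto simp only: inner zero_fun_apply ip_zero_left)
    qed
  qed
  have "proj_im_d0 G \<omega> = d0 G u"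
    unfolding proj_im_d0_def
  proof (rule the_equality)
    show "d0 G u \<in> d0 G ` F \<and> (\<forall>\<zeta>\<in>d0 G ` F. form_inner (\<omega> - d0 G u) \<zeta> = 0)"
      using uF char[OF d0_forms[OF uF]] r by blast
  next
    fix \<xi> assume *: "\<xi> \<in> d0 G ` F \<and> (\<forall>\<zeta>\<in>d0 G ` F. form_inner (\<omega> - \<xi>) \<zeta> = 0)"
    then obtain z where z: "z \<in> F" "\<xi> = d0 G z" by auto
    then have "delta0 G (\<omega> - d0 G z) = 0" using * char[OF d0_forms[OF z(1)]] by blast
    then have "delta0 G \<omega> = delta0 G (d0 G z)" "delta0 G \<omega> = delta0 G (d0 G u)"
      using r by (simp_all add: delta0_diff \<omega> z uF d0_forms)
    then have "delta0 G (d0 G (z - u)) = 0" by (simp add: d0_diff delta0_diff z uF d0_forms)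
    then have "d0 G (z - u) = 0" using z uF by (intro delta0_d0_eq_0 forms_diff)
    then show "\<xi> = d0 G u" using z uF by (simp add: d0_diff)
  qed
  then show ?thesis
    unfolding d0_inv_def using u
    by (auto intro!: the_inv_into_f_f inj_onI delta0_image_unique)
qed

lemma d0_inv:
  assumes "\<omega> \<in> F"
  shows "d0_inv G \<omega> \<in> delta0 G ` F" "delta0 G (\<omega> - d0 G (d0_inv G \<omega>)) = 0"
proof -
  obtain u where u: "u \<in> delta0 G ` F" "delta0 G (\<omega> - d0 G u) = 0" using hodge_preimage[OF assms] ..
  have "d0_inv G \<omega> = u" by (rule d0_inv_unique[OF assms u])
  with u show "d0_inv G \<omega> \<in> delta0 G ` F" "delta0 G (\<omega> - d0 G (d0_inv G \<omega>)) = 0" by simp_all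
qed

lemma d0_inv_forms: "\<omega> \<in> F \<Longrightarrow> d0_inv G \<omega> \<in> F"
  using d0_inv(1)[of \<omega>] delta0_forms by auto

lemma delta0_image_add: "u \<in> delta0 G ` F \<Longrightarrow> v \<in> delta0 G ` F \<Longrightarrow> u + v \<in> delta0 G ` F"
  by (auto simp: delta0_add[symmetric] intro: forms_add)

lemma d0_inv_add:
  assumes "\<omega> \<in> F" "\<eta> \<in> F"
  shows "d0_inv G (\<omega> + \<eta>) = d0_inv G \<omega> + d0_inv G \<eta>"
proof (rule d0_inv_unique)
  note [simp] = assms d0_forms delta0_forms d0_inv_forms
  have "\<omega> + \<eta> - d0 G (d0_inv G \<omega> + d0_inv G \<eta>) = (\<omega> - d0 G (d0_inv G \<omega>)) + (\<eta> - d0 G (d0_inv G \<eta>))"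
    by (simp add: d0_add)
  then show "delta0 G (\<omega> + \<eta> - d0 G (d0_inv G \<omega> + d0_inv G \<eta>)) = 0"
    by (simp only: delta0_add forms_diff assms d0_forms d0_inv_forms d0_inv(2)) simp
qed (auto intro: forms_add delta0_image_add d0_inv assms)

lemma d0_inv_delta0_closed:
  assumes "\<omega> \<in> F" "delta0 G \<omega> = 0"
  shows "d0_inv G \<omega> = 0"
  by (rule d0_inv_unique)
    (use assms forms_zero delta0_zero in \<open>auto simp: d0_zero image_iff intro!: bexI[of _ 0]\<close>)

lemma d0_inv_d0_delta0: "u \<in> delta0 G ` F \<Longrightarrow> d0_inv G (d0 G u) = u"
  by (rule d0_inv_unique) (auto simp: delta0_zero intro: d0_forms delta0_forms)

text \<open>A form in the image of \<open>d0\<close> is its own projection: the residual lies in the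
  image of \<open>d0\<close> and is killed by \<open>delta0\<close>.\<close>

lemma d0_d0_inv_d0:
  assumes "\<omega> \<in> F"
  shows "d0 G (d0_inv G (d0 G \<omega>)) = d0 G \<omega>"
proof -
  note [simp] = assms d0_forms d0_inv_forms
  have "delta0 G (d0 G (\<omega> - d0_inv G (d0 G \<omega>))) = 0"
    using d0_inv(2)[of "d0 G \<omega>"] by (simp add: d0_diff)
  then have "d0 G (\<omega> - d0_inv G (d0 G \<omega>)) = 0" by (intro delta0_d0_eq_0 forms_diff) simp_all
  then show ?thesis by (simp add: d0_diff)
qed

end


subsection \<open>Weight filtration\<close>

context gradable
begin

lemma ext_d_minus_d0: "\<omega> \<in> F \<Longrightarrow> ext_d G \<omega> - d0 G \<omega> = grad \<omega>"
  by (intro ext) (simp add: minus_apply ext_d_eq d0_eq)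

lemma ext_d_split: "\<omega> \<in> F \<Longrightarrow> ext_d G \<omega> = grad \<omega> + d0 G \<omega>"
  using ext_d_minus_d0[of \<omega>] by (simp add: algebra_simps)

lemma ext_d_forms: "\<omega> \<in> F \<Longrightarrow> ext_d G \<omega> \<in> F"
  by (simp add: ext_d_split forms_add grad_forms d0_forms)

lemma grad_form_add: "\<omega> \<in> F \<Longrightarrow> \<eta> \<in> F \<Longrightarrow> grad (\<omega> + \<eta>) = grad \<omega> + grad \<eta>"
  by (intro ext) (simp add: plus_fun_def grad_add)

lemma ext_d_add: "\<omega> \<in> F \<Longrightarrow> \<eta> \<in> F \<Longrightarrow> ext_d G (\<omega> + \<eta>) = ext_d G \<omega> + ext_d G \<eta>"
  by (simp add: ext_d_split forms_add grad_form_add d0_add)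

definition tr :: "(nat \<Rightarrow> nat \<Rightarrow> bool) \<Rightarrow> ('g, 'v) form \<Rightarrow> ('g, 'v) form" where
  "tr Q \<omega> = (\<lambda>g. trunc Q (\<omega> g))"

lemma tr_forms: "\<omega> \<in> F \<Longrightarrow> tr Q \<omega> \<in> F"
  unfolding tr_def
  by (rule formsI, rule alternating_trunc[OF forms_alternating], assumption,
      rule trunc_smooth, rule forms_smooth)

lemma tr_add: "tr Q (\<omega> + \<eta>) = tr Q \<omega> + tr Q \<eta>"
  by (intro ext) (simp add: tr_def plus_fun_apply[of \<omega>] plus_fun_apply trunc_add)

lemma tr_zero: "tr Q 0 = 0"
  by (intro ext) (simp add: tr_def zero_fun_apply)

lemma tr_uminus: "tr Q (- \<omega>) = - tr Q \<omega>"
  using tr_add[of Q \<omega> "- \<omega>"] by (simp add: tr_zero eq_neg_iff_add_eq_0 add.commute)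

lemma tr_diff: "tr Q (\<omega> - \<eta>) = tr Q \<omega> - tr Q \<eta>"
  using tr_add[of Q \<omega> "- \<eta>"] by (simp add: tr_uminus)

lemma tr_d0:
  assumes "\<omega> \<in> F"
  shows "tr Q (d0 G \<omega>) = d0 G (tr (\<lambda>n. Q (Suc n)) \<omega>)"
proof
  show "tr Q (d0 G \<omega>) g = d0 G (tr (\<lambda>n. Q (Suc n)) \<omega>) g" for g
    by (simp only: d0_eq[OF tr_forms[OF assms]]) (simp only: tr_def d0_eq[OF assms]
        trunc_ce[OF forms_alternating[OF assms]])
qed

lemma tr_delta0:
  assumes "\<omega> \<in> F"
  shows "delta0 G (tr Q \<omega>) = tr (\<lambda>n. Q (Suc n)) (delta0 G \<omega>)"
proof
  show "delta0 G (tr Q \<omega>) g = tr (\<lambda>n. Q (Suc n)) (delta0 G \<omega>) g" for g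
    by (simp only: delta0_eq[OF tr_forms[OF assms]]) (simp only: tr_def delta0_eq[OF assms]
        adj_ce_trunc[OF forms_alternating[OF assms]])
qed

text \<open>Truncation commutes, up to the shift in degree, with \<open>d0\<close> and
  \<open>delta0\<close>. It therefore carries both conditions of \<open>d0_inv_unique\<close> from
  \<omega> to its truncation.\<close>

lemma tr_d0_inv:
  assumes \<omega>: "\<omega> \<in> F"
  shows "d0_inv G (tr Q \<omega>) = tr (\<lambda>n. Q (Suc n)) (d0_inv G \<omega>)"
proof (rule d0_inv_unique)
  obtain y where y: "y \<in> F" "d0_inv G \<omega> = delta0 G y" using d0_inv(1)[OF \<omega>] by auto
  then have "tr (\<lambda>n. Q (Suc n)) (d0_inv G \<omega>) = delta0 G (tr Q y)"
    using tr_delta0[OF y(1), of Q] by simp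
  then show "tr (\<lambda>n. Q (Suc n)) (d0_inv G \<omega>) \<in> delta0 G ` F"
    using tr_forms[OF y(1)] by simp
  have u: "d0_inv G \<omega> \<in> F" by (rule d0_inv_forms[OF \<omega>])
  have "tr Q \<omega> - d0 G (tr (\<lambda>n. Q (Suc n)) (d0_inv G \<omega>)) = tr Q (\<omega> - d0 G (d0_inv G \<omega>))"
    by (simp add: tr_diff tr_d0[OF u])
  then show "delta0 G (tr Q \<omega> - d0 G (tr (\<lambda>n. Q (Suc n)) (d0_inv G \<omega>))) = 0"
    using tr_delta0[OF forms_diff[OF \<omega> d0_forms[OF u]], of Q] by (simp add: d0_inv(2)[OF \<omega>] tr_zero)
qed (rule tr_forms[OF \<omega>])

lemma trunc_length: "alternating a \<Longrightarrow> trunc (\<lambda>n w. q n) a vs = (if q (length vs) then a vs else 0)"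
proof (induction vs arbitrary: q a)
  case (Cons v vs)
  have "trunc (\<lambda>n w. q (Suc n)) (contract (P w v) a) vs = (if q (Suc (length vs)) then a (P w v # vs) else 0)" for w
    by (simp only: Cons.IH[OF alternating_contract[OF Cons.prems]]) (simp only: contract_apply)
  then show ?case
    using alternating_decompose_hd[OF Cons.prems, of v vs] by auto
qed simp

text \<open>Having pure degree means being fixed by a truncation, so \<open>tr_d0\<close> and
  \<open>tr_d0_inv\<close> also yield the degree statements below.\<close>

lemma kforms_iff: "\<omega> \<in> kforms G k \<longleftrightarrow> \<omega> \<in> F \<and> tr (\<lambda>n w. n = k) \<omega> = \<omega>"
proof -
  have "tr (\<lambda>n w. n = k) \<omega> = \<omega> \<longleftrightarrow> (\<forall>g vs. length vs \<noteq> k \<longrightarrow> \<omega> g vs = 0)" if "\<omega> \<in> F"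
  proof -
    have t: "tr (\<lambda>n w. n = k) \<omega> g vs = (if length vs = k then \<omega> g vs else 0)" for g vs
      unfolding tr_def by (rule trunc_length[OF forms_alternating[OF that], of "\<lambda>n. n = k"])
    show ?thesis unfolding fun_eq_iff t by auto
  qed
  then show ?thesis by (auto simp: kforms_def)
qed

lemma kforms_forms: "\<omega> \<in> kforms G k \<Longrightarrow> \<omega> \<in> F"
  by (simp add: kforms_def)

lemma tr_kforms: "\<omega> \<in> F \<Longrightarrow> tr (\<lambda>n w. n = k) \<omega> \<in> kforms G k"
  using trunc_length[OF forms_alternating, of \<omega> "\<lambda>n. n = k"] tr_forms[of \<omega>]
  by (simp add: kforms_def tr_def)

lemma kforms_zero: "0 \<in> kforms G k"
  by (simp add: kforms_iff tr_zero forms_zero)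

lemma kforms_add: "\<omega> \<in> kforms G k \<Longrightarrow> \<eta> \<in> kforms G k \<Longrightarrow> \<omega> + \<eta> \<in> kforms G k"
  by (simp add: kforms_iff tr_add forms_add)

lemma kforms_diff: "\<omega> \<in> kforms G k \<Longrightarrow> \<eta> \<in> kforms G k \<Longrightarrow> \<omega> - \<eta> \<in> kforms G k"
  by (simp add: kforms_iff tr_diff forms_diff)

lemma kforms_uminus: "\<omega> \<in> kforms G k \<Longrightarrow> - \<omega> \<in> kforms G k"
  by (simp add: kforms_iff tr_uminus forms_uminus)

lemma d0_kforms: "\<omega> \<in> kforms G k \<Longrightarrow> d0 G \<omega> \<in> kforms G (Suc k)"
  by (simp add: kforms_iff d0_forms tr_d0)

lemma d0_inv_kforms: "\<omega> \<in> kforms G (Suc k) \<Longrightarrow> d0_inv G \<omega> \<in> kforms G k"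
  using tr_d0_inv[of \<omega> "\<lambda>n w. n = Suc k"] by (simp add: kforms_iff d0_inv_forms)

text \<open>Any preimage may be truncated to degree \<open>Suc k\<close>.\<close>

lemma kforms_delta0_image:
  assumes "u \<in> kforms G k" "u \<in> delta0 G ` F"
  shows "u \<in> delta0 G ` kforms G (Suc k)"
proof -
  obtain y where y: "y \<in> F" "u = delta0 G y" using assms by auto
  have "u = tr (\<lambda>n w. n = k) u" using assms by (simp add: kforms_iff)
  also have "\<dots> = delta0 G (tr (\<lambda>n w. n = Suc k) y)"
    using tr_delta0[OF y(1), of "\<lambda>n w. n = Suc k"] y by simp
  finally show ?thesis using tr_kforms[OF y(1)] by blast
qed

lemma grad_kforms:
  assumes "\<omega> \<in> kforms G k"
  shows "grad \<omega> \<in> kforms G (Suc k)"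
proof -
  have "grad \<omega> g vs = 0" if "length vs \<noteq> Suc k" for g vs
    unfolding grad_eq_sum
  proof (rule sum.neutral, rule ballI)
    fix i assume "i \<in> {..<length vs}"
    then have "length (del i vs) \<noteq> k" using that by (auto simp: del_def)
    then have "(\<lambda>h. \<omega> h (del i vs)) = (\<lambda>h. 0)" using assms by (auto simp: kforms_def)
    then show "(-1) ^ i * X (vs ! i) (\<lambda>h. \<omega> h (del i vs)) g = 0" by (simp add: X_const)
  qed
  then show ?thesis using grad_forms[OF kforms_forms[OF assms]] by (simp add: kforms_def)
qed

lemma ext_d_kforms: "\<omega> \<in> kforms G k \<Longrightarrow> ext_d G \<omega> \<in> kforms G (Suc k)"
  by (simp add: ext_d_split kforms_forms kforms_add grad_kforms d0_kforms)

text \<open>The weight filtration expressed by truncation and without reference to a degree. For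
  forms of pure degree it agrees with \<open>form_weight_ge\<close>, by
  \<open>form_weight_ge_imp\<close> and \<open>form_weight_geI\<close>.\<close>

definition weight_ge :: "nat \<Rightarrow> ('g, 'v) form \<Rightarrow> bool" where
  "weight_ge p \<omega> \<longleftrightarrow> \<omega> \<in> F \<and> tr (\<lambda>n w. p \<le> w) \<omega> = \<omega>"

lemma weight_ge_iff:
  "weight_ge p \<omega> \<longleftrightarrow> \<omega> \<in> F \<and> (\<forall>g ws xs. homogeneous ws xs \<longrightarrow> sum_list ws < p \<longrightarrow> \<omega> g xs = 0)"
proof (cases "\<omega> \<in> F")
  case True
  note h = trunc_homogeneous[OF forms_alternating[OF True], where Q = "\<lambda>n w. p \<le> w"]
  have "tr (\<lambda>n w. p \<le> w) \<omega> = \<omega>"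
    if "\<forall>g ws xs. homogeneous ws xs \<longrightarrow> sum_list ws < p \<longrightarrow> \<omega> g xs = 0"
  proof
    show "tr (\<lambda>n w. p \<le> w) \<omega> g = \<omega> g" for g
      unfolding tr_def
      by (rule homogeneous_eqI[OF alternating_trunc[OF forms_alternating[OF True]] forms_alternating[OF True]])
        (use that in \<open>auto simp: h\<close>)
  qed
  moreover have "\<omega> g xs = 0" if "tr (\<lambda>n w. p \<le> w) \<omega> = \<omega>" "homogeneous ws xs" "sum_list ws < p" for g ws xs
    using h[OF that(2), of g] fun_cong[OF fun_cong[OF that(1), of g], of xs] that(3) by (simp add: tr_def)
  ultimately show ?thesis using True by (auto simp: weight_ge_def)
qed (simp add: weight_ge_def)

lemma weight_ge_0: "\<omega> \<in> F \<Longrightarrow> weight_ge 0 \<omega>"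
  by (simp add: weight_ge_iff)

lemma weight_ge_uminus: "weight_ge p \<omega> \<Longrightarrow> weight_ge p (- \<omega>)"
  by (simp add: weight_ge_def tr_uminus forms_uminus)

lemma weight_ge_d0_inv: "weight_ge p \<omega> \<Longrightarrow> weight_ge p (d0_inv G \<omega>)"
  using tr_d0_inv[of \<omega> "\<lambda>n w. p \<le> w"] by (simp add: weight_ge_def d0_inv_forms)

text \<open>Each term removes one argument to differentiate along it. A nonzero homogeneous argument
  has positive weight, so \<omega> is evaluated at a list of strictly smaller total weight.\<close>

lemma grad_homogeneous_eq_0:
  assumes "homogeneous ws xs" "\<omega> \<in> F"
    and "\<And>g us ys. homogeneous us ys \<Longrightarrow> sum_list us < sum_list ws \<Longrightarrow> \<omega> g ys = 0"
  shows "grad \<omega> g xs = 0"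
  using assms
proof (induction arbitrary: \<omega> rule: list_all2_induct)
  case Nil
  then show ?case by simp
next
  case (Cons w ws x xs)
  have "X x (\<lambda>h. \<omega> h xs) g = 0"
  proof (cases "w \<in> weights G")
    case True
    then have "w > 0" using W_pos by (cases w) auto
    then have "\<omega> h xs = 0" for h using Cons.prems(2)[OF Cons.hyps(2)] by simp
    then show ?thesis by (simp add: X_const)
  next
    case False
    then have "x = 0" using L_trivial Cons.hyps(1) by auto
    then show ?thesis using X_scale[OF forms_smooth[OF Cons.prems(1)], of 0 0 xs] by simp
  qed
  moreover have "grad (\<lambda>h. contract x (\<omega> h)) g xs = 0"
  proof (rule Cons.IH[OF forms_contract[OF Cons.prems(1)]])
    fix h us ys assume "homogeneous us ys" "sum_list us < sum_list ws"
    then show "contract x (\<omega> h) ys = 0"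
      unfolding contract_apply using Cons.hyps(1) by (intro Cons.prems(2)[of "w # us"]) auto
  qed
  ultimately show ?case by simp
qed

lemma weight_ge_grad:
  assumes "weight_ge p \<omega>"
  shows "weight_ge (Suc p) (grad \<omega>)"
  unfolding weight_ge_iff
proof (intro conjI allI impI)
  show "grad \<omega> \<in> F" using assms by (simp add: weight_ge_iff grad_forms)
  show "grad \<omega> g xs = 0" if "homogeneous ws xs" "sum_list ws < Suc p" for g ws xs
    by (rule grad_homogeneous_eq_0[OF that(1)]) (use assms that(2) in \<open>auto simp: weight_ge_iff\<close>)
qed

text \<open>An alternating function can be nonzero only at lists of nonzero vectors no longer than
  the dimension, and the total weight of such a homogeneous list is bounded.\<close>

lemma weight_ge_bounded: "\<exists>N. \<forall>p\<ge>N. \<forall>\<omega>. weight_ge p \<omega> \<longrightarrow> \<omega> = 0"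
proof (intro exI allI impI)
  let ?M = "\<Sum>(weights G)"
  \<comment> \<open>The witness for \<open>N\<close> is read off here. It is a crude bound: every
    weight is at most the sum \<open>?M\<close> of all weights.\<close>
  fix p \<omega> assume p: "DIM('v) * ?M + 1 \<le> p" and \<omega>: "weight_ge p \<omega>"
  then have F: "\<omega> \<in> F" by (simp add: weight_ge_def)
  have "\<omega> g = 0" for g
  proof (rule homogeneous_eqI[OF forms_alternating[OF F] alternating_zero])
    fix ws xs assume h: "homogeneous ws xs"
    consider "length xs > DIM('v)" | "0 \<in> set xs" | "length xs \<le> DIM('v)" "0 \<notin> set xs" by linarith
    then show "\<omega> g xs = 0 xs"
    proof cases
      case 1
      then show ?thesis using alternating_long[OF forms_alternating[OF F]] by (simp add: zero_fun_apply)
    next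
      case 2
      then obtain ys zs where "xs = ys @ 0 # zs" by (auto dest: split_list)
      then show ?thesis
        using linear_0[OF alternating_linear[OF forms_alternating[OF F]]] by (simp add: zero_fun_apply)
    next
      case 3
      have "w \<le> ?M" if "w \<in> set ws" for w
      proof -
        obtain i where "i < length ws" "w = ws ! i" using \<open>w \<in> set ws\<close> by (auto simp: in_set_conv_nth)
        then have xi: "xs ! i \<in> layer G w" "xs ! i \<in> set xs" using h by (auto simp: list_all2_conv_all_nth)
        have "w \<in> weights G"
        proof (rule ccontr)
          assume "w \<notin> weights G"
          then have "xs ! i = 0" using xi(1) L_trivial[of w] by simp
          then show False using xi(2) 3(2) by simp
        qed
        then show ?thesis using finite_W by (intro member_le_sum) simp_all
      qed
      moreover have "sum_list us \<le> length us * M" if "\<forall>w\<in>set us. w \<le> M" for us and M :: nat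
        using that by (induction us) (auto intro: add_mono)
      ultimately have "sum_list ws \<le> length ws * ?M" by simp
      also have "length ws = length xs" using h by (rule list_all2_lengthD)
      also have "length xs * ?M \<le> DIM('v) * ?M" using 3 by simp
      finally have "sum_list ws < p" using p by simp
      then show ?thesis using \<omega> h by (simp add: weight_ge_iff zero_fun_apply)
    qed
  qed
  then show "\<omega> = 0" by (intro ext) (simp add: zero_fun_apply)
qed

section \<open>Agreement of \<open>weight_ge\<close> with the filtration spanned by wedge
  products\<close>

lemma wedge_homogeneous_eq_0:
  assumes "list_all2 (covector_weight G) vs \<theta>" "homogeneous ws xs" "sum_list ws \<noteq> sum_list vs"
  shows "wedge \<theta> xs = 0"
proof (cases "length xs = length \<theta>")
  case True
  let ?k = "length \<theta>"
  have len: "length vs = ?k" "length ws = ?k"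
    using True list_all2_lengthD[OF assms(1)] list_all2_lengthD[OF assms(2)] by auto
  \<comment> \<open>A nonzero product forces every covector to meet a vector of its own weight. Then
    \<sigma> matches the two weight lists, and their sums agree.\<close>
  have prod0: "(\<Prod>i<?k. (\<theta> ! i) (xs ! \<sigma> i)) = 0" if s: "\<sigma> permutes {..<?k}" for \<sigma>
  proof (rule ccontr)
    assume nz: "\<not> ?thesis"
    have "vs ! i = ws ! \<sigma> i" if i: "i < ?k" for i
    proof (rule ccontr)
      assume ne: "vs ! i \<noteq> ws ! \<sigma> i"
      have si: "\<sigma> i < ?k" using permutes_in_image[OF s, of i] i by simp
      have \<theta>: "covector_weight G (vs ! i) (\<theta> ! i)"
        using assms(1) i len by (auto simp: list_all2_conv_all_nth)
      have x: "xs ! \<sigma> i \<in> layer G (ws ! \<sigma> i)"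
        using assms(2) si len True by (auto simp: list_all2_conv_all_nth)
      have "(\<theta> ! i) (xs ! \<sigma> i) = 0"
      proof (cases "ws ! \<sigma> i \<in> weights G")
        case True
        then show ?thesis using \<theta> x ne by (auto simp: covector_weight_def)
      next
        case False
        then show ?thesis using \<theta> x L_trivial linear_0 by (auto simp: covector_weight_def)
      qed
      then show False using nz i by auto
    qed
    then have "(\<Sum>i<?k. vs ! i) = (\<Sum>i<?k. ws ! \<sigma> i)" by (intro sum.cong) auto
    also have "\<dots> = (\<Sum>i<?k. ws ! i)" using sum.permute[OF s, of "(!) ws"] by (simp add: comp_def)
    finally show False using assms(3) len by (simp add: sum_list_sum_nth atLeast0LessThan)
  qed
  have "(\<Sum>\<sigma> | \<sigma> permutes {..<?k}. of_int (sign \<sigma>) * (\<Prod>i<?k. (\<theta> ! i) (xs ! \<sigma> i))) = 0"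
    by (intro sum.neutral ballI) (simp only: mem_Collect_eq prod0 mult_zero_right)
  then show ?thesis by (simp add: wedge_def)
qed (simp add: wedge_def)

lemma form_weight_ge_imp:
  assumes "form_weight_ge G k p \<omega>" "\<omega> \<in> F"
  shows "weight_ge p \<omega>"
  unfolding weight_ge_iff
proof (intro conjI allI impI)
  fix g ws xs assume h: "homogeneous ws xs" "sum_list ws < p"
  obtain n c where c: "\<omega> = (\<Sum>j<(n::nat). c j)" "\<And>j. j < n \<Longrightarrow> \<exists>q\<ge>p. form_weight G k q (c j)"
    using assms(1) by (auto simp: form_weight_ge_def)
  have "c j g xs = 0" if j: "j < n" for j
  proof -
    obtain q where q: "q \<ge> p" "form_weight G k q (c j)" using c(2)[OF j] by auto
    then obtain m f \<theta> where cj: "c j = (\<lambda>g vs. \<Sum>i<(m::nat). f i g * wedge (\<theta> i) vs)"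
      and \<theta>: "\<forall>i<m. \<exists>us. length us = k \<and> list_all2 (covector_weight G) us (\<theta> i) \<and> sum_list us = q"
      by (auto simp: form_weight_def)
    have "wedge (\<theta> i) xs = 0" if "i < m" for i
      using \<theta> that wedge_homogeneous_eq_0[OF _ h(1)] h(2) q(1) by fastforce
    then show ?thesis by (simp add: cj)
  qed
  then show "\<omega> g xs = 0" by (simp add: c(1) sum_fun_apply)
qed (rule assms)

text \<open>Apply the symmetric idempotent \<open>P w\<close> to the basis expansion of
  \<open>P w v\<close> and sum over the weights. The members of this frame are homogeneous, as
  weights of covectors require.\<close>

lemma layer_frame: "v = (\<Sum>(w, b)\<in>weights G \<times> Basis. (P w b \<bullet> v) *\<^sub>R P w b)"
proof -
  have "P w v = (\<Sum>b\<in>Basis. (P w b \<bullet> v) *\<^sub>R P w b)" for w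
  proof -
    have pp: "P w (P w v) = P w v" by (rule trans[OF P_on_layer[OF P_decomposition(1)]]) simp
    have sym: "P w v \<bullet> b = P w b \<bullet> v" for b
      using P_self_adjoint[of w v b] by (simp only: inner_commute)
    have "P w v = P w (\<Sum>b\<in>Basis. (P w v \<bullet> b) *\<^sub>R b)" by (simp add: euclidean_representation pp)
    also have "\<dots> = (\<Sum>b\<in>Basis. (P w v \<bullet> b) *\<^sub>R P w b)"
      by (simp add: linear_sum[OF P_linear] linear_scale[OF P_linear])
    finally show ?thesis by (simp only: sym)
  qed
  then show ?thesis using P_decomposition(2)[of v] by (simp add: sum.cartesian_product[symmetric])
qed

lemma covector_weight_layer:
  assumes "w \<in> weights G"
  shows "covector_weight G w ((\<bullet>) (P w b))"
  using assms L_orthogonal[OF _ assms _ P_decomposition(1)[of w b]]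
  by (auto simp: covector_weight_def bounded_linear.linear[OF bounded_linear_inner_right]
      intro: L_orthogonal[OF assms _ _ P_decomposition(1)])

text \<open>Expand \<omega> in wedge products dual to the homogeneous frame. Each term has a pure
  weight, and the coefficients of terms of weight below \<open>p\<close> are values of \<omega> that
  vanish by hypothesis.\<close>

lemma form_weight_geI:
  assumes \<omega>: "\<omega> \<in> kforms G k" "weight_ge p \<omega>"
  shows "form_weight_ge G k p \<omega>"
proof -
  let ?I = "weights G \<times> (Basis :: 'v set)"
  let ?f = "\<lambda>(w, b). P w b"
  let ?t = "\<lambda>is g vs. \<omega> g (map ?f is) / fact k * dual_wedge (map ?f is) vs"
  define A where "A = {is \<in> nlists ?I k. p \<le> sum_list (map fst is)}"
  have fin: "finite (nlists ?I k)" using finite_W by (intro finite_lists_length_eq) simp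
  have "finite A" by (rule finite_subset[OF _ fin]) (auto simp: A_def)
  \<comment> \<open>\<open>form_weight_ge\<close> sums over an initial segment of the naturals, so
    the surviving index lists are enumerated.\<close>
  then obtain h where h: "bij_betw h {..<card A} A"
    using ex_bij_betw_nat_finite[of A] by (auto simp: atLeast0LessThan)
  have F: "\<omega> \<in> F" by (rule kforms_forms[OF \<omega>(1)])
  have frame: "v = (\<Sum>i\<in>?I. (?f i \<bullet> v) *\<^sub>R ?f i)" for v
    using layer_frame[of v] by (simp add: case_prod_unfold)
  have "\<omega> g vs = (\<Sum>is\<in>A. ?t is g vs)" for g vs
  proof (cases "length vs = k")
    case True
    have "\<omega> g vs = (\<Sum>is\<in>nlists ?I k. ?t is g vs)"
      using dual_wedge_expand[OF forms_alternating[OF F, of g], where I = ?I and f = ?f and us = vs, OF frame] True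
      by (simp add: sum_divide_distrib[symmetric])
    also have "\<dots> = (\<Sum>is\<in>A. ?t is g vs)"
    proof (rule sum.mono_neutral_right[OF fin])
      show "\<forall>is\<in>nlists ?I k - A. ?t is g vs = 0"
      proof
        fix "is" assume i: "is \<in> nlists ?I k - A"
        have "homogeneous (map fst is) (map ?f is)"
          by (auto simp: list_all2_conv_all_nth case_prod_unfold P_decomposition(1))
        moreover have "sum_list (map fst is) < p" using i by (auto simp: A_def)
        ultimately have "\<omega> g (map ?f is) = 0" using \<omega>(2) unfolding weight_ge_iff by blast
        then show "?t is g vs = 0" by simp
      qed
    qed (auto simp: A_def)
    finally show ?thesis .
  next
    case False
    then have "(\<Sum>is\<in>A. ?t is g vs) = 0" by (intro sum.neutral) (auto simp: A_def wedge_def)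
    moreover have "\<omega> g vs = 0" using \<omega>(1) False by (simp add: kforms_def)
    ultimately show ?thesis by (simp only:)
  qed
  note expand = this
  have sum: "\<omega> = (\<Sum>j<card A. ?t (h j))"
  proof (intro ext)
    fix g vs
    have "\<omega> g vs = (\<Sum>j<card A. ?t (h j) g vs)"
      by (rule trans[OF expand sum.reindex_bij_betw[OF h, symmetric]])
    then show "\<omega> g vs = (\<Sum>j<card A. ?t (h j)) g vs" by (simp only: sum_fun_apply)
  qed
  have "\<exists>q\<ge>p. form_weight G k q (?t (h j))" if "j < card A" for j
  proof -
    have hj: "h j \<in> A" using h that by (auto simp: bij_betw_def)
    have "form_weight G k (sum_list (map fst (h j))) (?t (h j))"
      unfolding form_weight_def
    proof (intro exI conjI allI impI)
      show "?t (h j) = (\<lambda>g vs. \<Sum>i<Suc 0. \<omega> g (map ?f (h j)) / fact k * wedge (map (\<bullet>) (map ?f (h j))) vs)"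
        by simp
      show "(\<lambda>g. \<omega> g (map ?f (h j)) / fact k) \<in> Cinf G"
        using smooth_scale[OF forms_smooth[OF F], of "inverse (fact k)"] by (simp add: field_simps)
      show "length (map fst (h j)) = k" using hj by (simp add: A_def)
      show "list_all2 (covector_weight G) (map fst (h j)) (map (\<bullet>) (map ?f (h j)))"
        using hj by (auto simp: list_all2_conv_all_nth case_prod_unfold A_def intro!: covector_weight_layer dest!: nth_mem)
    qed simp
    then show ?thesis using hj by (auto simp: A_def)
  qed
  then show ?thesis unfolding form_weight_ge_def using sum by blast
qed

end


subsection \<open>Runs of the Leibniz recursion\<close>

context gradable
begin

lemma d0_inv_zero: "d0_inv G 0 = 0"
  by (rule d0_inv_delta0_closed[OF forms_zero delta0_zero])

lemma d0_inv_uminus: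
  assumes "\<omega> \<in> F"
  shows "d0_inv G (- \<omega>) = - d0_inv G \<omega>"
proof -
  have "d0_inv G \<omega> + d0_inv G (- \<omega>) = 0"
    using d0_inv_add[OF assms forms_uminus[OF assms]] by (simp add: d0_inv_zero)
  then show ?thesis by (simp add: add_eq_0_iff)
qed

lemma rumin_b_eq: "\<omega> \<in> F \<Longrightarrow> rumin_b G \<omega> = - d0_inv G (grad \<omega>)"
  by (simp add: rumin_b_def ext_d_minus_d0)

lemma rumin_b_add: "\<omega> \<in> F \<Longrightarrow> \<eta> \<in> F \<Longrightarrow> rumin_b G (\<omega> + \<eta>) = rumin_b G \<omega> + rumin_b G \<eta>"
  by (simp add: rumin_b_eq forms_add grad_form_add d0_inv_add grad_forms)

lemma rumin_b_zero: "rumin_b G 0 = 0"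
  using rumin_b_add[OF forms_zero forms_zero] by simp

lemma weight_ge_rumin_b: "weight_ge p \<omega> \<Longrightarrow> weight_ge (Suc p) (rumin_b G \<omega>)"
  using weight_ge_uminus[OF weight_ge_d0_inv[OF weight_ge_grad[of p \<omega>]]]
  by (simp add: rumin_b_eq weight_ge_def)

text \<open>\<open>b\<close> strictly raises weights, so a fixed point has weight at least
  \<open>p\<close> for every \<open>p\<close>. This is the injectivity of
  \<open>Id - b\<close>.\<close>

lemma rumin_b_fixed_eq_0:
  assumes "\<omega> \<in> F" "\<omega> = rumin_b G \<omega>"
  shows "\<omega> = 0"
proof -
  have "weight_ge p \<omega>" for p
  proof (induction p)
    case (Suc p)
    then show ?case using weight_ge_rumin_b[OF Suc] assms(2) by simp
  qed (rule weight_ge_0[OF assms(1)])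
  then show ?thesis using weight_ge_bounded by blast
qed

text \<open>Injectivity determines the inverse at any form exhibited as
  \<open>(Id - b) \<eta>\<close>; the invariant of a run exhibits its form in this way.\<close>

lemma inv_Id_minus_b_eq:
  assumes "\<eta> \<in> F"
  shows "inv_Id_minus_b G (\<eta> - rumin_b G \<eta>) = \<eta>"
  unfolding inv_Id_minus_b_def
proof (rule the_inv_into_f_eq[OF inj_onI])
  fix x y assume x: "x \<in> F" and y: "y \<in> F" and "x - rumin_b G x = y - rumin_b G y"
  moreover have "rumin_b G x = rumin_b G (x - y) + rumin_b G y"
    using rumin_b_add[OF forms_diff[OF x y] y] by simp
  ultimately have "x - y = rumin_b G (x - y)" by (simp add: algebra_simps)
  then have "x - y = 0" by (rule rumin_b_fixed_eq_0[OF forms_diff[OF x y]])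
  then show "x = y" by simp
qed (use assms in auto)

text \<open>\<open>d0_inv\<close> kills the kernel of \<open>Box0\<close> and the image of
  \<open>delta0\<close>, while \<open>d0\<close> kills all components but \<open>t\<close>. So
  \<beta> determines the three components, and every round is forced.\<close>

lemma split_components:
  assumes "\<xi> \<in> d0 G ` F" "r \<in> F" "Box0 G r = 0" "t \<in> delta0 G ` F"
  shows "d0_inv G (\<xi> + r + t) = d0_inv G \<xi>" "d0 G (d0_inv G \<xi>) = \<xi>"
    and "d0_inv G (d0 G (\<xi> + r + t)) = t"
proof -
  obtain x where x: "x \<in> F" "\<xi> = d0 G x" using assms(1) by auto
  obtain y where y: "y \<in> F" "t = delta0 G y" using assms(4) by auto
  have r: "d0 G r = 0" "delta0 G r = 0" using Box0_eq_0_iff[OF assms(2)] assms(3) by auto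
  have F: "\<xi> \<in> F" "t \<in> F" using x y by (auto intro: d0_forms delta0_forms)
  have "d0_inv G r = 0" by (rule d0_inv_delta0_closed[OF assms(2) r(2)])
  moreover have "d0_inv G t = 0"
    using F(2) by (rule d0_inv_delta0_closed) (simp add: y delta0_delta0)
  ultimately show "d0_inv G (\<xi> + r + t) = d0_inv G \<xi>"
    using F assms(2) by (simp add: d0_inv_add forms_add)
  show "d0 G (d0_inv G \<xi>) = \<xi>" unfolding x(2) by (rule d0_d0_inv_d0[OF x(1)])
  have "d0 G \<xi> = 0" unfolding x(2) by (rule d0_d0[OF x(1)])
  then have "d0 G (\<xi> + r + t) = d0 G t" using F assms(2) r by (simp add: d0_add forms_add)
  then show "d0_inv G (d0 G (\<xi> + r + t)) = t" using d0_inv_d0_delta0[OF assms(4)] by simp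
qed

lemma split_exists:
  assumes "\<beta> \<in> F"
  shows "\<exists>\<xi> r t. \<beta> = \<xi> + r + t \<and> \<xi> \<in> d0 G ` F \<and> r \<in> F \<and> Box0 G r = 0 \<and> t \<in> delta0 G ` F"
proof (intro exI conjI)
  note [simp] = assms d0_forms delta0_forms d0_inv_forms forms_diff forms_add
  \<comment> \<open>The middle component that remains is \<open>Pi0 G \<beta>\<close>.\<close>
  let ?\<xi> = "d0 G (d0_inv G \<beta>)" and ?t = "d0_inv G (d0 G \<beta>)"
  show "\<beta> = ?\<xi> + (\<beta> - ?\<xi> - ?t) + ?t" by simp
  show "?\<xi> \<in> d0 G ` F" by simp
  show r: "\<beta> - ?\<xi> - ?t \<in> F" by simp
  show t: "?t \<in> delta0 G ` F" by (rule d0_inv(1)) simp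
  have "d0 G (\<beta> - ?\<xi> - ?t) = 0" by (simp add: d0_diff d0_d0 d0_d0_inv_d0)
  moreover have "delta0 G ?t = 0" using t by (auto simp: delta0_delta0)
  then have "delta0 G (\<beta> - ?\<xi> - ?t) = 0"
    using d0_inv(2)[OF assms] by (simp add: delta0_diff[of "\<beta> - ?\<xi>"])
  ultimately show "Box0 G (\<beta> - ?\<xi> - ?t) = 0" using Box0_eq_0_iff[OF r] by simp
qed

text \<open>The equation for \<open>\<eta> - rumin_b G \<eta>\<close> is the telescoping identity
  that links runs to \<open>rumin_Pi\<close>. In the last claim each round contributes one unit of
  weight, coming from \<open>grad\<close>.\<close>

lemma leibniz_run_invariant:
  assumes "leibniz_run G \<alpha> n \<rho> \<eta> \<tau> \<beta>" "\<alpha> \<in> kforms G m"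
  shows "\<beta> \<in> kforms G (Suc m)" "\<rho> \<in> kforms G (Suc m)" "Box0 G \<rho> = 0"
    and "\<eta> \<in> delta0 G ` kforms G (Suc m)" "\<tau> \<in> delta0 G ` kforms G (Suc (Suc m))"
    and "ext_d G \<alpha> = \<rho> + ext_d G \<eta> + \<tau> + \<beta>"
    and "\<eta> - rumin_b G \<eta> = d0_inv G (ext_d G \<alpha>) - d0_inv G \<beta>"
    and "\<And>p. weight_ge p (ext_d G \<alpha>) \<Longrightarrow> weight_ge (p + n) \<beta>"
proof -
  \<comment> \<open>Membership in the image of \<open>delta0\<close> and pure degree are carried
    separately through the induction; \<open>kforms_delta0_image\<close> joins them at the
    end.\<close>
  let ?I = "\<lambda>n \<rho> \<eta> \<tau> \<beta>. \<beta> \<in> kforms G (Suc m) \<and> \<rho> \<in> kforms G (Suc m) \<and> Box0 G \<rho> = 0 \<and>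
    \<eta> \<in> delta0 G ` F \<and> \<eta> \<in> kforms G m \<and> \<tau> \<in> delta0 G ` F \<and> \<tau> \<in> kforms G (Suc m) \<and>
    ext_d G \<alpha> = \<rho> + ext_d G \<eta> + \<tau> + \<beta> \<and>
    \<eta> - rumin_b G \<eta> = d0_inv G (ext_d G \<alpha>) - d0_inv G \<beta> \<and>
    (\<forall>p. weight_ge p (ext_d G \<alpha>) \<longrightarrow> weight_ge (p + n) \<beta>)"
  have zero_image: "0 \<in> delta0 G ` F" using forms_zero delta0_zero by (metis imageI)
  have ext_d_zero: "ext_d G 0 = 0" using ext_d_add[OF forms_zero forms_zero] by simp
  have "?I n \<rho> \<eta> \<tau> \<beta>" using assms(1)
  proof (induction rule: leibniz_run.induct)
    case start
    show ?case
      using Box0_eq_0_iff[OF forms_zero] ext_d_kforms[OF assms(2)]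
      by (simp add: kforms_zero d0_zero delta0_zero zero_image ext_d_zero rumin_b_zero)
  next
    case (round n \<rho> \<eta> \<tau> \<beta> \<xi> r t)
    note IH = round.IH
    have \<beta>: "\<beta> \<in> kforms G (Suc m)" "\<beta> \<in> F" using IH kforms_forms by blast+
    note comps = split_components[OF round.hyps(3,4,5,6), folded round.hyps(2)]
    let ?u = "d0_inv G \<beta>"
    have u: "d0_inv G \<xi> = ?u" "d0 G ?u = \<xi>" using comps by simp_all
    have uk: "?u \<in> kforms G m" by (rule d0_inv_kforms[OF \<beta>(1)])
    then have uF: "?u \<in> F" by (rule kforms_forms)
    have \<beta>': "- (ext_d G (d0_inv G \<xi>) - d0 G (d0_inv G \<xi>)) = - grad ?u"
      by (simp only: u(1) ext_d_minus_d0[OF uF])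
    \<comment> \<open>A round prescribes no degrees for its components; they are recovered by
      expressing the components through \<beta>.\<close>
    have tk: "t \<in> kforms G (Suc m)"
      using d0_inv_kforms[OF d0_kforms[OF \<beta>(1)]] comps(3) by simp
    have \<xi>k: "\<xi> \<in> kforms G (Suc m)" using d0_kforms[OF uk] u by simp
    have rk: "r \<in> kforms G (Suc m)"
      using kforms_diff[OF kforms_diff[OF \<beta>(1) \<xi>k] tk] round.hyps(2) by simp
    have \<rho>F: "\<rho> \<in> F" and \<eta>F: "\<eta> \<in> F" using IH kforms_forms by blast+
    have Box: "Box0 G (\<rho> + r) = 0"
      using Box0_eq_0_iff[OF \<rho>F] Box0_eq_0_iff[OF round.hyps(4)] Box0_eq_0_iff[OF forms_add[OF \<rho>F round.hyps(4)]]
        IH round.hyps(5) by (simp add: d0_add delta0_add \<rho>F round.hyps(4))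
    have du: "ext_d G ?u = grad ?u + \<xi>" using ext_d_split[OF uF] u by simp
    have "ext_d G \<alpha> = \<rho> + ext_d G \<eta> + \<tau> + (\<xi> + r + t)"
      unfolding round.hyps(2)[symmetric] using IH by blast
    then have ext: "ext_d G \<alpha> = (\<rho> + r) + ext_d G (\<eta> + ?u) + (\<tau> + t) + - grad ?u"
      by (simp only: ext_d_add[OF \<eta>F uF] du) (simp add: algebra_simps)
    \<comment> \<open>\<open>- grad ?u\<close> is the next remainder, so the new primitive trades
      \<open>d0_inv\<close> of the old remainder for \<open>d0_inv\<close> of the next one.\<close>
    have b: "rumin_b G ?u = d0_inv G (- grad ?u)"
      by (simp add: rumin_b_eq uF d0_inv_uminus grad_forms)
    have eta: "(\<eta> + ?u) - rumin_b G (\<eta> + ?u) = d0_inv G (ext_d G \<alpha>) - d0_inv G (- grad ?u)"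
    proof -
      have "(\<eta> + ?u) - rumin_b G (\<eta> + ?u) = (\<eta> - rumin_b G \<eta>) + ?u - rumin_b G ?u"
        by (simp add: rumin_b_add \<eta>F uF)
      then show ?thesis using IH by (simp add: b)
    qed
    have wt: "weight_ge (p + Suc n) (- grad ?u)" if "weight_ge p (ext_d G \<alpha>)" for p
      using weight_ge_uminus[OF weight_ge_grad[OF weight_ge_d0_inv[of "p + n" \<beta>]]] IH that by simp
    show ?case
      unfolding \<beta>' unfolding u(1)
      using IH Box ext eta wt kforms_uminus[OF grad_kforms[OF uk]] kforms_add rk tk uk
        delta0_image_add round.hyps(6) d0_inv(1)[OF \<beta>(2)] by blast
  qed
  then show "\<beta> \<in> kforms G (Suc m)" "\<rho> \<in> kforms G (Suc m)" "Box0 G \<rho> = 0"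
    "\<eta> \<in> delta0 G ` kforms G (Suc m)" "\<tau> \<in> delta0 G ` kforms G (Suc (Suc m))"
    "ext_d G \<alpha> = \<rho> + ext_d G \<eta> + \<tau> + \<beta>"
    "\<eta> - rumin_b G \<eta> = d0_inv G (ext_d G \<alpha>) - d0_inv G \<beta>"
    "\<And>p. weight_ge p (ext_d G \<alpha>) \<Longrightarrow> weight_ge (p + n) \<beta>"
    using kforms_delta0_image by blast+
qed

lemma leibniz_run_exists:
  assumes "\<alpha> \<in> kforms G m"
  shows "\<exists>\<rho> \<eta> \<tau> \<beta>. leibniz_run G \<alpha> n \<rho> \<eta> \<tau> \<beta>"
proof (induction n)
  case 0
  show ?case using leibniz_run.start by blast
next
  case (Suc n)
  then obtain \<rho> \<eta> \<tau> \<beta> where run: "leibniz_run G \<alpha> n \<rho> \<eta> \<tau> \<beta>" by blast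
  have "\<beta> \<in> F" by (rule kforms_forms[OF leibniz_run_invariant(1)[OF run assms]])
  from split_exists[OF this] obtain \<xi> r t where
    "\<beta> = \<xi> + r + t" "\<xi> \<in> d0 G ` F" "r \<in> F" "Box0 G r = 0" "t \<in> delta0 G ` F" by blast
  from leibniz_run.round[OF run this] show ?case by blast
qed

text \<open>With remainder 0 the invariant identifies \<eta> with
  \<open>rumin_Pi G \<alpha>\<close>. Then \<open>\<alpha> - \<eta>\<close> is
  \<open>rumin_Pi_E G \<alpha>\<close>, and its exterior derivative is
  \<open>\<rho> + \<tau>\<close>.\<close>

lemma leibniz_run_result:
  assumes run: "leibniz_run G \<alpha> n \<rho> \<eta> \<tau> 0" and \<alpha>: "\<alpha> \<in> rumin_forms G m"
  shows "rumin_d G \<alpha> = \<rho>"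
proof -
  have \<alpha>k: "\<alpha> \<in> kforms G m" and box: "Box0 G \<alpha> = 0" using \<alpha> by (auto simp: rumin_forms_def)
  note inv = leibniz_run_invariant[OF run \<alpha>k]
  have \<alpha>F: "\<alpha> \<in> F" and \<rho>F: "\<rho> \<in> F" using \<alpha>k inv(2) kforms_forms by auto
  have \<tau>i: "\<tau> \<in> delta0 G ` F" and "\<eta> \<in> delta0 G ` F" using inv(4,5) kforms_forms by auto
  then have \<eta>F: "\<eta> \<in> F" and \<tau>F: "\<tau> \<in> F" using delta0_forms by auto
  have "d0_inv G \<alpha> = 0"
    using Box0_eq_0_iff[OF \<alpha>F] box by (intro d0_inv_delta0_closed[OF \<alpha>F]) simp
  moreover have "inv_Id_minus_b G 0 = 0"
    using inv_Id_minus_b_eq[OF forms_zero] by (simp add: rumin_b_zero)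
  moreover have "inv_Id_minus_b G (d0_inv G (ext_d G \<alpha>)) = \<eta>"
    using inv_Id_minus_b_eq[OF \<eta>F] inv(7) by (simp add: d0_inv_zero)
  moreover have "ext_d G 0 = 0" using ext_d_add[OF forms_zero forms_zero] by simp
  ultimately have "rumin_Pi G \<alpha> = \<eta>" by (simp add: rumin_Pi_def)
  moreover have "ext_d G (\<alpha> - \<eta>) = \<rho> + \<tau>"
    using ext_d_add[OF forms_diff[OF \<alpha>F \<eta>F] \<eta>F] inv(6) by (simp add: algebra_simps)
  ultimately have "rumin_d G \<alpha> = Pi0 G (\<rho> + \<tau>)"
    by (simp add: rumin_d_def rumin_Pi_E_def)
  also have "\<dots> = \<rho>"
  proof -
    have "0 \<in> d0 G ` F" using forms_zero d0_zero by (metis imageI)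
    \<comment> \<open>The splitting of \<open>\<rho> + \<tau>\<close> with \<open>\<xi> = 0\<close>:
      both terms that \<open>Pi0\<close> subtracts are known, and their sum is \<tau>.\<close>
    from split_components[OF this \<rho>F inv(3) \<tau>i] show ?thesis
      by (simp add: Pi0_def d0_inv_zero d0_zero)
  qed
  finally show ?thesis .
qed

end

theorem proposition4p1:
  fixes G :: "('g::{t2_space, second_countable_topology}, 'v::euclidean_space) graded_group"
    and k :: nat and \<alpha> :: "('g, 'v) form"
  assumes "positively_gradable_group G"
    and "k \<ge> 1"
    and "\<alpha> \<in> rumin_forms G (k - 1)"
  shows "(\<exists>N. \<forall>n\<ge>N. (\<exists>\<rho> \<eta> \<tau>. leibniz_run G \<alpha> n \<rho> \<eta> \<tau> 0) \<and>
             (\<forall>\<rho> \<eta> \<tau> \<beta>. leibniz_run G \<alpha> n \<rho> \<eta> \<tau> \<beta> \<longrightarrow> \<beta> = 0)) \<and>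
         (\<forall>n \<rho> \<eta> \<tau> \<beta>. leibniz_run G \<alpha> n \<rho> \<eta> \<tau> \<beta> \<longrightarrow>
             ext_d G \<alpha> = \<rho> + ext_d G \<eta> + \<tau> + \<beta> \<and>
             (\<forall>p. form_weight_ge G k p (ext_d G \<alpha>) \<longrightarrow> form_weight_ge G k (p + n) \<beta>)) \<and>
         (\<forall>n \<rho> \<eta> \<tau>. leibniz_run G \<alpha> n \<rho> \<eta> \<tau> 0 \<longrightarrow>
             \<rho> = rumin_d G \<alpha> \<and> \<rho> \<in> rumin_forms G k \<and>
             \<eta> \<in> delta0 G ` kforms G k \<and> \<tau> \<in> delta0 G ` kforms G (Suc k) \<and>
             ext_d G \<alpha> = rumin_d G \<alpha> + ext_d G \<eta> + \<tau>)"
proof -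
  interpret gradable G by standard (rule assms(1))
  obtain m where k: "k = Suc m" using assms(2) by (cases k) auto
  have \<alpha>: "\<alpha> \<in> rumin_forms G m" using assms(3) k by simp
  then have \<alpha>k: "\<alpha> \<in> kforms G m" by (simp add: rumin_forms_def)
  have dF: "ext_d G \<alpha> \<in> forms G" by (rule ext_d_forms[OF kforms_forms[OF \<alpha>k]])
  note inv = leibniz_run_invariant[OF _ \<alpha>k]
  obtain N where N: "\<And>p \<omega>. N \<le> p \<Longrightarrow> weight_ge p \<omega> \<Longrightarrow> \<omega> = 0" using weight_ge_bounded by blast
  \<comment> \<open>Every form has weight at least 0, so the remainder after \<open>n\<close> rounds
    has weight at least \<open>n\<close>.\<close>
  have zero: "\<beta> = 0" if "N \<le> n" "leibniz_run G \<alpha> n \<rho> \<eta> \<tau> \<beta>" for n \<rho> \<eta> \<tau> \<beta>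
    using N[of "0 + n"] inv(8)[OF that(2) weight_ge_0[OF dF]] that(1) by simp
  show ?thesis
  proof (intro conjI allI impI)
    show "\<exists>N. \<forall>n\<ge>N. (\<exists>\<rho> \<eta> \<tau>. leibniz_run G \<alpha> n \<rho> \<eta> \<tau> 0) \<and>
        (\<forall>\<rho> \<eta> \<tau> \<beta>. leibniz_run G \<alpha> n \<rho> \<eta> \<tau> \<beta> \<longrightarrow> \<beta> = 0)"
      using leibniz_run_exists[OF \<alpha>k] zero by metis
  next
    fix n \<rho> \<eta> \<tau> \<beta> assume run: "leibniz_run G \<alpha> n \<rho> \<eta> \<tau> \<beta>"
    show "ext_d G \<alpha> = \<rho> + ext_d G \<eta> + \<tau> + \<beta>" by (rule inv(6)[OF run])
    show "form_weight_ge G k (p + n) \<beta>" if "form_weight_ge G k p (ext_d G \<alpha>)" for p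
      using form_weight_geI[OF inv(1)[OF run] inv(8)[OF run form_weight_ge_imp[OF that dF]]] k by simp
  next
    fix n \<rho> \<eta> \<tau> assume run: "leibniz_run G \<alpha> n \<rho> \<eta> \<tau> 0"
    show \<rho>: "\<rho> = rumin_d G \<alpha>" by (rule leibniz_run_result[OF run \<alpha>, symmetric])
    show "\<rho> \<in> rumin_forms G k" using inv(2,3)[OF run] k by (simp add: rumin_forms_def)
    show "\<eta> \<in> delta0 G ` kforms G k" "\<tau> \<in> delta0 G ` kforms G (Suc k)"
      using inv(4,5)[OF run] k by simp_all
    show "ext_d G \<alpha> = rumin_d G \<alpha> + ext_d G \<eta> + \<tau>"
      using inv(6)[OF run] \<rho> by simp
  qed
qed

end
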